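(* Let $\varphi(x,y)$ be an $I$-stable $L$-formula and let $M$ be a model. Assume that $(a,b)$ or $(b,a)$ is $M$-independent. Then for all $a'$, $b'$ such that $a\equiv_M a'$, $b\equiv_M b'$, and $(a',b')$ or $(b',a')$ is $M$-independent, $\varphi(a,b)$ holds if and only if $\varphi(a',b')$ holds.
   Context: Fix a complete first-order theory $T$ in a language $L$ with infinite models and work in a monster model $\mathbb{M}$; $x,y$ are finite tuples of variables. An ideal $I_x$ of $L_x(\mathbb{M})$-formulas is a family of formulas in $x$ with parameters closed under implication and finite disjunctions and containing the empty formula. A partial type is $I_x$-wide if it implies no formula in $I_x$; $a$ is $I_x$-wide over $A$ if $\mathrm{tp}(a/A)$ is. $I_x$ is $A$-invariant if $\psi(x,a)\in I_x$, $a\equiv_A a'$ imply $\psi(x,a')\in I_x$; an $A$-invariant ideal is $S_1$ if for every $L$-formula $\psi(x,z)$ and $A$-indiscernible $(a_i)_{i\in\mathbb{N}}$ with $\psi(x,a_0)\wedge\psi(x,a_1)\in I_x$ we get $\psi(x,a_0)\in I_x$. Fix $\emptyset$-invariant $S_1$-ideals $I_x$, $I_y$ and $I=(I_x,I_y)$. A finite sequence of tuples (each in the sort of $x$ or of $y$) is $M$-independent if the type of each entry over $M$ and the preceding entries is wide for the corresponding ideal ($I_x$ for $x$-sort entries, $I_y$ for $y$-sort entries). Here $a,a'$ are in the sort of $x$ and $b,b'$ in the sort of $y$. $\varphi(x,y)$ is $I$-stable of ladder $k$ if there are no model $M$ and tuple $(a_1,b_1,\ldots,a_k,b_k)$ with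 $(a_1,b_1,\ldots,a_k,b_k)$ or $(b_k,a_k,\ldots,b_1,a_1)$ $M$-independent and $\varphi(a_i,b_j)$ iff $i\le j$; $I$-stable means $I$-stable of some ladder $k$. *)

theory Defs
  imports Main
begin

unbundle cardinal_syntax

section \<open>Syntax\<close>

text \<open>
  A language is given by sets of function and relation symbols paired with their arities, so that
  either set may be empty; constants are function symbols of arity 0. Formulas may contain
  parameters \<open>Par m\<close> for elements \<open>m\<close> of the structure. The set functions \<open>pars_tm\<close> and \<open>pars\<close>
  generated by the datatype package collect the parameters of a term or formula.
\<close>

record ('f, 'r) lang =
  funs :: "('f \<times> nat) set"
  rels :: "('r \<times> nat) set"

datatype ('f, pars_tm: 'm) tm = Var nat | Par 'm | App 'f "('f, 'm) tm list"

datatype ('f, 'r, pars: 'm) fm =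
    Fls
  | Equ "('f, 'm) tm" "('f, 'm) tm"
  | Rel 'r "('f, 'm) tm list"
  | Neg "('f, 'r, 'm) fm"
  | Con "('f, 'r, 'm) fm" "('f, 'r, 'm) fm"
  | Dis "('f, 'r, 'm) fm" "('f, 'r, 'm) fm"
  | Exi nat "('f, 'r, 'm) fm"

fun wf_tm :: "('f, 'r) lang \<Rightarrow> ('f, 'm) tm \<Rightarrow> bool" where
  "wf_tm L (Var n) = True"
| "wf_tm L (Par m) = True"
| "wf_tm L (App f ts) = ((f, length ts) \<in> funs L \<and> (\<forall>t\<in>set ts. wf_tm L t))"

primrec wf_fm :: "('f, 'r) lang \<Rightarrow> ('f, 'r, 'm) fm \<Rightarrow> bool" where
  "wf_fm L Fls = True"
| "wf_fm L (Equ s t) = (wf_tm L s \<and> wf_tm L t)"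
| "wf_fm L (Rel r ts) = ((r, length ts) \<in> rels L \<and> (\<forall>t\<in>set ts. wf_tm L t))"
| "wf_fm L (Neg \<phi>) = wf_fm L \<phi>"
| "wf_fm L (Con \<phi> \<psi>) = (wf_fm L \<phi> \<and> wf_fm L \<psi>)"
| "wf_fm L (Dis \<phi> \<psi>) = (wf_fm L \<phi> \<and> wf_fm L \<psi>)"
| "wf_fm L (Exi n \<phi>) = wf_fm L \<phi>"

fun fv_tm :: "('f, 'm) tm \<Rightarrow> nat set" where
  "fv_tm (Var n) = {n}"
| "fv_tm (Par m) = {}"
| "fv_tm (App f ts) = (\<Union>t\<in>set ts. fv_tm t)"

primrec fv :: "('f, 'r, 'm) fm \<Rightarrow> nat set" where
  "fv Fls = {}"
| "fv (Equ s t) = fv_tm s \<union> fv_tm t"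
| "fv (Rel r ts) = (\<Union>t\<in>set ts. fv_tm t)"
| "fv (Neg \<phi>) = fv \<phi>"
| "fv (Con \<phi> \<psi>) = fv \<phi> \<union> fv \<psi>"
| "fv (Dis \<phi> \<psi>) = fv \<phi> \<union> fv \<psi>"
| "fv (Exi n \<phi>) = fv \<phi> - {n}"

text \<open>The \<open>L(A)\<close>-formulas with free variables among \<open>V\<close>.\<close>

definition formulas ::
  "('f, 'r) lang \<Rightarrow> 'm set \<Rightarrow> nat set \<Rightarrow> ('f, 'r, 'm) fm set" where
  "formulas L A V = {\<phi>. wf_fm L \<phi> \<and> pars \<phi> \<subseteq> A \<and> fv \<phi> \<subseteq> V}"

text \<open>
  \<open>inst zs c \<psi>\<close> is \<open>\<psi>(x, c)\<close>: the free variables \<open>zs\<close> of \<open>\<psi>\<close> are replaced by the parameters \<open>c\<close>.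
\<close>

primrec inst_tm :: "(nat \<Rightarrow> 'm option) \<Rightarrow> ('f, 'm) tm \<Rightarrow> ('f, 'm) tm" where
  "inst_tm s (Var n) = (case s n of None \<Rightarrow> Var n | Some m \<Rightarrow> Par m)"
| "inst_tm s (Par m) = Par m"
| "inst_tm s (App f ts) = App f (map (inst_tm s) ts)"

primrec inst_fm :: "('f, 'r, 'm) fm \<Rightarrow> (nat \<Rightarrow> 'm option) \<Rightarrow> ('f, 'r, 'm) fm" where
  "inst_fm Fls s = Fls"
| "inst_fm (Equ t u) s = Equ (inst_tm s t) (inst_tm s u)"
| "inst_fm (Rel r ts) s = Rel r (map (inst_tm s) ts)"
| "inst_fm (Neg \<phi>) s = Neg (inst_fm \<phi> s)"
| "inst_fm (Con \<phi> \<psi>) s = Con (inst_fm \<phi> s) (inst_fm \<psi> s)"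
| "inst_fm (Dis \<phi> \<psi>) s = Dis (inst_fm \<phi> s) (inst_fm \<psi> s)"
| "inst_fm (Exi n \<phi>) s = Exi n (inst_fm \<phi> (s(n := None)))"

definition inst :: "nat list \<Rightarrow> 'm list \<Rightarrow> ('f, 'r, 'm) fm \<Rightarrow> ('f, 'r, 'm) fm" where
  "inst zs c \<psi> = inst_fm \<psi> (map_of (zip zs c))"


section \<open>Semantics\<close>

text \<open>
  The universe of the ambient structure is the whole type \<open>'m\<close>. Satisfaction is relativised to a
  domain \<open>D\<close> of quantification in order to speak about substructures; \<open>sat UNIV\<close> is satisfaction
  in the ambient structure. Interpretations matter only on argument lists of the right length.
\<close>

record ('f, 'r, 'm) struct =
  funI :: "'f \<Rightarrow> 'm list \<Rightarrow> 'm"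
  relI :: "'r \<Rightarrow> 'm list \<Rightarrow> bool"

primrec tm_val :: "('f, 'r, 'm) struct \<Rightarrow> (nat \<Rightarrow> 'm) \<Rightarrow> ('f, 'm) tm \<Rightarrow> 'm" where
  "tm_val S e (Var n) = e n"
| "tm_val S e (Par m) = m"
| "tm_val S e (App f ts) = funI S f (map (tm_val S e) ts)"

primrec sat ::
  "'m set \<Rightarrow> ('f, 'r, 'm) struct \<Rightarrow> ('f, 'r, 'm) fm \<Rightarrow> (nat \<Rightarrow> 'm) \<Rightarrow> bool" where
  "sat D S Fls e = False"
| "sat D S (Equ s t) e = (tm_val S e s = tm_val S e t)"
| "sat D S (Rel r ts) e = relI S r (map (tm_val S e) ts)"
| "sat D S (Neg \<phi>) e = (\<not> sat D S \<phi> e)"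
| "sat D S (Con \<phi> \<psi>) e = (sat D S \<phi> e \<and> sat D S \<psi> e)"
| "sat D S (Dis \<phi> \<psi>) e = (sat D S \<phi> e \<or> sat D S \<psi> e)"
| "sat D S (Exi n \<phi>) e = (\<exists>m\<in>D. sat D S \<phi> (e(n := m)))"

text \<open>\<open>asg xs a\<close> assigns the tuple \<open>a\<close> to the variables \<open>xs\<close>.\<close>

definition asg :: "nat list \<Rightarrow> 'm list \<Rightarrow> nat \<Rightarrow> 'm" where
  "asg xs a n = (case map_of (zip xs a) n of None \<Rightarrow> undefined | Some m \<Rightarrow> m)"

definition holds :: "('f, 'r, 'm) struct \<Rightarrow> nat list \<Rightarrow> ('f, 'r, 'm) fm \<Rightarrow> 'm list \<Rightarrow> bool" where
  "holds S xs \<phi> a \<longleftrightarrow> sat UNIV S \<phi> (asg xs a)"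

definition entails ::
  "('f, 'r, 'm) struct \<Rightarrow> ('f, 'r, 'm) fm set \<Rightarrow> ('f, 'r, 'm) fm \<Rightarrow> bool" where
  "entails S \<Gamma> \<psi> \<longleftrightarrow> (\<forall>e. (\<forall>\<phi>\<in>\<Gamma>. sat UNIV S \<phi> e) \<longrightarrow> sat UNIV S \<psi> e)"

definition tp ::
  "('f, 'r) lang \<Rightarrow> ('f, 'r, 'm) struct \<Rightarrow> nat list \<Rightarrow> 'm list \<Rightarrow> 'm set \<Rightarrow> ('f, 'r, 'm) fm set"
  where "tp L S xs a A = {\<phi> \<in> formulas L A (set xs). holds S xs \<phi> a}"

text \<open>\<open>same_type L S A a b\<close> is \<open>a \<equiv>\<^sub>A b\<close>.\<close>

definition same_type ::
  "('f, 'r) lang \<Rightarrow> ('f, 'r, 'm) struct \<Rightarrow> 'm set \<Rightarrow> 'm list \<Rightarrow> 'm list \<Rightarrow> bool" where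
  "same_type L S A a b \<longleftrightarrow>
     length a = length b \<and> tp L S [0..<length a] a A = tp L S [0..<length b] b A"

definition elementary_substructure ::
  "('f, 'r) lang \<Rightarrow> ('f, 'r, 'm) struct \<Rightarrow> 'm set \<Rightarrow> bool" where
  "elementary_substructure L S M \<longleftrightarrow>
     M \<noteq> {} \<and>
     (\<forall>(f, n)\<in>funs L. \<forall>ms. set ms \<subseteq> M \<and> length ms = n \<longrightarrow> funI S f ms \<in> M) \<and>
     (\<forall>\<sigma>\<in>formulas L M {}. \<forall>e. sat M S \<sigma> e \<longleftrightarrow> sat UNIV S \<sigma> e)"


section \<open>Monster models\<close>

text \<open>Complete theories are taken to be deductively closed.\<close>

definition complete_theory :: "('f, 'r) lang \<Rightarrow> ('f, 'r, 'm) fm set \<Rightarrow> bool" where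
  "complete_theory L T \<longleftrightarrow>
     T \<subseteq> formulas L {} {} \<and> (\<forall>\<sigma>\<in>formulas L {} {}. \<sigma> \<in> T \<longleftrightarrow> Neg \<sigma> \<notin> T)"

definition satisfies_theory :: "('f, 'r, 'm) struct \<Rightarrow> ('f, 'r, 'm) fm set \<Rightarrow> bool" where
  "satisfies_theory S T \<longleftrightarrow> (\<forall>\<sigma>\<in>T. \<forall>e. sat UNIV S \<sigma> e)"

definition saturated :: "('f, 'r) lang \<Rightarrow> ('f, 'r, 'm) struct \<Rightarrow> 'k rel \<Rightarrow> bool" where
  "saturated L S \<kappa> \<longleftrightarrow>
     (\<forall>A V \<Gamma>. |A| <o \<kappa> \<and> finite V \<and> \<Gamma> \<subseteq> formulas L A V \<and>
        (\<forall>\<Delta>\<subseteq>\<Gamma>. finite \<Delta> \<longrightarrow> (\<exists>e. \<forall>\<phi>\<in>\<Delta>. sat UNIV S \<phi> e)) \<longrightarrow>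
        (\<exists>e. \<forall>\<phi>\<in>\<Gamma>. sat UNIV S \<phi> e))"

definition elementary_map ::
  "('f, 'r) lang \<Rightarrow> ('f, 'r, 'm) struct \<Rightarrow> 'm set \<Rightarrow> ('m \<Rightarrow> 'm) \<Rightarrow> bool" where
  "elementary_map L S A g \<longleftrightarrow> (\<forall>c. set c \<subseteq> A \<longrightarrow> same_type L S {} c (map g c))"

definition automorphism ::
  "('f, 'r) lang \<Rightarrow> ('f, 'r, 'm) struct \<Rightarrow> ('m \<Rightarrow> 'm) \<Rightarrow> bool" where
  "automorphism L S \<sigma> \<longleftrightarrow>
     bij \<sigma> \<and>
     (\<forall>(f, n)\<in>funs L. \<forall>ms. length ms = n \<longrightarrow> \<sigma> (funI S f ms) = funI S f (map \<sigma> ms)) \<and>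
     (\<forall>(r, n)\<in>rels L. \<forall>ms. length ms = n \<longrightarrow> relI S r (map \<sigma> ms) = relI S r ms)"

definition strongly_homogeneous ::
  "('f, 'r) lang \<Rightarrow> ('f, 'r, 'm) struct \<Rightarrow> 'k rel \<Rightarrow> bool" where
  "strongly_homogeneous L S \<kappa> \<longleftrightarrow>
     (\<forall>A g. |A| <o \<kappa> \<and> elementary_map L S A g \<longrightarrow>
        (\<exists>\<sigma>. automorphism L S \<sigma> \<and> (\<forall>a\<in>A. \<sigma> a = g a)))"

text \<open>
  Every set of cardinality less than \<open>\<kappa>\<close> is equipotent to a subset of \<open>Field \<kappa>\<close>, so the following
  says that \<open>\<mu> < \<kappa>\<close> implies \<open>2 ^ \<mu> < \<kappa>\<close>.
\<close>

definition strong_limit :: "'k rel \<Rightarrow> bool" where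
  "strong_limit \<kappa> \<longleftrightarrow> Card_order \<kappa> \<and> (\<forall>A\<subseteq>Field \<kappa>. |A| <o \<kappa> \<longrightarrow> |Pow A| <o \<kappa>)"

text \<open>
  As usual, the size \<open>\<kappa>\<close> of the monster model is a strong limit cardinal greater than the number of
  \<open>L\<close>-formulas, hence uncountable, and small means of cardinality less than \<open>\<kappa>\<close>.
\<close>

definition monster_model ::
  "('f, 'r) lang \<Rightarrow> ('f, 'r, 'm) fm set \<Rightarrow> 'k rel \<Rightarrow> ('f, 'r, 'm) struct \<Rightarrow> bool" where
  "monster_model L T \<kappa> S \<longleftrightarrow>
     satisfies_theory S T \<and> infinite (UNIV :: 'm set) \<and>
     strong_limit \<kappa> \<and> |formulas L {} UNIV :: ('f, 'r, 'm) fm set| <o \<kappa> \<and>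
     saturated L S \<kappa> \<and> strongly_homogeneous L S \<kappa>"

definition small_model ::
  "('f, 'r) lang \<Rightarrow> 'k rel \<Rightarrow> ('f, 'r, 'm) struct \<Rightarrow> 'm set \<Rightarrow> bool" where
  "small_model L \<kappa> S M \<longleftrightarrow> elementary_substructure L S M \<and> |M| <o \<kappa>"


section \<open>Ideals and wide types\<close>

definition ideal ::
  "('f, 'r) lang \<Rightarrow> ('f, 'r, 'm) struct \<Rightarrow> nat list \<Rightarrow> ('f, 'r, 'm) fm set \<Rightarrow> bool" where
  "ideal L S xs I \<longleftrightarrow>
     I \<subseteq> formulas L UNIV (set xs) \<and>
     Fls \<in> I \<and>
     (\<forall>\<phi>\<in>formulas L UNIV (set xs). \<forall>\<psi>\<in>I. entails S {\<phi>} \<psi> \<longrightarrow> \<phi> \<in> I) \<and>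
     (\<forall>\<phi>\<in>I. \<forall>\<psi>\<in>I. Dis \<phi> \<psi> \<in> I)"

definition invariant ::
  "('f, 'r) lang \<Rightarrow> ('f, 'r, 'm) struct \<Rightarrow> 'm set \<Rightarrow> nat list \<Rightarrow> ('f, 'r, 'm) fm set \<Rightarrow> bool" where
  "invariant L S A xs I \<longleftrightarrow>
     (\<forall>zs \<psi> c c'. distinct zs \<and> set xs \<inter> set zs = {} \<and> \<psi> \<in> formulas L {} (set xs \<union> set zs) \<and>
        length c = length zs \<and> same_type L S A c c' \<and> inst zs c \<psi> \<in> I \<longrightarrow> inst zs c' \<psi> \<in> I)"

definition indiscernible ::
  "('f, 'r) lang \<Rightarrow> ('f, 'r, 'm) struct \<Rightarrow> 'm set \<Rightarrow> (nat \<Rightarrow> 'm list) \<Rightarrow> bool" where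
  "indiscernible L S A c \<longleftrightarrow>
     (\<forall>i j. length (c i) = length (c j)) \<and>
     (\<forall>is js. sorted_wrt (<) is \<and> sorted_wrt (<) js \<and> length is = length js \<longrightarrow>
        same_type L S A (concat (map c is)) (concat (map c js)))"

definition S1_ideal ::
  "('f, 'r) lang \<Rightarrow> ('f, 'r, 'm) struct \<Rightarrow> 'm set \<Rightarrow> nat list \<Rightarrow> ('f, 'r, 'm) fm set \<Rightarrow> bool" where
  "S1_ideal L S A xs I \<longleftrightarrow>
     ideal L S xs I \<and> invariant L S A xs I \<and>
     (\<forall>zs \<psi> c. distinct zs \<and> set xs \<inter> set zs = {} \<and> \<psi> \<in> formulas L {} (set xs \<union> set zs) \<and>
        indiscernible L S A c \<and> length (c 0) = length zs \<and>
        Con (inst zs (c 0) \<psi>) (inst zs (c 1) \<psi>) \<in> I \<longrightarrow> inst zs (c 0) \<psi> \<in> I)"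

definition wide :: "('f, 'r, 'm) struct \<Rightarrow> ('f, 'r, 'm) fm set \<Rightarrow> ('f, 'r, 'm) fm set \<Rightarrow> bool"
  where "wide S I \<Gamma> \<longleftrightarrow> \<not> (\<exists>\<psi>\<in>I. entails S \<Gamma> \<psi>)"


section \<open>Independence and stability relative to a pair of ideals\<close>

text \<open>
  An entry of a sequence records whether it is in the sort of \<open>x\<close> or in the sort of \<open>y\<close>, as the two
  ideals may differ even if the tuples \<open>x\<close> and \<open>y\<close> have the same length.
\<close>

datatype 'm entry = InX (coords: "'m list") | InY (coords: "'m list")

fun wide_entry ::
  "('f, 'r) lang \<Rightarrow> ('f, 'r, 'm) struct \<Rightarrow> nat list \<Rightarrow> nat list \<Rightarrow> ('f, 'r, 'm) fm set \<Rightarrow>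
   ('f, 'r, 'm) fm set \<Rightarrow> 'm set \<Rightarrow> 'm entry \<Rightarrow> bool" where
  "wide_entry L S xs ys Ix Iy A (InX a) \<longleftrightarrow> length a = length xs \<and> wide S Ix (tp L S xs a A)"
| "wide_entry L S xs ys Ix Iy A (InY b) \<longleftrightarrow> length b = length ys \<and> wide S Iy (tp L S ys b A)"

definition independent ::
  "('f, 'r) lang \<Rightarrow> ('f, 'r, 'm) struct \<Rightarrow> nat list \<Rightarrow> nat list \<Rightarrow> ('f, 'r, 'm) fm set \<Rightarrow>
   ('f, 'r, 'm) fm set \<Rightarrow> 'm set \<Rightarrow> 'm entry list \<Rightarrow> bool" where
  "independent L S xs ys Ix Iy M cs \<longleftrightarrow>
     (\<forall>i<length cs. wide_entry L S xs ys Ix Iy (M \<union> (\<Union>j<i. set (coords (cs ! j)))) (cs ! i))"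

text \<open>The sequence \<open>(a 1, b 1, \<dots>, a k, b k)\<close>.\<close>

definition ladder :: "nat \<Rightarrow> (nat \<Rightarrow> 'm list) \<Rightarrow> (nat \<Rightarrow> 'm list) \<Rightarrow> 'm entry list" where
  "ladder k a b = concat (map (\<lambda>i. [InX (a i), InY (b i)]) [1..<Suc k])"

definition I_stable_of_ladder ::
  "('f, 'r) lang \<Rightarrow> 'k rel \<Rightarrow> ('f, 'r, 'm) struct \<Rightarrow> nat list \<Rightarrow> nat list \<Rightarrow>
   ('f, 'r, 'm) fm set \<Rightarrow> ('f, 'r, 'm) fm set \<Rightarrow> nat \<Rightarrow> ('f, 'r, 'm) fm \<Rightarrow> bool" where
  "I_stable_of_ladder L \<kappa> S xs ys Ix Iy k \<phi> \<longleftrightarrow>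
     \<not> (\<exists>M a b. small_model L \<kappa> S M \<and>
          (independent L S xs ys Ix Iy M (ladder k a b) \<or>
           independent L S xs ys Ix Iy M (rev (ladder k a b))) \<and>
          (\<forall>i\<in>{1..k}. \<forall>j\<in>{1..k}. holds S (xs @ ys) \<phi> (a i @ b j) \<longleftrightarrow> i \<le> j))"

definition I_stable ::
  "('f, 'r) lang \<Rightarrow> 'k rel \<Rightarrow> ('f, 'r, 'm) struct \<Rightarrow> nat list \<Rightarrow> nat list \<Rightarrow>
   ('f, 'r, 'm) fm set \<Rightarrow> ('f, 'r, 'm) fm set \<Rightarrow> ('f, 'r, 'm) fm \<Rightarrow> bool" where
  "I_stable L \<kappa> S xs ys Ix Iy \<phi> \<longleftrightarrow> (\<exists>k. I_stable_of_ladder L \<kappa> S xs ys Ix Iy k \<phi>)"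

end

theory Submission
  imports Defs "HOL-Library.Countable_Set"
begin

text \<open>
  Let \<open>p = tp(a/M)\<close> and \<open>q = tp(b/M)\<close>, and suppose that both truth values of \<open>\<phi>\<close> occur on
  independent realisations of \<open>p\<close> and \<open>q\<close>. For parameters \<open>u, d\<close>, wideness of
  \<open>p(x) \<and> \<psi>(x, u) \<and> \<chi>(x, d)\<close> is a stable relation between \<open>u\<close> and \<open>d\<close> by the S1-property. Hence, once
  \<open>d\<close> is wide over \<open>M u\<close>, it depends only on \<open>tp(u/M)\<close> and \<open>tp(d/M)\<close>: it can be computed at a pair in
  which \<open>u\<close> realises a coheir over \<open>M d\<close>, and coheirs generate indiscernible Morley sequences, even
  though no wide type need be invariant.

  Given an independent sequence \<open>b\<^sub>1, \<dots>, b\<^sub>k\<close> in \<open>q\<close>, stationarity therefore reduces wideness of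
  \<open>p(x)\<close> together with a prescribed pattern of truth values of \<open>\<phi>(x, b\<^sub>i)\<close> to one favourable choice of
  \<open>b\<^sub>k\<close>. Such a choice exists: building \<open>a\<^sub>0, b\<^sub>0, a\<^sub>1, b\<^sub>1, \<dots>\<close> with a constant truth value whenever the
  later element is in one sort, \<open>I\<close>-stability forces that value somewhere in the other order too. The
  same holds with the sorts exchanged, so every pattern is wide on both sides, and a ladder of any
  length can be built, contradicting \<open>I\<close>-stability.
\<close>

section \<open>Ultrafilters\<close>

text \<open>The coheir is placed on the side of the parameter tuple \<open>u\<close>, which need not
  be wide: over a model every tuple has one, and S1 spreads the wide tuple \<open>d\<close> along
  its Morley sequence. Indiscernibles always come from averages of ultrafilters rather than from
  Ramsey-type extraction. Patterns are treated in two rounds because the favourable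
  \<open>b_k\<close> has two origins. For a constant truth value it is read off a Morley sequence of
  the earlier parameters, one copy of the pattern already containing the condition on it. For mixed
  values this fails, and \<open>b_k\<close> has to precede \<open>x\<close>; that needs the value in
  the opposite order of independence, which \<open>I\<close>-stability extracts from the constant
  case. Exchange of sorts is possible because the ladder condition is kept for infinite sequences
  and both signs: dropping the first term and negating the relation turns a ladder that begins in
  one sort into one that begins in the other. Only Boolean operations and substitutions of variables
  on predicates of lists are involved, so formulas enter only when the hypotheses are
  translated.\<close>

definition ultra :: "('a \<Rightarrow> bool) set \<Rightarrow> bool" where
  "ultra U \<longleftrightarrow> (\<lambda>_. False) \<notin> U \<and>
     (\<forall>P Q. P \<in> U \<longrightarrow> Q \<in> U \<longrightarrow> (\<lambda>x. P x \<and> Q x) \<in> U) \<and>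
     (\<forall>P Q. P \<in> U \<longrightarrow> (\<forall>x. P x \<longrightarrow> Q x) \<longrightarrow> Q \<in> U) \<and>
     (\<forall>P. P \<in> U \<or> (\<lambda>x. \<not> P x) \<in> U)"

lemma ultra_conj: "ultra U \<Longrightarrow> P \<in> U \<Longrightarrow> Q \<in> U \<Longrightarrow> (\<lambda>x. P x \<and> Q x) \<in> U"
  and ultra_mono: "ultra U \<Longrightarrow> P \<in> U \<Longrightarrow> (\<And>x. P x \<Longrightarrow> Q x) \<Longrightarrow> Q \<in> U"
  and ultra_False: "ultra U \<Longrightarrow> (\<lambda>_. False) \<notin> U"
  unfolding ultra_def by blast+

lemma ultra_ex:
  assumes "ultra U" "P \<in> U" shows "\<exists>x. P x"
proof (rule ccontr)
  assume "\<nexists>x. P x"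
  then have "(\<lambda>_. False) \<in> U"
    using ultra_mono[OF assms, of "\<lambda>_. False"] by blast
  then show False using ultra_False[OF assms(1)] by blast
qed

lemma ultra_neg: "ultra U \<Longrightarrow> (\<lambda>x. \<not> P x) \<in> U \<longleftrightarrow> P \<notin> U"
  using ultra_ex[of U "\<lambda>x. P x \<and> \<not> P x"] ultra_conj[of U P "\<lambda>x. \<not> P x"]
  unfolding ultra_def by blast

lemma ultra_cong:
  assumes "ultra U" "R \<in> U" "\<And>x. R x \<Longrightarrow> P x = Q x"
  shows "P \<in> U \<longleftrightarrow> Q \<in> U"
  using ultra_mono[OF assms(1) ultra_conj[OF assms(1) _ assms(2)]] assms(3) by metis

lemma ultra_True: "ultra U \<Longrightarrow> (\<lambda>_. True) \<in> U"
  using ultra_neg[of U "\<lambda>_. False"] ultra_False[of U] by simp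

lemma ultra_const: "ultra U \<Longrightarrow> (\<lambda>_. b) \<in> U \<longleftrightarrow> b"
  using ultra_False ultra_True by (cases b) auto

lemma ultra_image:
  assumes "ultra U" shows "ultra {P. (\<lambda>x. P (f x)) \<in> U}"
  using assms unfolding ultra_def by (auto 0 3)

text \<open>Zorn's lemma for proper filters containing \<open>F\<close>. A maximal one decides every
  \<open>P\<close>: if the complement of \<open>P\<close> is missing, adjoining \<open>P\<close>
  keeps the filter proper.\<close>

lemma ultra_exists:
  fixes F :: "('a \<Rightarrow> bool) set"
  assumes ne: "F \<noteq> {}"
    and conj: "\<And>P Q. P \<in> F \<Longrightarrow> Q \<in> F \<Longrightarrow> (\<lambda>x. P x \<and> Q x) \<in> F"
    and sat: "\<And>P. P \<in> F \<Longrightarrow> \<exists>x. P x"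
  shows "\<exists>U. ultra U \<and> F \<subseteq> U"
proof -
  define filt where "filt G \<longleftrightarrow> F \<subseteq> G \<and> (\<lambda>_. False) \<notin> G \<and>
     (\<forall>P Q. P \<in> G \<longrightarrow> Q \<in> G \<longrightarrow> (\<lambda>x. P x \<and> Q x) \<in> G) \<and>
     (\<forall>P Q. P \<in> G \<longrightarrow> (\<forall>x. P x \<longrightarrow> Q x) \<longrightarrow> Q \<in> G)" for G :: "('a \<Rightarrow> bool) set"
  define G0 where "G0 = {P. \<exists>Q\<in>F. \<forall>x. Q x \<longrightarrow> P x}"
  have "F \<subseteq> G0" "(\<lambda>_. False) \<notin> G0" using sat by (auto simp: G0_def)
  moreover have "(\<lambda>x. P x \<and> Q x) \<in> G0" if PQ: "P \<in> G0" "Q \<in> G0" for P Q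
  proof -
    obtain P' Q' where "P' \<in> F" "Q' \<in> F" "\<forall>x. P' x \<longrightarrow> P x" "\<forall>x. Q' x \<longrightarrow> Q x"
      using PQ unfolding G0_def by blast
    then show ?thesis using conj[of P' Q'] by (auto simp: G0_def intro!: bexI[of _ "\<lambda>x. P' x \<and> Q' x"])
  qed
  moreover have "Q \<in> G0" if "P \<in> G0" "\<forall>x. P x \<longrightarrow> Q x" for P Q
    using that unfolding G0_def by blast
  ultimately have filt0: "filt G0" unfolding filt_def by blast
  have "\<exists>U\<in>{G. filt G}. \<forall>X\<in>{G. filt G}. U \<subseteq> X \<longrightarrow> X = U"
  proof (rule subset_Zorn)
    fix C assume C: "subset.chain {G. filt G} C"
    show "\<exists>U\<in>{G. filt G}. \<forall>X\<in>C. X \<subseteq> U"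
    proof (cases "C = {}")
      case True then show ?thesis using filt0 by blast
    next
      case False
      have f: "filt G" if "G \<in> C" for G using C that by (auto simp: subset.chain_def)
      have lin: "G \<subseteq> H \<or> H \<subseteq> G" if "G \<in> C" "H \<in> C" for G H
        using C that by (auto simp: subset_chain_def)
      have "(\<lambda>x. P x \<and> Q x) \<in> \<Union>C" if PQ: "P \<in> \<Union>C" "Q \<in> \<Union>C" for P Q
      proof -
        obtain G H where GH: "G \<in> C" "H \<in> C" "P \<in> G" "Q \<in> H" using PQ by blast
        then consider "P \<in> H" | "Q \<in> G" using lin by blast
        then show ?thesis using GH f unfolding filt_def by cases blast+
      qed
      moreover have "Q \<in> \<Union>C" if PQ: "P \<in> \<Union>C" "\<forall>x. P x \<longrightarrow> Q x" for P Q
      proof -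
        obtain G where "G \<in> C" "P \<in> G" using PQ(1) by blast
        then show ?thesis using f[of G] PQ(2) unfolding filt_def by blast
      qed
      moreover have "F \<subseteq> \<Union>C" "(\<lambda>_. False) \<notin> \<Union>C" using False f unfolding filt_def by blast+
      ultimately have "filt (\<Union>C)" unfolding filt_def by blast
      then show ?thesis by blast
    qed
  qed
  then obtain U where U: "filt U" and max: "\<And>X. filt X \<Longrightarrow> U \<subseteq> X \<Longrightarrow> X = U" by blast
  have monoU: "P \<in> U \<Longrightarrow> \<forall>x. P x \<longrightarrow> Q x \<Longrightarrow> Q \<in> U" for P Q
    using U by (simp add: filt_def)
  have "P \<in> U \<or> (\<lambda>x. \<not> P x) \<in> U" for P
  proof (rule disjCI)
    assume nP: "(\<lambda>x. \<not> P x) \<notin> U"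
    define X where "X = {Q. \<exists>R\<in>U. \<forall>x. R x \<and> P x \<longrightarrow> Q x}"
    have 1: "U \<subseteq> X" by (auto simp: X_def)
    have 2: "(\<lambda>_. False) \<notin> X"
    proof
      assume "(\<lambda>_. False) \<in> X"
      then obtain R where "R \<in> U" "\<forall>x. R x \<longrightarrow> \<not> P x" by (auto simp: X_def)
      then show False using monoU[of R "\<lambda>x. \<not> P x"] nP by blast
    qed
    have 3: "(\<lambda>x. Q x \<and> Q' x) \<in> X" if "Q \<in> X" "Q' \<in> X" for Q Q'
    proof -
      obtain R R' where R: "R \<in> U" "\<forall>x. R x \<and> P x \<longrightarrow> Q x" "R' \<in> U" "\<forall>x. R' x \<and> P x \<longrightarrow> Q' x"
        using \<open>Q \<in> X\<close> \<open>Q' \<in> X\<close> unfolding X_def by blast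
      then have "(\<lambda>x. R x \<and> R' x) \<in> U" using U unfolding filt_def by blast
      moreover have "\<forall>x. (R x \<and> R' x) \<and> P x \<longrightarrow> Q x \<and> Q' x" using R by blast
      ultimately show ?thesis unfolding X_def by (intro CollectI bexI[of _ "\<lambda>x. R x \<and> R' x"])
    qed
    have 4: "Q' \<in> X" if "Q \<in> X" "\<forall>x. Q x \<longrightarrow> Q' x" for Q Q'
      using that unfolding X_def by blast
    have "F \<subseteq> X" using 1 U by (auto simp: filt_def)
    then have "filt X" unfolding filt_def using 2 3 4 by blast
    then have "X = U" using max 1 by blast
    moreover have "P \<in> X"
      using U ne unfolding X_def filt_def by blast
    ultimately show "P \<in> U" by simp
  qed
  then have "ultra U" using U unfolding ultra_def filt_def by blast
  then show ?thesis using U by (auto simp: filt_def)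
qed

text \<open>A nonprincipal ultrafilter in the form in which it is used: a condition that holds from
  some index on is true in the limit.\<close>

lemma ultra_nat_exists: "\<exists>U :: (nat \<Rightarrow> bool) set. ultra U \<and> (\<forall>n. (\<lambda>i. n < i) \<in> U)"
proof -
  let ?F = "{P. \<exists>n::nat. P = (\<lambda>i. n < i)}"
  have "\<exists>U. ultra U \<and> ?F \<subseteq> U"
  proof (rule ultra_exists)
    fix P Q assume "P \<in> ?F" "Q \<in> ?F"
    then obtain m n where "P = (\<lambda>i. m < i)" "Q = (\<lambda>i. n < i)" by blast
    then have "(\<lambda>x. P x \<and> Q x) = (\<lambda>i. max m n < i)" by auto
    then show "(\<lambda>x. P x \<and> Q x) \<in> ?F" by blast
  qed auto
  then show ?thesis by blast
qed


section \<open>Definable predicates on tuples\<close>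

text \<open>The action of a substitution of variables. The index map \<open>f\<close> may permute,
  repeat or omit coordinates, which covers renaming, identification and dummy variables at
  once.\<close>

definition picks :: "nat \<Rightarrow> nat \<Rightarrow> ('m list \<Rightarrow> 'm list) \<Rightarrow> bool" where
  "picks n m h \<longleftrightarrow>
     (\<exists>f. (\<forall>i<m. f i < n) \<and> (\<forall>x. length x = n \<longrightarrow> h x = map (\<lambda>i. x ! f i) [0..<m]))"

lemma picks_length: "picks n m h \<Longrightarrow> length x = n \<Longrightarrow> length (h x) = m"
  by (auto simp: picks_def)

lemma picks_take: "k \<le> n \<Longrightarrow> picks n k (take k)"
  unfolding picks_def by (rule exI[of _ id]) (auto intro: nth_equalityI)

lemma picks_drop: "picks (k + n) n (drop k)"
  unfolding picks_def by (rule exI[of _ "\<lambda>i. k + i"]) (auto intro: nth_equalityI)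

lemma picks_append:
  fixes h g :: "'m list \<Rightarrow> 'm list"
  assumes "picks n m h" "picks n k g" shows "picks n (m + k) (\<lambda>x. h x @ g x)"
proof -
  obtain f1 f2 where f: "\<forall>i<m. f1 i < n" "\<forall>x. length x = n \<longrightarrow> h x = map (\<lambda>i. x ! f1 i) [0..<m]"
    "\<forall>i<k. f2 i < n" "\<forall>x. length x = n \<longrightarrow> g x = map (\<lambda>i. x ! f2 i) [0..<k]"
    using assms by (auto simp: picks_def)
  show ?thesis unfolding picks_def
  proof (intro exI[of _ "\<lambda>i. if i < m then f1 i else f2 (i - m)"] conjI allI impI)
    fix x :: "'m list" assume "length x = n"
    then have "h x = map (\<lambda>i. x ! f1 i) [0..<m]" "g x = map (\<lambda>i. x ! f2 i) [0..<k]"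
      using f by blast+
    then show "h x @ g x = map (\<lambda>i. x ! (if i < m then f1 i else f2 (i - m))) [0..<m + k]"
      by (simp only:) (rule nth_equalityI; auto simp: nth_append)
  qed (use f in auto)
qed

lemma picks_comp:
  assumes "picks n m h" "picks m k g" shows "picks n k (\<lambda>x. g (h x))"
proof -
  obtain f1 f2 where f: "\<forall>i<m. f1 i < n" "\<forall>x. length x = n \<longrightarrow> h x = map (\<lambda>i. x ! f1 i) [0..<m]"
    "\<forall>i<k. f2 i < m" "\<forall>x. length x = m \<longrightarrow> g x = map (\<lambda>i. x ! f2 i) [0..<k]"
    using assms by (auto simp: picks_def)
  show ?thesis unfolding picks_def
    by (rule exI[of _ "\<lambda>i. f1 (f2 i)"]) (use f in \<open>auto intro!: nth_equalityI\<close>)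
qed

text \<open>\<open>def0 n\<close> stands for the \<open>n\<close>-ary predicates definable without
  parameters. Quantifiers do not appear: their work is done by saturation and by the Tarski-Vaught
  property of \<open>M\<close>, both added in later locales.\<close>

locale definability =
  fixes def0 :: "nat \<Rightarrow> ('m list \<Rightarrow> bool) \<Rightarrow> bool"
  assumes def0_cong: "\<And>n P Q. def0 n P \<Longrightarrow> (\<And>x. length x = n \<Longrightarrow> P x = Q x) \<Longrightarrow> def0 n Q"
    and def0_True: "\<And>n. def0 n (\<lambda>_. True)"
    and def0_neg: "\<And>n P. def0 n P \<Longrightarrow> def0 n (\<lambda>x. \<not> P x)"
    and def0_conj: "\<And>n P Q. def0 n P \<Longrightarrow> def0 n Q \<Longrightarrow> def0 n (\<lambda>x. P x \<and> Q x)"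
    and def0_picks: "\<And>n m P h. def0 m P \<Longrightarrow> picks n m h \<Longrightarrow> def0 n (\<lambda>x. P (h x))"
begin

definition Def :: "'m set \<Rightarrow> nat \<Rightarrow> ('m list \<Rightarrow> bool) \<Rightarrow> bool" where
  "Def A n P \<longleftrightarrow> (\<exists>c Q. set c \<subseteq> A \<and> def0 (n + length c) Q \<and> (\<forall>x. length x = n \<longrightarrow> P x = Q (x @ c)))"

lemma DefI: "set c \<subseteq> A \<Longrightarrow> def0 (n + length c) Q \<Longrightarrow> (\<And>x. length x = n \<Longrightarrow> P x = Q (x @ c)) \<Longrightarrow> Def A n P"
  unfolding Def_def by blast

lemma DefE:
  assumes "Def A n P"
  obtains c Q where "set c \<subseteq> A" "def0 (n + length c) Q" "\<And>x. length x = n \<Longrightarrow> P x = Q (x @ c)"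
  using assms unfolding Def_def by blast

lemma Def_mono: "Def A n P \<Longrightarrow> A \<subseteq> B \<Longrightarrow> Def B n P"
  unfolding Def_def by blast

lemma Def_UNIV: "Def A n P \<Longrightarrow> Def UNIV n P"
  by (erule Def_mono) simp

lemma Def_cong: "Def A n P \<Longrightarrow> (\<And>x. length x = n \<Longrightarrow> P x = Q x) \<Longrightarrow> Def A n Q"
  unfolding Def_def by simp

lemma Def_0: "def0 n P \<Longrightarrow> Def A n P"
  by (rule DefI[of "[]" _ _ P]) auto

lemma Def_True: "Def A n (\<lambda>_. True)"
  by (rule Def_0[OF def0_True])

lemma Def_neg: "Def A n P \<Longrightarrow> Def A n (\<lambda>x. \<not> P x)"
  by (erule DefE, rule DefI, assumption, erule def0_neg) simp

lemma Def_conj: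
  assumes "Def A n P" "Def A n Q" shows "Def A n (\<lambda>x. P x \<and> Q x)"
proof -
  obtain c P' where c: "set c \<subseteq> A" "def0 (n + length c) P'" "\<And>x. length x = n \<Longrightarrow> P x = P' (x @ c)"
    using assms(1) by (rule DefE) blast
  obtain d Q' where d: "set d \<subseteq> A" "def0 (n + length d) Q'" "\<And>x. length x = n \<Longrightarrow> Q x = Q' (x @ d)"
    using assms(2) by (rule DefE) blast
  let ?n = "n + length c + length d"
  have "picks ?n (n + length c) (take (n + length c))" by (rule picks_take) simp
  moreover have "picks ?n (n + length d) (\<lambda>x. take n x @ drop (n + length c) x)"
    by (rule picks_append[OF picks_take picks_drop]) simp
  ultimately have "def0 ?n (\<lambda>x. P' (take (n + length c) x) \<and> Q' (take n x @ drop (n + length c) x))"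
    using c(2) d(2) by (intro def0_conj) (rule def0_picks; assumption)+
  then show ?thesis
    using c d by (intro DefI[of "c @ d"]) (auto simp: add.assoc)
qed

lemma Def_all_less: "(\<And>i. i < k \<Longrightarrow> Def A n (P i)) \<Longrightarrow> Def A n (\<lambda>x. \<forall>i<k. P i x)" for k :: nat
proof (induction k)
  case (Suc k)
  then have "Def A n (\<lambda>x. (\<forall>i<k. P i x) \<and> P k x)" by (simp add: Def_conj)
  then show ?case by (rule Def_cong) (auto simp: less_Suc_eq)
qed (simp add: Def_True)

lemma Def_eq_bool: "Def A n P \<Longrightarrow> Def A n (\<lambda>x. P x = b)"
  by (cases b) (auto intro: Def_neg)

lemma Def_picks:
  assumes "Def A m P" "picks n m h" shows "Def A n (\<lambda>x. P (h x))"
proof -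
  obtain c Q where c: "set c \<subseteq> A" "def0 (m + length c) Q" "\<And>x. length x = m \<Longrightarrow> P x = Q (x @ c)"
    using assms(1) by (rule DefE) blast
  have "picks (n + length c) (m + length c) (\<lambda>x. h (take n x) @ drop n x)"
    by (intro picks_append picks_comp[OF picks_take assms(2)] picks_drop) simp
  then show ?thesis
    by (intro DefI[OF c(1) def0_picks[OF c(2)]]) (auto simp: c(3) picks_length[OF assms(2)])
qed

lemma Def_inst:
  assumes "Def A (n + length c) P" "set c \<subseteq> A" shows "Def A n (\<lambda>x. P (x @ c))"
proof -
  obtain d Q where d: "set d \<subseteq> A" "def0 (n + length c + length d) Q"
    "\<And>x. length x = n + length c \<Longrightarrow> P x = Q (x @ d)"
    using assms(1) by (rule DefE) blast
  then show ?thesis using assms(2) by (intro DefI[of "c @ d"]) (auto simp: add.assoc)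
qed

lemma Def_inst_left:
  assumes "Def A (length c + n) P" "set c \<subseteq> A" shows "Def A n (\<lambda>x. P (c @ x))"
proof -
  have "Def A (n + length c) (\<lambda>x. P (drop n x @ take n x))"
    by (rule Def_picks[OF assms(1)]) (simp add: picks_append picks_drop picks_take)
  from Def_inst[OF this assms(2)] show ?thesis
    by (rule Def_cong) simp
qed

section \<open>Types of tuples and indiscernible sequences\<close>

definition ty :: "'m set \<Rightarrow> 'm list \<Rightarrow> 'm list \<Rightarrow> bool" where
  "ty A v w \<longleftrightarrow> length v = length w \<and> (\<forall>P. Def A (length v) P \<longrightarrow> P v = P w)"

lemma ty_D: "ty A v w \<Longrightarrow> Def A (length v) P \<Longrightarrow> P v = P w"
  by (simp add: ty_def)

lemma ty_length: "ty A v w \<Longrightarrow> length v = length w"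
  by (simp add: ty_def)

lemma ty_refl: "ty A v v"
  by (simp add: ty_def)

lemma ty_sym: "ty A v w \<Longrightarrow> ty A w v"
  by (auto simp: ty_def)

lemma ty_trans: "ty A u v \<Longrightarrow> ty A v w \<Longrightarrow> ty A u w"
  unfolding ty_def by metis

lemma ty_mono: "ty B v w \<Longrightarrow> A \<subseteq> B \<Longrightarrow> ty A v w"
  unfolding ty_def by (meson Def_mono)

text \<open>Both \<open>w\<close> and \<open>w'\<close> arise by one and the same substitution of
  variables from \<open>v @ c\<close> and \<open>v' @ c\<close>, where \<open>c\<close> lists the
  common coordinates taken from \<open>A\<close>. With the hypothesis phrased by zipped lists,
  swapping, splitting and repeating blocks becomes a matter of set inclusion.\<close>

lemma ty_zip:
  assumes ty: "ty A v v'" and len: "length w = length w'"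
    and zip: "set (zip w w') \<subseteq> set (zip v v') \<union> Id_on A"
  shows "ty A w w'"
proof -
  define c where "c = map fst (filter (\<lambda>(x, y). x = y \<and> x \<in> A) (zip w w'))"
  have c: "set c \<subseteq> A" by (auto simp: c_def)
  define V where "V = v @ c" define V' where "V' = v' @ c"
  have lv: "length v = length v'" using ty by (rule ty_length)
  have lV: "length V = length V'" by (simp add: V_def V'_def lv)
  have "\<exists>j<length V. w ! i = V ! j \<and> w' ! i = V' ! j" if i: "i < length w" for i
  proof -
    have "(w ! i, w' ! i) \<in> set (zip w w')" using i len by (auto simp: set_zip)
    then consider "(w ! i, w' ! i) \<in> set (zip v v')" | "w ! i = w' ! i" "w ! i \<in> A" using zip by auto
    then show ?thesis
    proof cases
      case 1
      then obtain j where "j < length v" "w ! i = v ! j" "w' ! i = v' ! j" by (auto simp: set_zip)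
      then show ?thesis using lv by (auto simp: V_def V'_def nth_append)
    next
      case 2
      then have "w ! i \<in> set c"
        using \<open>(w ! i, w' ! i) \<in> set (zip w w')\<close> by (force simp: c_def)
      then obtain j where "j < length c" "w ! i = c ! j" by (metis in_set_conv_nth)
      then show ?thesis using lv 2 nth_append_length_plus[of v c j] nth_append_length_plus[of v' c j]
        by (intro exI[of _ "length v + j"]) (auto simp: V_def V'_def)
    qed
  qed
  then obtain f where f: "\<And>i. i < length w \<Longrightarrow> f i < length V \<and> w ! i = V ! f i \<and> w' ! i = V' ! f i"
    by metis
  define h where "h = (\<lambda>x :: 'm list. map (\<lambda>i. x ! f i) [0..<length w])"
  have h: "picks (length V) (length w) h" using f by (auto simp: picks_def h_def)
  have w: "w = h V" "w' = h V'" using f len by (auto simp: h_def intro: nth_equalityI)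
  show ?thesis unfolding ty_def
  proof (intro conjI allI impI)
    fix P assume P: "Def A (length w) P"
    have "Def A (length v + length c) (\<lambda>x. P (h x))" using Def_picks[OF P h] by (simp add: V_def)
    from ty_D[OF ty Def_inst[OF this c]] show "P w = P w'" by (simp add: w V_def V'_def)
  qed (fact len)
qed

lemma ty_appendD:
  assumes "ty A (v @ w) (v' @ w')" "length v = length v'"
  shows "ty A v v'" "ty A w w'"
proof -
  have "length w = length w'" using ty_length[OF assms(1)] assms(2) by simp
  then show "ty A v v'" "ty A w w'" using assms(2) by (auto intro: ty_zip[OF assms(1)])
qed

lemma ty_swap:
  assumes "ty A (v @ w) (v' @ w')" "length v = length v'" shows "ty A (w @ v) (w' @ v')"
  using assms ty_length[OF assms(1)] by (intro ty_zip[OF assms(1)]) auto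

lemma ty_param:
  assumes "ty A v v'" "set c \<subseteq> A" shows "ty {} (v @ c) (v' @ c)"
proof -
  have "set (zip c c) \<subseteq> Id_on A" using assms(2) by (auto simp: zip_same_conv_map)
  then have "ty A (v @ c) (v' @ c)"
    using ty_length[OF assms(1)] by (intro ty_zip[OF assms(1)]) auto
  then show ?thesis by (rule ty_mono) simp
qed

definition indisc :: "'m set \<Rightarrow> (nat \<Rightarrow> 'm list) \<Rightarrow> bool" where
  "indisc A c \<longleftrightarrow>
     (\<forall>i j. length (c i) = length (c j)) \<and>
     (\<forall>is js. sorted_wrt (<) is \<and> sorted_wrt (<) js \<and> length is = length js \<longrightarrow>
        ty A (concat (map c is)) (concat (map c js)))"

text \<open>Replacing each index \<open>i\<close> by \<open>2 * i\<close> and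
  \<open>2 * i + 1\<close> keeps an increasing index list increasing. Grouping is what lets the
  two-term S1 axiom be iterated, and later it places two points of a sequence in one term.\<close>

lemma indisc_pairs:
  assumes "indisc A c" shows "indisc A (\<lambda>i. c (2 * i) @ c (Suc (2 * i)))"
proof -
  define d where "d = (\<lambda>is. concat (map (\<lambda>i. [2 * i, Suc (2 * i)]) is) :: nat list)"
  have eq: "concat (map (\<lambda>i. c (2 * i) @ c (Suc (2 * i))) is) = concat (map c (d is))" for "is"
    by (induction "is") (auto simp: d_def)
  have srt: "sorted_wrt (<) (d is)" if "sorted_wrt (<) is" for "is"
    using that by (induction "is") (force simp: d_def)+
  have len: "length (d is) = 2 * length is" for "is" by (induction "is") (auto simp: d_def)
  have l: "\<forall>i j. length (c i) = length (c j)" using assms by (simp add: indisc_def)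
  have "ty A (concat (map c (d is))) (concat (map c (d js)))"
    if "sorted_wrt (<) is" "sorted_wrt (<) js" "length is = length js" for "is" js
  proof -
    have "length (d is) = length (d js)" using len that(3) by simp
    then show ?thesis using assms srt[OF that(1)] srt[OF that(2)] unfolding indisc_def by blast
  qed
  moreover have "length (c (2 * i) @ c (Suc (2 * i))) = length (c (2 * j) @ c (Suc (2 * j)))" for i j
    using l by (metis length_append)
  ultimately show ?thesis unfolding indisc_def eq by blast
qed

lemma set_zip_concat:
  assumes "\<forall>i j. length (c i) = length (c j)" "length is = length js"
  shows "set (zip (concat (map c is)) (concat (map c js))) =
         (\<Union>k<length is. set (zip (c (is ! k)) (c (js ! k))))"
  using assms(2)
proof (induction "is" js rule: list_induct2)
  case (Cons i "is" j js)
  have "length (c i) = length (c j)" using assms(1) by blast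
  then show ?case using Cons by (simp add: lessThan_Suc_eq_insert_0)
qed simp

text \<open>A constant block from \<open>A\<close> is attached to every term. This moves the
  parameters of a predicate into the sequence, where the S1 axiom, which is stated over the empty
  set, can see them.\<close>

lemma indisc_param:
  assumes "indisc A c" "set m \<subseteq> A" shows "indisc {} (\<lambda>i. c i @ m)"
proof -
  have l: "\<forall>i j. length (c i) = length (c j)" using assms by (simp add: indisc_def)
  then have l': "\<forall>i j. length (c i @ m) = length (c j @ m)" by (metis length_append)
  have "ty A (concat (map (\<lambda>i. c i @ m) is)) (concat (map (\<lambda>i. c i @ m) js))"
    if "sorted_wrt (<) is" "sorted_wrt (<) js" "length is = length js" for "is" js
  proof (rule ty_zip)
    show "ty A (concat (map c is)) (concat (map c js))"
      using assms(1) that by (simp add: indisc_def)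
    have "map (length \<circ> (\<lambda>i. c i @ m)) is = map (length \<circ> (\<lambda>i. c i @ m)) js"
      using l that(3) by (intro nth_equalityI) auto
    then show "length (concat (map (\<lambda>i. c i @ m) is)) = length (concat (map (\<lambda>i. c i @ m) js))"
      by (simp add: length_concat)
    have "set (zip (c i @ m) (c j @ m)) = set (zip (c i) (c j)) \<union> set (zip m m)" for i j
      using l by simp
    moreover have "set (zip m m) \<subseteq> Id_on A" using assms(2) by (auto simp: zip_same_conv_map)
    ultimately show "set (zip (concat (map (\<lambda>i. c i @ m) is)) (concat (map (\<lambda>i. c i @ m) js)))
        \<subseteq> set (zip (concat (map c is)) (concat (map c js))) \<union> Id_on A"
      unfolding set_zip_concat[OF l that(3)] set_zip_concat[OF l' that(3)] by blast
  qed
  then show ?thesis using l' unfolding indisc_def by (blast intro: ty_mono)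
qed

end


section \<open>S1-ideals of definable predicates\<close>

lemma all_less_double: "(\<forall>i<2 * m. Q i) \<longleftrightarrow> (\<forall>i<m. Q (2 * i) \<and> Q (Suc (2 * i)))" for m :: nat
  by (induction m) (auto simp: All_less_Suc)

context definability
begin

text \<open>\<open>N P\<close> means that \<open>P\<close> is null, that is, defined by a formula of
  the ideal. Since \<open>N\<close> takes arbitrary properties of lists, one clause identifies those
  that agree on length \<open>n\<close>, and the monotonicity clause asks that the smaller property
  be definable. The last two clauses are invariance and the S1 axiom over the empty set.\<close>

definition S1 :: "nat \<Rightarrow> (('m list \<Rightarrow> bool) \<Rightarrow> bool) \<Rightarrow> bool" where
  "S1 n N \<longleftrightarrow> N (\<lambda>_. False) \<and>
     (\<forall>P Q. N P \<longrightarrow> (\<forall>x. length x = n \<longrightarrow> P x = Q x) \<longrightarrow> N Q) \<and>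
     (\<forall>P Q. Def UNIV n P \<longrightarrow> N Q \<longrightarrow> (\<forall>x. length x = n \<longrightarrow> P x \<longrightarrow> Q x) \<longrightarrow> N P) \<and>
     (\<forall>P Q. N P \<longrightarrow> N Q \<longrightarrow> N (\<lambda>x. P x \<or> Q x)) \<and>
     (\<forall>P c c'. def0 (n + length c) P \<longrightarrow> ty {} c c' \<longrightarrow> N (\<lambda>x. P (x @ c)) \<longrightarrow> N (\<lambda>x. P (x @ c'))) \<and>
     (\<forall>P c. def0 (n + length (c 0)) P \<longrightarrow> indisc {} c \<longrightarrow>
        N (\<lambda>x. P (x @ c 0) \<and> P (x @ c 1)) \<longrightarrow> N (\<lambda>x. P (x @ c 0)))"

context
  fixes n :: nat and N :: "('m list \<Rightarrow> bool) \<Rightarrow> bool"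
  assumes S1: "S1 n N"
begin

lemma null_False: "N (\<lambda>_. False)"
  using S1 by (simp add: S1_def)

lemma null_cong: "(\<And>x. length x = n \<Longrightarrow> P x = Q x) \<Longrightarrow> N P = N Q"
  using S1 unfolding S1_def by metis

lemma null_mono: "Def A n P \<Longrightarrow> N Q \<Longrightarrow> (\<And>x. length x = n \<Longrightarrow> P x \<Longrightarrow> Q x) \<Longrightarrow> N P"
  using S1 Def_UNIV[of A n P] unfolding S1_def by metis

lemma null_disj: "N P \<Longrightarrow> N Q \<Longrightarrow> N (\<lambda>x. P x \<or> Q x)"
  using S1 by (simp add: S1_def)

text \<open>The parameters \<open>m\<close> of \<open>P\<close> are absorbed into the tuple:
  \<open>c @ m\<close> and \<open>c' @ m\<close> have the same type over the empty set, where
  invariance applies. Symmetry of \<open>ty\<close> turns the implication into an equality.\<close>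

lemma null_ty:
  assumes P: "Def A (n + length c) P" and ty: "ty A c c'"
  shows "N (\<lambda>x. P (x @ c)) = N (\<lambda>x. P (x @ c'))"
proof -
  have "N (\<lambda>x. P (x @ c'))" if P: "Def A (n + length c) P" and ty: "ty A c c'" and N: "N (\<lambda>x. P (x @ c))"
    for P c c'
  proof -
    obtain m Q where Q: "set m \<subseteq> A" "def0 (n + length c + length m) Q"
      "\<And>x. length x = n + length c \<Longrightarrow> P x = Q (x @ m)"
      using P by (rule DefE) blast
    have "N (\<lambda>x. Q (x @ (c @ m)))"
      using N Q(3) null_cong[of "\<lambda>x. P (x @ c)" "\<lambda>x. Q (x @ (c @ m))"] by simp
    moreover have "def0 (n + length (c @ m)) Q" using Q(2) by (simp add: add.assoc)
    moreover have "def0 (n + length c) P \<Longrightarrow> ty {} c c' \<Longrightarrow> N (\<lambda>x. P (x @ c)) \<Longrightarrow> N (\<lambda>x. P (x @ c'))"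
      for P c c' using S1 unfolding S1_def by blast
    ultimately have "N (\<lambda>x. Q (x @ (c' @ m)))"
      using ty_param[OF ty Q(1)] by blast
    then show ?thesis
      using Q(3) null_cong[of "\<lambda>x. P (x @ c')" "\<lambda>x. Q (x @ (c' @ m))"] ty_length[OF ty] by simp
  qed
  from this[OF P ty] this[of c' P c] show ?thesis
    using P ty ty_sym[OF ty] ty_length[OF ty] by auto
qed

lemma null_S1:
  assumes P: "Def A (n + length (c 0)) P" and c: "indisc A c"
    and N: "N (\<lambda>x. P (x @ c 0) \<and> P (x @ c 1))"
  shows "N (\<lambda>x. P (x @ c 0))"
proof -
  obtain m Q where Q: "set m \<subseteq> A" "def0 (n + length (c 0) + length m) Q"
    "\<And>x. length x = n + length (c 0) \<Longrightarrow> P x = Q (x @ m)"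
    using P by (rule DefE) blast
  have l: "length (c 1) = length (c 0)" using c unfolding indisc_def by blast
  have "N (\<lambda>x. Q (x @ (c 0 @ m)) \<and> Q (x @ (c 1 @ m)))"
    using N Q(3) l null_cong[of "\<lambda>x. P (x @ c 0) \<and> P (x @ c 1)"
        "\<lambda>x. Q (x @ (c 0 @ m)) \<and> Q (x @ (c 1 @ m))"] by simp
  moreover have "def0 (n + length (c 0 @ m)) Q" using Q(2) by (simp add: add.assoc)
  moreover have "def0 (n + length (c 0)) P \<Longrightarrow> indisc {} c \<Longrightarrow>
        N (\<lambda>x. P (x @ c 0) \<and> P (x @ c 1)) \<Longrightarrow> N (\<lambda>x. P (x @ c 0))" for P c
    using S1 unfolding S1_def by blast
  from this[of "\<lambda>i. c i @ m" Q] have "def0 (n + length (c 0 @ m)) Q \<Longrightarrow>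
        N (\<lambda>x. Q (x @ (c 0 @ m)) \<and> Q (x @ (c 1 @ m))) \<Longrightarrow> N (\<lambda>x. Q (x @ (c 0 @ m)))"
    using indisc_param[OF c Q(1)] by simp
  ultimately have "N (\<lambda>x. Q (x @ (c 0 @ m)))" by blast
  then show ?thesis
    using Q(3) null_cong[of "\<lambda>x. P (x @ c 0)" "\<lambda>x. Q (x @ (c 0 @ m))"] by simp
qed

text \<open>Induction by doubling: grouping consecutive terms turns a conjunction over
  \<open>2 ^ Suc j\<close> terms into one over \<open>2 ^ j\<close> pairs. The induction hypothesis
  leaves a single pair, which is the S1 axiom itself.\<close>

lemma null_S1_power:
  assumes "Def A (n + length (c 0)) P" and "indisc A c" and "N (\<lambda>x. \<forall>i<2 ^ j. P (x @ c i))"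
  shows "N (\<lambda>x. P (x @ c 0))"
  using assms
proof (induction j arbitrary: c P)
  case 0
  then show ?case by simp
next
  case (Suc j)
  define k where "k = length (c 0)"
  have l: "length (c i) = k" for i
    using Suc.prems(2) unfolding indisc_def k_def by blast
  define c' where "c' i = c (2 * i) @ c (Suc (2 * i))" for i
  define P' where "P' w \<longleftrightarrow> P (take (n + k) w) \<and> P (take n w @ drop (n + k) w)" for w
  have P: "Def A (n + k) P" using Suc.prems(1) by (simp add: k_def)
  have "Def A (n + length (c' 0)) P'"
  proof -
    have "picks (n + k + k) (n + k) (\<lambda>w. take n w @ drop (n + k) w)"
      by (rule picks_append[OF picks_take picks_drop]) simp
    then have "Def A (n + k + k) P'"
      unfolding P'_def by (intro Def_conj Def_picks[OF P] picks_take) auto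
    then show ?thesis by (simp add: c'_def l add.assoc)
  qed
  moreover have "indisc A c'"
    unfolding c'_def by (rule indisc_pairs) fact
  moreover have "N (\<lambda>x. \<forall>i<2 ^ j. P' (x @ c' i))"
  proof -
    have "(\<forall>i<2 ^ j. P' (x @ c' i)) = (\<forall>i<2 ^ Suc j. P (x @ c i))" if x: "length x = n" for x
    proof -
      have "P' (x @ c' i) \<longleftrightarrow> P (x @ c (2 * i)) \<and> P (x @ c (Suc (2 * i)))" for i
        using x by (simp add: P'_def c'_def l)
      then show ?thesis by (simp add: all_less_double)
    qed
    then show ?thesis
      by (rule null_cong[THEN iffD2, OF _ Suc.prems(3)])
  qed
  ultimately have "N (\<lambda>x. P' (x @ c' 0))" by (rule Suc.IH)
  then have "N (\<lambda>x. P (x @ c 0) \<and> P (x @ c 1))"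
    by (rule null_cong[THEN iffD1, rotated]) (simp add: P'_def c'_def l)
  then show ?case using null_S1 Suc.prems by blast
qed

text \<open>Since \<open>k < 2 ^ k\<close>, lengthening the conjunction to a power of two only
  shrinks the property, so it stays null.\<close>

lemma null_S1_less:
  assumes P: "Def A (n + length (c 0)) P" and c: "indisc A c" and N: "N (\<lambda>x. \<forall>i<k. P (x @ c i))"
  shows "N (\<lambda>x. P (x @ c 0))"
proof -
  have l: "length (c i) = length (c 0)" for i
    using c unfolding indisc_def by blast
  have "Def UNIV n (\<lambda>x. P (x @ c i))" for i
    by (rule Def_inst) (use Def_UNIV[OF P] l[of i] in auto)
  then have "Def UNIV n (\<lambda>x. \<forall>i<2 ^ k. P (x @ c i))" by (rule Def_all_less)
  then have "N (\<lambda>x. \<forall>i<2 ^ k. P (x @ c i))"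
    using N by (rule null_mono) (meson less_exp less_trans)
  then show ?thesis using null_S1_power P c by blast
qed

end

section \<open>Wide tuples and their realisation\<close>

definition wide :: "(('m list \<Rightarrow> bool) \<Rightarrow> bool) \<Rightarrow> nat \<Rightarrow> 'm set \<Rightarrow> 'm list \<Rightarrow> bool" where
  "wide N n A a \<longleftrightarrow> length a = n \<and> (\<forall>P. Def A n P \<longrightarrow> P a \<longrightarrow> \<not> N P)"

lemma wide_mono: "wide N n B a \<Longrightarrow> A \<subseteq> B \<Longrightarrow> wide N n A a"
  unfolding wide_def by (meson Def_mono)

lemma wideD: "wide N n A a \<Longrightarrow> Def A n P \<Longrightarrow> P a \<Longrightarrow> \<not> N P"
  unfolding wide_def by blast

lemma wide_length: "wide N n A a \<Longrightarrow> length a = n"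
  unfolding wide_def by blast

end

locale saturated_definability = definability def0 for def0 :: "nat \<Rightarrow> ('m list \<Rightarrow> bool) \<Rightarrow> bool" +
  fixes small :: "'m set \<Rightarrow> bool"
  assumes small_Un: "\<And>A B. small A \<Longrightarrow> countable B \<Longrightarrow> small (A \<union> B)"
    and saturation: "\<And>A F n. small A \<Longrightarrow> (\<And>P. P \<in> F \<Longrightarrow> Def A n P) \<Longrightarrow>
      (\<And>G. finite G \<Longrightarrow> G \<subseteq> F \<Longrightarrow> \<exists>x. length x = n \<and> (\<forall>P\<in>G. P x)) \<Longrightarrow>
      \<exists>x. length x = n \<and> (\<forall>P\<in>F. P x)"
begin

text \<open>Saturation is applied to \<open>F\<close> together with the complements of all null sets
  definable over \<open>B\<close>. Finitely many of these conditions follow from one member of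
  \<open>F\<close> outside one null set, and a set that is not null cannot be covered by a null
  one.\<close>

lemma wide_realize:
  assumes S1: "S1 n N" and small: "small B" and ne: "F \<noteq> {}"
    and Def: "\<And>P. P \<in> F \<Longrightarrow> Def B n P"
    and conj: "\<And>P Q. P \<in> F \<Longrightarrow> Q \<in> F \<Longrightarrow> (\<lambda>x. P x \<and> Q x) \<in> F"
    and pos: "\<And>P. P \<in> F \<Longrightarrow> \<not> N P"
  shows "\<exists>v. wide N n B v \<and> (\<forall>P\<in>F. P v)"
proof -
  let ?F = "F \<union> {P. Def B n P \<and> N (\<lambda>x. \<not> P x)}"
  have "\<exists>x. length x = n \<and> (\<forall>P\<in>?F. P x)"
  proof (rule saturation[OF small])
    show "P \<in> ?F \<Longrightarrow> Def B n P" for P using Def by auto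
    fix G assume "finite G" "G \<subseteq> ?F"
    then have "\<exists>P\<in>F. \<exists>Q. N Q \<and> (\<forall>x. P x \<longrightarrow> \<not> Q x \<longrightarrow> (\<forall>R\<in>G. R x))"
    proof (induction G)
      case empty
      then show ?case using ne null_False[OF S1] by auto
    next
      case (insert R G)
      then obtain P Q where PQ: "P \<in> F" "N Q" "\<forall>x. P x \<longrightarrow> \<not> Q x \<longrightarrow> (\<forall>R\<in>G. R x)" by auto
      consider "R \<in> F" | "N (\<lambda>x. \<not> R x)" using insert.prems by auto
      then show ?case
      proof cases
        case 1
        then show ?thesis using PQ conj[OF PQ(1) 1] by (intro bexI[of _ "\<lambda>x. P x \<and> R x"] exI[of _ Q]) auto
      next
        case 2
        then show ?thesis using PQ null_disj[OF S1 PQ(2) 2]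
          by (intro bexI[of _ P] exI[of _ "\<lambda>x. Q x \<or> \<not> R x"]) auto
      qed
    qed
    then obtain P Q where PQ: "P \<in> F" "N Q" "\<forall>x. P x \<longrightarrow> \<not> Q x \<longrightarrow> (\<forall>R\<in>G. R x)" by blast
    have "\<exists>x. length x = n \<and> P x \<and> \<not> Q x"
      using null_mono[OF S1 Def[OF PQ(1)] PQ(2)] pos[OF PQ(1)] by blast
    then show "\<exists>x. length x = n \<and> (\<forall>R\<in>G. R x)" using PQ(3) by blast
  qed
  then obtain v where v: "length v = n" "\<And>P. P \<in> F \<Longrightarrow> P v" "\<And>P. Def B n P \<Longrightarrow> N (\<lambda>x. \<not> P x) \<Longrightarrow> P v"
    by blast
  have "wide N n B v" unfolding wide_def
  proof (intro conjI allI impI notI)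
    fix P assume "Def B n P" "P v" "N P"
    then show False using v(3)[of "\<lambda>x. \<not> P x"] by (simp add: Def_neg)
  qed (fact v(1))
  then show ?thesis using v(2) by blast
qed

text \<open>The case of \<open>wide_realize\<close> where \<open>F\<close> is the type of
  \<open>b\<close> over \<open>A\<close>: wideness of \<open>b\<close> says precisely that its
  members are not null.\<close>

lemma wide_extend:
  assumes S1: "S1 n N" and small: "small B" and "A \<subseteq> B" and wide: "wide N n A b"
  obtains b' where "wide N n B b'" "ty A b b'"
proof -
  let ?F = "{P. Def A n P \<and> P b}"
  have "\<exists>b'. wide N n B b' \<and> (\<forall>P\<in>?F. P b')"
  proof (rule wide_realize[OF S1 small, of ?F])
    show "?F \<noteq> {}" using Def_True by blast
    show "P \<in> ?F \<Longrightarrow> Def B n P" for P using \<open>A \<subseteq> B\<close> by (auto intro: Def_mono)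
    show "P \<in> ?F \<Longrightarrow> \<not> N P" for P using wide by (auto dest: wideD)
    show "(\<lambda>x. P x \<and> Q x) \<in> ?F" if "P \<in> ?F" "Q \<in> ?F" for P Q using that by (auto intro: Def_conj)
  qed
  then obtain b' where b': "wide N n B b'" "\<And>P. P \<in> ?F \<Longrightarrow> P b'" by blast
  have len: "length b = n" "length b' = n" using wide b'(1) by (auto dest: wide_length)
  have "ty A b b'" unfolding ty_def
  proof (intro conjI allI impI)
    fix P assume P: "Def A (length b) P"
    show "P b = P b'" using b'(2)[of P] b'(2)[of "\<lambda>x. \<not> P x"] P len by (auto simp: Def_neg)
  qed (simp add: len)
  then show thesis using b'(1) that by blast
qed


section \<open>Ultrafilters on tuples and Morley sequences\<close>

text \<open>\<open>v\<close> realises over \<open>A\<close> the average type of \<open>U\<close>. An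
  ultrafilter on tuples thus serves as a global type, with a restriction to every parameter
  set.\<close>

definition realizes :: "('m list \<Rightarrow> bool) set \<Rightarrow> 'm set \<Rightarrow> nat \<Rightarrow> 'm list \<Rightarrow> bool" where
  "realizes U A l v \<longleftrightarrow> length v = l \<and> (\<forall>P. Def A l P \<longrightarrow> P v = (P \<in> U))"

lemma realizes_mono: "realizes U B l v \<Longrightarrow> A \<subseteq> B \<Longrightarrow> realizes U A l v"
  unfolding realizes_def by (meson Def_mono)

lemma realizes_length: "realizes U A l v \<Longrightarrow> length v = l"
  by (simp add: realizes_def)

lemma realizesD: "realizes U A l v \<Longrightarrow> Def A l P \<Longrightarrow> P v = (P \<in> U)"
  by (simp add: realizes_def)

definition ultra_on :: "nat \<Rightarrow> 'm set \<Rightarrow> ('m list \<Rightarrow> bool) set \<Rightarrow> bool" where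
  "ultra_on l A U \<longleftrightarrow> ultra U \<and> (\<lambda>v. length v = l \<and> set v \<subseteq> A) \<in> U"

lemma realizes_exists:
  assumes small: "small A" and U: "ultra_on l B U"
  obtains v where "realizes U A l v"
proof -
  let ?F = "{P. Def A l P \<and> P \<in> U}"
  have ultra: "ultra U" and len: "(\<lambda>v. length v = l) \<in> U"
    using U by (auto simp: ultra_on_def elim: ultra_mono)
  have "\<exists>x. length x = l \<and> (\<forall>P\<in>?F. P x)"
  proof (rule saturation[OF small])
    fix G assume "finite G" "G \<subseteq> ?F"
    then have "(\<lambda>v. length v = l \<and> (\<forall>P\<in>G. P v)) \<in> U"
    proof (induction G)
      case (insert P G)
      then have "(\<lambda>v. P v \<and> (length v = l \<and> (\<forall>P\<in>G. P v))) \<in> U" by (intro ultra_conj[OF ultra, of P]) auto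
      then show ?case by (rule ultra_mono[OF ultra]) auto
    qed (simp add: len)
    then show "\<exists>x. length x = l \<and> (\<forall>P\<in>G. P x)" by (rule ultra_ex[OF ultra])
  qed auto
  then obtain v where v: "length v = l" "\<And>P. Def A l P \<Longrightarrow> P \<in> U \<Longrightarrow> P v" by blast
  have "P v = (P \<in> U)" if "Def A l P" for P
    using v(2)[of P] v(2)[of "\<lambda>x. \<not> P x"] that ultra_neg[OF ultra, of P] by (auto simp: Def_neg)
  then have "realizes U A l v" using v(1) by (simp add: realizes_def)
  then show thesis by (rule that)
qed

text \<open>The global average type of an ultrafilter on tuples from \<open>A\<close> is invariant over \<open>A\<close>.\<close>

lemma realizes_ty:
  assumes U: "ultra_on l A U" and w: "ty A w w'"
    and v: "realizes U (A \<union> set w) l v" and v': "realizes U (A \<union> set w') l v'"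
  shows "ty A (v @ w) (v' @ w')"
  unfolding ty_def
proof (intro conjI allI impI)
  have ultra: "ultra U" using U by (simp add: ultra_on_def)
  have len: "length v = l" "length v' = l" "length w = length w'"
    using v v' w by (auto dest: realizes_length ty_length)
  then show "length (v @ w) = length (v' @ w')" by simp
  fix P assume "Def A (length (v @ w)) P"
  then have P: "Def A (l + length w) P" by (simp add: len)
  have "P (v @ w) \<longleftrightarrow> (\<lambda>z. P (z @ w)) \<in> U"
    by (rule realizesD[OF v], rule Def_inst) (auto intro: Def_mono[OF P])
  \<comment> \<open>Tuples \<open>z\<close> from \<open>A\<close> cannot distinguish
    \<open>w\<close> from \<open>w'\<close>, and \<open>U\<close> concentrates on such
    tuples.\<close>
  also have "\<dots> \<longleftrightarrow> (\<lambda>z. P (z @ w')) \<in> U"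
  proof (rule ultra_cong[OF ultra, of "\<lambda>v. length v = l \<and> set v \<subseteq> A"])
    show "(\<lambda>v. length v = l \<and> set v \<subseteq> A) \<in> U" using U by (simp add: ultra_on_def)
    fix z :: "'m list" assume "length z = l \<and> set z \<subseteq> A"
    then show "P (z @ w) = P (z @ w')"
      using P by (intro ty_D[OF w, of "\<lambda>w. P (z @ w)"] Def_inst_left) auto
  qed
  also have "\<dots> \<longleftrightarrow> P (v' @ w')"
    by (rule realizesD[OF v', symmetric], rule Def_inst) (use Def_mono[OF P, of "A \<union> set w'"] len in auto)
  finally show "P (v @ w) = P (v' @ w')" .
qed

definition morley :: "('m list \<Rightarrow> bool) set \<Rightarrow> 'm set \<Rightarrow> nat \<Rightarrow> (nat \<Rightarrow> 'm list) \<Rightarrow> bool" where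
  "morley U A l c \<longleftrightarrow> (\<forall>i. realizes U (A \<union> (\<Union>j<i. set (c j))) l (c i))"

text \<open>Induction on the length of the index list: the last term realises the average type over
  the earlier ones, and invariance of this type over \<open>A\<close> extends an equality of types
  from the earlier terms to the whole list.\<close>

lemma morley_indisc:
  assumes U: "ultra_on l A U" and c: "morley U A l c"
  shows "indisc A c"
proof -
  have "ty A (concat (map c is)) (concat (map c js))"
    if "sorted_wrt (<) is" "sorted_wrt (<) js" "length is = length js" for "is" js
    using that
  proof (induction "is" arbitrary: js rule: rev_induct)
    case Nil
    then show ?case by (simp add: ty_refl)
  next
    case (snoc i "is")
    then obtain j js' where js: "js = js' @ [j]"
      by (metis length_0_conv snoc_eq_iff_butlast rev_exhaust)
    have r: "realizes U (A \<union> set (concat (map c is))) l (c i)" if "sorted_wrt (<) (is @ [i])" for "is" i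
    proof (rule realizes_mono)
      show "realizes U (A \<union> (\<Union>j<i. set (c j))) l (c i)" using c by (simp add: morley_def)
      show "A \<union> set (concat (map c is)) \<subseteq> A \<union> (\<Union>j<i. set (c j))"
        using that by (fastforce simp: sorted_wrt_append)
    qed
    have IH: "ty A (concat (map c is)) (concat (map c js'))"
      using snoc js by (auto simp: sorted_wrt_append)
    have "ty A (c i @ concat (map c is)) (c j @ concat (map c js'))"
      by (rule realizes_ty[OF U IH r r]) (use snoc js in auto)
    then have "ty A (concat (map c is) @ c i) (concat (map c js') @ c j)"
      by (rule ty_swap) (use c in \<open>auto simp: morley_def realizes_def\<close>)
    then show ?case using js by simp
  qed
  then show ?thesis using c by (auto simp: indisc_def morley_def realizes_def)
qed

text \<open>A finite initial part \<open>g\<close> can be prescribed, so a Morley sequence that is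
  still under construction may be prolonged; \<open>k = 0\<close> gives plain existence.\<close>

lemma morley_extend:
  assumes small: "small A" and U: "ultra_on l B U"
    and g: "\<And>i. i < k \<Longrightarrow> realizes U (A \<union> (\<Union>j<i. set (g j))) l (g i)"
  obtains c where "morley U A l c" "\<And>i. i < k \<Longrightarrow> c i = g i"
proof -
  let ?P = "\<lambda>c i v. realizes U (A \<union> (\<Union>j<i. set (c j))) l v \<and> (i < k \<longrightarrow> v = g i)"
  have "\<exists>c. \<forall>i. ?P c i (c i)"
  proof (rule dependent_wf_choice[OF wf_less])
    fix c c' :: "nat \<Rightarrow> 'm list" and i v
    assume "\<And>j. (j, i) \<in> {(x, y). x < y} \<Longrightarrow> c j = c' j"
    then have "(\<Union>j<i. set (c j)) = (\<Union>j<i. set (c' j))" by auto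
    then show "?P c i v = ?P c' i v" by simp
  next
    fix c i assume c: "\<And>j. (j, i) \<in> {(x, y). x < y} \<Longrightarrow> ?P c j (c j)"
    show "\<exists>v. ?P c i v"
    proof (cases "i < k")
      case True
      then have "c j = g j" if "j < i" for j using c that by simp
      then have "(\<Union>j<i. set (c j)) = (\<Union>j<i. set (g j))" by auto
      then show ?thesis using g[OF True] by auto
    next
      case False
      have "small (A \<union> (\<Union>j<i. set (c j)))"
        by (rule small_Un[OF small]) (auto intro: countable_finite)
      then show ?thesis using False realizes_exists[OF _ U] by blast
    qed
  qed
  then show thesis using that by (auto simp: morley_def)
qed

end


section \<open>Stability of the wideness relation over a model\<close>

lemma (in definability) null_cross:
  assumes S1: "S1 n N" and p: "indisc A p" and k: "length (p 0) = k"
    and Y: "Def A (n + l) Y" and Z: "Def A (n + m) Z"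
    and g: "picks k l g" and h: "picks k m h"
    and N: "N (\<lambda>y. Y (y @ g (p 1)) \<and> Z (y @ h (p 0)))"
  shows "N (\<lambda>y. Y (y @ g (p 0)) \<and> Z (y @ h (p 0)))"
proof -
  \<comment> \<open>\<open>\<Psi>\<close> asks for both conditions at the same term. Imposed at
    \<open>p 0\<close> and \<open>p 1\<close> together it implies the crossed property,
    \<open>Y\<close> at \<open>p 1\<close> and \<open>Z\<close> at \<open>p 0\<close>. So the S1
    axiom for \<open>\<Psi>\<close> passes from nullness of the crossed property to nullness of the
    uncrossed one; this is how S1 forbids half graphs.\<close>
  define \<Psi> where "\<Psi> x \<longleftrightarrow> Y (take n x @ g (drop n x)) \<and> Z (take n x @ h (drop n x))" for x
  have "picks (n + k) (n + l) (\<lambda>x. take n x @ g (drop n x))"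
    "picks (n + k) (n + m) (\<lambda>x. take n x @ h (drop n x))"
    by (intro picks_append picks_take picks_comp[OF picks_drop g] picks_comp[OF picks_drop h]; simp)+
  then have \<Psi>: "Def A (n + k) \<Psi>"
    unfolding \<Psi>_def by (intro Def_conj Def_picks[OF Y] Def_picks[OF Z])
  have l: "length (p 1) = k" using p k unfolding indisc_def by metis
  have "Def UNIV n (\<lambda>y. \<Psi> (y @ p i))" if "i \<in> {0, 1}" for i
    by (rule Def_inst) (use Def_UNIV[OF \<Psi>] k l that in auto)
  then have "Def UNIV n (\<lambda>y. \<Psi> (y @ p 0) \<and> \<Psi> (y @ p 1))" by (simp add: Def_conj)
  then have "N (\<lambda>y. \<Psi> (y @ p 0) \<and> \<Psi> (y @ p 1))"
    by (rule null_mono[OF S1 _ N]) (simp add: \<Psi>_def)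
  then have "N (\<lambda>y. \<Psi> (y @ p 0))"
    using null_S1[OF S1 _ p] \<Psi> k by blast
  then show ?thesis
    by (rule null_cong[OF S1, THEN iffD1, rotated]) (simp add: \<Psi>_def)
qed

text \<open>The assumption \<open>model\<close> is the Tarski-Vaught test: every nonempty set
  definable over \<open>M\<close> has a point in \<open>M\<close>.\<close>

locale over_model = saturated_definability def0 small
  for def0 :: "nat \<Rightarrow> ('m list \<Rightarrow> bool) \<Rightarrow> bool" and small +
  fixes M :: "'m set"
  assumes small_M: "small M"
    and model: "\<And>l P v. Def M l P \<Longrightarrow> length v = l \<Longrightarrow> P v \<Longrightarrow> \<exists>w. length w = l \<and> set w \<subseteq> M \<and> P w"
begin

text \<open>By the Tarski-Vaught test, the members of the type of \<open>u\<close> over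
  \<open>M\<close>, restricted to tuples from \<open>M\<close>, have the finite intersection
  property. The average of any ultrafilter containing them is a coheir of that type.\<close>

lemma coheir_exists:
  obtains U where "ultra_on (length u) M U" "realizes U M (length u) u"
proof -
  let ?F = "{\<lambda>v. (length v = length u \<and> set v \<subseteq> M) \<and> P v |P. Def M (length u) P \<and> P u}"
  have "\<exists>U. ultra U \<and> ?F \<subseteq> U"
  proof (rule ultra_exists)
    show "?F \<noteq> {}" using Def_True by blast
    show "\<exists>x. P x" if "P \<in> ?F" for P using that model by blast
    fix P Q assume "P \<in> ?F" "Q \<in> ?F"
    then obtain P' Q' where *: "P = (\<lambda>v. (length v = length u \<and> set v \<subseteq> M) \<and> P' v)" "Def M (length u) P'" "P' u"
      "Q = (\<lambda>v. (length v = length u \<and> set v \<subseteq> M) \<and> Q' v)" "Def M (length u) Q'" "Q' u" by blast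
    then show "(\<lambda>x. P x \<and> Q x) \<in> ?F"
      by (intro CollectI exI[of _ "\<lambda>x. P' x \<and> Q' x"]) (auto intro: Def_conj)
  qed
  then obtain U where U: "ultra U" "\<And>P. Def M (length u) P \<Longrightarrow> P u \<Longrightarrow>
      (\<lambda>v. (length v = length u \<and> set v \<subseteq> M) \<and> P v) \<in> U" by blast
  have pos: "P \<in> U" if "Def M (length u) P" "P u" for P
    using U(2)[OF that] by (rule ultra_mono[OF U(1)]) auto
  have "ultra_on (length u) M U"
    using U(1) U(2)[OF Def_True] by (simp add: ultra_on_def)
  moreover have "P u = (P \<in> U)" if "Def M (length u) P" for P
    using pos[OF that] pos[OF Def_neg[OF that]] ultra_neg[OF U(1), of P] by blast
  ultimately show thesis using that by (auto simp: realizes_def)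
qed

text \<open>If a property of \<open>(d, u)\<close> imposed at all \<open>g j\<close> at once were
  null, S1 would make it null at one term and invariance would make it null at \<open>u\<close>,
  against wideness of \<open>d\<close> over \<open>M\<close> and \<open>u\<close>. So one tuple can
  copy \<open>d\<close> over a whole initial part of a Morley sequence.\<close>

lemma wide_common_extension:
  fixes g :: "nat \<Rightarrow> 'm list"
  assumes S1: "S1 m N" and d: "wide N m (M \<union> set u) d" and l: "length u = l"
    and U: "ultra_on l M U" and u: "realizes U M l u"
    and g: "\<And>i. i < k \<Longrightarrow> realizes U (M \<union> (\<Union>j<i. set (g j))) l (g i)"
  obtains w where "length w = m" "\<And>j. j < k \<Longrightarrow> ty M (d @ u) (w @ g j)"
proof -
  obtain c where c: "morley U M l c" "\<And>i. i < k \<Longrightarrow> c i = g i"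
    using morley_extend[OF small_M U g] by blast
  have lc: "length (c i) = l" for i using c(1) by (simp add: morley_def realizes_def)
  have c0: "ty M u (c 0)"
  proof -
    have "realizes U M l (c 0)" using c(1) unfolding morley_def by (auto intro: realizes_mono)
    then show ?thesis using u by (auto simp: realizes_def ty_def)
  qed
  let ?B = "M \<union> (\<Union>j<k. set (c j))"
  let ?F = "{\<lambda>z. \<forall>j<k. P (z @ c j) |P. Def M (m + l) P \<and> P (d @ u)}"
  have ld: "length d = m" using d by (rule wide_length)
  have "\<exists>w. wide N m ?B w \<and> (\<forall>P\<in>?F. P w)"
  proof (rule wide_realize[OF S1])
    show "small ?B" by (rule small_Un[OF small_M]) (auto intro: countable_finite)
    show "?F \<noteq> {}" using Def_True by blast
    show "Def ?B m Q" if Q: "Q \<in> ?F" for Q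
    proof -
      obtain P where P: "Q = (\<lambda>z. \<forall>j<k. P (z @ c j))" "Def M (m + l) P" using Q by blast
      have "Def ?B m (\<lambda>z. P (z @ c j))" if "j < k" for j
        by (rule Def_inst) (use that lc Def_mono[OF P(2), of ?B] in auto)
      then show ?thesis unfolding P(1) by (rule Def_all_less)
    qed
    show "\<not> N Q" if Q: "Q \<in> ?F" for Q
    proof
      assume N: "N Q"
      obtain P where P: "Q = (\<lambda>z. \<forall>j<k. P (z @ c j))" "Def M (m + l) P" "P (d @ u)" using Q by blast
      have "N (\<lambda>z. P (z @ c 0))"
      proof (rule null_S1_less[OF S1 _ morley_indisc[OF U c(1)], where P = P])
        show "Def M (m + length (c 0)) P" using P(2) lc by simp
        show "N (\<lambda>z. \<forall>j<k. P (z @ c j))" using N unfolding P(1) .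
      qed
      moreover have "Def M (m + length u) P" using P(2) l by simp
      ultimately have "N (\<lambda>z. P (z @ u))"
        using null_ty[OF S1 _ c0, of P] by blast
      moreover have "Def (M \<union> set u) m (\<lambda>z. P (z @ u))"
        by (rule Def_inst) (use Def_mono[OF P(2), of "M \<union> set u"] l in auto)
      ultimately show False using wideD[OF d] P(3) by blast
    qed
    fix P Q assume "P \<in> ?F" "Q \<in> ?F"
    then obtain P' Q' where *: "P = (\<lambda>z. \<forall>j<k. P' (z @ c j))" "Def M (m + l) P'" "P' (d @ u)"
      "Q = (\<lambda>z. \<forall>j<k. Q' (z @ c j))" "Def M (m + l) Q'" "Q' (d @ u)" by blast
    then show "(\<lambda>x. P x \<and> Q x) \<in> ?F"
      by (intro CollectI exI[of _ "\<lambda>x. P' x \<and> Q' x"]) (auto intro: Def_conj)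
  qed
  then obtain w where w1: "wide N m ?B w" and w2: "\<forall>Q\<in>?F. Q w" by blast
  have "\<forall>j<k. P (w @ c j)" if "Def M (m + l) P" "P (d @ u)" for P
    using that by (intro w2[rule_format, of "\<lambda>z. \<forall>j<k. P (z @ c j)"] CollectI exI[of _ P]) simp
  note w = w1 this
  have lw: "length w = m" using w(1) by (rule wide_length)
  have "ty M (d @ u) (w @ g j)" if j: "j < k" for j
    unfolding ty_def
  proof (intro conjI allI impI)
    show "length (d @ u) = length (w @ g j)" using lw ld l lc[of j] c(2)[OF j] by simp
    fix P assume "Def M (length (d @ u)) P"
    then have "Def M (m + l) P" by (simp add: ld l)
    then show "P (d @ u) = P (w @ g j)"
      using w(2)[of P] w(2)[of "\<lambda>x. \<not> P x"] Def_neg[of M "m + l" P] j c(2)[OF j] by metis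
  qed
  then show thesis using that lw by blast
qed

text \<open>
  The relation \<open>\<not> N (\<lambda>y. Y (y @ u) \<and> Z (y @ d))\<close> between \<open>u\<close> and \<open>d\<close> is stable, since \<open>N\<close> is an
  S1-ideal. If \<open>d\<close> is wide over \<open>M\<close> and \<open>u\<close>, then its truth value at \<open>(u, d)\<close> must agree with the one
  at a pair whose first coordinate is a coheir over the second; otherwise averaging along a sequence
  that alternates between both values yields an indiscernible half graph.
\<close>

lemma null_conj_coheir:
  assumes S1: "S1 n N" and S1': "S1 m N'"
    and Y: "Def M (n + l) Y" and Z: "Def M (n + m) Z"
    and l: "length u = l" and U: "ultra_on l M U" and u: "realizes U M l u"
    and d: "wide N' m (M \<union> set u) d" and dd: "ty M d d'" and u': "realizes U (M \<union> set d') l u'"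
  shows "N (\<lambda>y. Y (y @ u) \<and> Z (y @ d)) = N (\<lambda>y. Y (y @ u') \<and> Z (y @ d'))"
proof -
  have ld: "length d = m" using d by (rule wide_length)
  have ld': "length d' = m" using ld ty_length[OF dd] by simp
  have lu': "length u' = l" using u' by (rule realizes_length)
  \<comment> \<open>Write \<open>s i\<close> as \<open>w_i @ v_i\<close>. The \<open>v_i\<close>
    realise \<open>U\<close> over all earlier pairs, so \<open>w_i @ v_j\<close> with
    \<open>i < j\<close> has the type of the coheir pair \<open>d' @ u'\<close>. On the other side
    \<open>w_i\<close> copies \<open>d\<close> over every \<open>v_j\<close> with
    \<open>j \<le> i\<close>.\<close>
  let ?P = "\<lambda>s (i :: nat) w. length w = m + l \<and> realizes U (M \<union> (\<Union>j<i. set (s j))) l (drop m w) \<and>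
     (\<forall>j<i. ty M (d @ u) (take m w @ drop m (s j))) \<and> ty M (d @ u) w"
  have "\<exists>s. \<forall>i. ?P s i (s i)"
  proof (rule dependent_wf_choice[OF wf_less, where P = ?P])
    fix s s' :: "nat \<Rightarrow> 'm list" and i w
    assume "\<And>j. (j, i) \<in> {(x, y). x < y} \<Longrightarrow> s j = s' j"
    then have eq: "s j = s' j" if "j < i" for j using that by simp
    then have "(\<Union>j<i. set (s j)) = (\<Union>j<i. set (s' j))" by auto
    then show "?P s i w = ?P s' i w" using eq by auto
  next
    fix s i assume s: "\<And>j. (j, i) \<in> {(x, y). x < y} \<Longrightarrow> ?P s j (s j)"
    have "small (M \<union> (\<Union>j<i. set (s j)))"
      by (rule small_Un[OF small_M]) (auto intro: countable_finite)
    then obtain v where v: "realizes U (M \<union> (\<Union>j<i. set (s j))) l v"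
      using realizes_exists[OF _ U] by blast
    define g where "g j = (if j < i then drop m (s j) else v)" for j
    have "realizes U (M \<union> (\<Union>j'<j. set (g j'))) l (g j)" if "j < Suc i" for j
    proof -
      have "(\<Union>j'<j. set (g j')) \<subseteq> (\<Union>j'<j. set (s j'))"
        using that by (auto simp: g_def dest: in_set_dropD)
      moreover have "realizes U (M \<union> (\<Union>j'<j. set (s j'))) l (g j)"
        using s[of j] v that by (cases "j < i") (auto simp: g_def less_Suc_eq)
      ultimately show ?thesis by (auto intro: realizes_mono)
    qed
    from wide_common_extension[OF S1' d l U u this]
    obtain w where w: "length w = m" "\<And>j. j < Suc i \<Longrightarrow> ty M (d @ u) (w @ g j)" by blast
    have "?P s i (w @ v)"
    proof (intro conjI allI impI)
      show "ty M (d @ u) (take m (w @ v) @ drop m (s j))" if "j < i" for j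
        using w(1) w(2)[of j] that by (simp add: g_def)
      show "ty M (d @ u) (w @ v)" using w(2)[of i] by (simp add: g_def)
    qed (use w(1) v in \<open>auto dest: realizes_length\<close>)
    then show "\<exists>w. ?P s i w" by blast
  qed
  then obtain s where s: "\<And>i. ?P s i (s i)" by blast
  have ls: "length (s i) = m + l" for i using s by blast
  \<comment> \<open>\<open>E v w\<close> joins the \<open>d\<close>-part of \<open>v\<close> to the
    \<open>u\<close>-part of \<open>w\<close>. On distinct terms of \<open>s\<close> its type over
    \<open>M\<close> is decided by which argument comes first.\<close>
  define E where "E v w = take m v @ drop m w" for v w :: "'m list"
  have E1: "ty M (d @ u) (E (s j) (s i))" if "i < j" for i j
    using s[of j] that by (auto simp: E_def)
  have E2: "ty M (d' @ u') (E (s i) (s j))" if "i < j" for i j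
  proof -
    have "ty M (take m (s i)) d"
      using s[of i] ty_appendD(1)[of M d u "take m (s i)" "drop m (s i)"] ld by (auto intro: ty_sym)
    then have "ty M (drop m (s j) @ take m (s i)) (u' @ d')"
    proof (rule realizes_ty[OF U ty_trans[OF _ dd] _ u'])
      have "set (take m (s i)) \<subseteq> (\<Union>j'<j. set (s j'))"
        using that by (auto dest: in_set_takeD)
      then show "realizes U (M \<union> set (take m (s i))) l (drop m (s j))"
        using s[of j] by (blast intro: realizes_mono)
    qed
    then have "ty M (take m (s i) @ drop m (s j)) (d' @ u')"
      by (rule ty_swap) (simp add: ls lu')
    then show ?thesis by (auto simp: E_def intro: ty_sym)
  qed
  \<comment> \<open>To make the half graph indiscernible, \<open>s\<close> is averaged along
    \<open>W\<close>, and a Morley sequence of the average \<open>V\<close> is taken over a set that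
    contains all \<open>s i\<close>.\<close>
  obtain W :: "(nat \<Rightarrow> bool) set" where W: "ultra W" "\<And>n. (\<lambda>i. n < i) \<in> W"
    using ultra_nat_exists by blast
  define V where "V = {P. (\<lambda>i. P (s i)) \<in> W}"
  define B where "B = M \<union> (\<Union>i. set (s i))"
  have V: "ultra_on (m + l) B V"
    using ultra_image[OF W(1), of s] ultra_True[OF W(1)] ls
    by (auto simp: ultra_on_def V_def B_def elim!: ultra_mono[OF W(1)])
  have "small B" unfolding B_def by (rule small_Un[OF small_M]) (auto intro: countable_finite)
  then obtain c where c: "morley V B (m + l) c"
    using morley_extend[OF _ V, of B 0] by blast
  then have lc: "length (c i) = m + l" for i by (simp add: morley_def realizes_def)
  have ci: "realizes V B (m + l) (c i)" for i
    using c unfolding morley_def by (blast intro: realizes_mono)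
  have cij: "realizes V (B \<union> set (c i)) (m + l) (c j)" if "i < j" for i j
  proof (rule realizes_mono)
    show "realizes V (B \<union> (\<Union>i<j. set (c i))) (m + l) (c j)" using c by (simp add: morley_def)
  qed (use that in auto)
  have MB: "M \<subseteq> B" by (simp add: B_def)
  have D1: "Def (B \<union> set w) (m + l) (\<lambda>v. P (E v w))" and D2: "Def (B \<union> set w) (m + l) (\<lambda>v. P (E w v))"
    if P: "Def M (m + l) P" and w: "length w = m + l" for P w
  proof -
    have P': "Def (B \<union> set w) (m + l) P" using Def_mono[OF P] MB by blast
    have "picks (m + l + length w) (m + l) (\<lambda>x. take m x @ drop (m + l + m) x)"
      unfolding w using picks_append[OF picks_take picks_drop, of m "m + l + m" l] by (simp add: add.assoc)
    from Def_inst[OF Def_picks[OF P' this]] have *: "Def (B \<union> set w) (m + l)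
      (\<lambda>x. P (take m (x @ w) @ drop (m + l + m) (x @ w)))" by simp
    show "Def (B \<union> set w) (m + l) (\<lambda>v. P (E v w))"
      by (rule Def_cong[OF *]) (simp add: E_def)
    have "picks (length w + (m + l)) (m + l) (\<lambda>x. take m x @ drop (m + l + m) x)"
      unfolding w using picks_append[OF picks_take picks_drop, of m "m + l + m" l] by (simp add: add.assoc)
    from Def_inst_left[OF Def_picks[OF P' this]] have *: "Def (B \<union> set w) (m + l)
      (\<lambda>x. P (take m (w @ x) @ drop (m + l + m) (w @ x)))" by simp
    show "Def (B \<union> set w) (m + l) (\<lambda>v. P (E w v))"
      by (rule Def_cong[OF *]) (simp add: E_def w)
  qed
  have D: "Def B (m + l) (\<lambda>v. P (E v (s i)))" "Def B (m + l) (\<lambda>v. P (E (s i) v))"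
    if P: "Def M (m + l) P" for P i
  proof -
    have "B \<union> set (s i) = B" by (auto simp: B_def)
    then show "Def B (m + l) (\<lambda>v. P (E v (s i)))" "Def B (m + l) (\<lambda>v. P (E (s i) v))"
      using D1[OF P ls, of i] D2[OF P ls, of i] by simp_all
  qed
  have lE: "length (E v w) = m + l" if "length v = m + l" "length w = m + l" for v w
    using that by (simp add: E_def)
  have ldu: "length (d @ u) = m + l" "length (d' @ u') = m + l" using ld ld' l lu' by simp_all
  \<comment> \<open>Averaging reverses the order: the later term \<open>c j\<close> is evaluated
    first and becomes the outer limit over \<open>k\<close>, so \<open>k'\<close> exceeds
    \<open>k\<close> in the inner limit. The pair therefore behaves like
    \<open>E (s k) (s k')\<close> with \<open>k < k'\<close>.\<close>
  have T1: "ty M (E (c j) (c i)) (d' @ u')" if ij: "i < j" for i j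
    unfolding ty_def
  proof (intro conjI allI impI)
    show "length (E (c j) (c i)) = length (d' @ u')" using ldu lE lc by simp
    fix P assume "Def M (length (E (c j) (c i))) P"
    then have P: "Def M (m + l) P" by (simp add: lE lc)
    have "P (E (c j) (c i)) \<longleftrightarrow> (\<lambda>k. P (E (s k) (c i))) \<in> W"
      using realizesD[OF cij[OF ij] D1[OF P lc]] by (simp add: V_def)
    also have "(\<lambda>k. P (E (s k) (c i))) = (\<lambda>k. (\<lambda>k'. P (E (s k) (s k'))) \<in> W)"
      using realizesD[OF ci D(2)[OF P]] by (simp add: V_def)
    also have "\<dots> = (\<lambda>k. P (d' @ u'))"
    proof
      fix k
      have "(\<lambda>k'. P (E (s k) (s k'))) \<in> W \<longleftrightarrow> (\<lambda>k'. P (d' @ u')) \<in> W"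
        using ultra_cong[OF W(1) W(2)[of k]] ty_D[OF E2] P ldu by (metis (mono_tags, lifting))
      then show "((\<lambda>k'. P (E (s k) (s k'))) \<in> W) = P (d' @ u')" using ultra_const[OF W(1)] by blast
    qed
    finally show "P (E (c j) (c i)) = P (d' @ u')" using ultra_const[OF W(1)] by blast
  qed
  have T2: "ty M (E (c i) (c j)) (d @ u)" if ij: "i < j" for i j
    unfolding ty_def
  proof (intro conjI allI impI)
    show "length (E (c i) (c j)) = length (d @ u)" using ldu lE lc by simp
    fix P assume "Def M (length (E (c i) (c j))) P"
    then have P: "Def M (m + l) P" by (simp add: lE lc)
    have "P (E (c i) (c j)) \<longleftrightarrow> (\<lambda>k. P (E (c i) (s k))) \<in> W"
      using realizesD[OF cij[OF ij] D2[OF P lc]] by (simp add: V_def)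
    also have "(\<lambda>k. P (E (c i) (s k))) = (\<lambda>k. (\<lambda>k'. P (E (s k') (s k))) \<in> W)"
      using realizesD[OF ci D(1)[OF P]] by (simp add: V_def)
    also have "\<dots> = (\<lambda>k. P (d @ u))"
    proof
      fix k
      have "(\<lambda>k'. P (E (s k') (s k))) \<in> W \<longleftrightarrow> (\<lambda>k'. P (d @ u)) \<in> W"
        using ultra_cong[OF W(1) W(2)[of k]] ty_D[OF E1] P ldu by (metis (mono_tags, lifting))
      then show "((\<lambda>k'. P (E (s k') (s k))) \<in> W) = P (d @ u)" using ultra_const[OF W(1)] by blast
    qed
    finally show "P (E (c i) (c j)) = P (d @ u)" using ultra_const[OF W(1)] by blast
  qed
  \<comment> \<open>Nullness of the joint condition at the \<open>u\<close>-part of the first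
    argument and the \<open>d\<close>-part of the second. By \<open>T1\<close> and
    \<open>T2\<close>, its value on two distinct terms of \<open>c\<close> depends only on their
    order.\<close>
  define R where "R v w = N (\<lambda>y. Y (y @ drop m v) \<and> Z (y @ take m w))" for v w
  have R: "R v w = N (\<lambda>y. Y (y @ u0) \<and> Z (y @ d0))"
    if ty: "ty M (E w v) (d0 @ u0)" and len: "length v = m + l" "length w = m + l" "length u0 = l" "length d0 = m"
    for v w u0 d0
  proof -
    define \<Phi> where "\<Phi> x \<longleftrightarrow> Y (take n x @ drop (n + m) x) \<and> Z (take (n + m) x)" for x
    have "picks (n + m + l) (n + l) (\<lambda>x. take n x @ drop (n + m) x)"
      by (rule picks_append[OF picks_take picks_drop]) simp
    then have "Def M (n + m + l) \<Phi>"
      unfolding \<Phi>_def by (intro Def_conj Def_picks[OF Y] Def_picks[OF Z] picks_take) auto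
    then have "N (\<lambda>y. \<Phi> (y @ E w v)) = N (\<lambda>y. \<Phi> (y @ d0 @ u0))"
      by (intro null_ty[OF S1 _ ty]) (simp add: lE len add.assoc)
    moreover have "N (\<lambda>y. \<Phi> (y @ E w v)) = R v w"
      unfolding R_def by (rule null_cong[OF S1]) (simp add: \<Phi>_def E_def len)
    moreover have "N (\<lambda>y. \<Phi> (y @ d0 @ u0)) = N (\<lambda>y. Y (y @ u0) \<and> Z (y @ d0))"
      by (rule null_cong[OF S1]) (simp add: \<Phi>_def len)
    ultimately show ?thesis by simp
  qed
  define p where "p i = c (2 * i) @ c (Suc (2 * i))" for i
  have p: "indisc M p"
    using indisc_pairs[OF morley_indisc[OF V c]] ty_mono[OF _ MB] unfolding indisc_def p_def by blast
  have lp: "length (p i) = (m + l) + (m + l)" for i by (simp add: p_def lc)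
  define fst' where "fst' = (\<lambda>x :: 'm list. take (m + l) x)"
  define snd' where "snd' = (\<lambda>x :: 'm list. drop (m + l) x)"
  have pk: "picks ((m + l) + (m + l)) (m + l) fst'" "picks ((m + l) + (m + l)) (m + l) snd'"
    unfolding fst'_def snd'_def by (simp add: picks_take) (rule picks_drop)
  have fs: "fst' (p i) = c (2 * i)" "snd' (p i) = c (Suc (2 * i))" for i
    by (simp_all add: fst'_def snd'_def p_def lc)
  note pu = picks_comp[OF pk(1) picks_drop] picks_comp[OF pk(2) picks_drop]
  have tk: "picks (m + l) m (take m)" by (rule picks_take) simp
  note pd = picks_comp[OF pk(1) tk] picks_comp[OF pk(2) tk]
  \<comment> \<open>Moving one argument from \<open>c 2\<close> to \<open>c 0\<close>, past the
    fixed \<open>c 1\<close>, reverses the order, so nullness at \<open>(u, d)\<close> gives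
    nullness at \<open>(u', d')\<close>. Exchanging the roles of \<open>Y\<close> and
    \<open>Z\<close> gives the converse.\<close>
  have "R (c 0) (c 1)" if "R (c 2) (c 1)"
    using null_cross[OF S1 p lp Y Z pu(1) pd(2)] that by (simp add: R_def fs)
  moreover have "R (c 1) (c 0)" if "R (c 1) (c 2)"
    using null_cross[OF S1 p lp Z Y pd(1) pu(2)] that by (simp add: R_def fs conj_commute)
  moreover have "R (c i) (c j) = N (\<lambda>y. Y (y @ u') \<and> Z (y @ d'))" if "i < j" for i j
    by (rule R[OF T1[OF that]]) (use lc ld' lu' in auto)
  moreover have "R (c j) (c i) = N (\<lambda>y. Y (y @ u) \<and> Z (y @ d))" if "i < j" for i j
    by (rule R[OF T2[OF that]]) (use lc ld l in auto)
  ultimately show ?thesis by auto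
qed

end


section \<open>Stable relations between wide types\<close>

lemma concat_nth_take:
  "\<forall>b\<in>set bs. length b = m \<Longrightarrow> i < length bs \<Longrightarrow> take m (drop (m * i) (concat bs)) = bs ! i"
proof (induction bs arbitrary: i)
  case (Cons b bs)
  then show ?case by (cases i) auto
qed simp

lemma length_concat_const: "\<forall>b\<in>set bs. length b = m \<Longrightarrow> length (concat bs) = m * length bs"
  by (induction bs) auto

context over_model
begin

text \<open>The hypothesis on \<open>\<theta>\<close> says that the type of \<open>b\<close> over
  \<open>M\<close> stays wide when \<open>Q\<close> is added; this is the family to which
  \<open>wide_realize\<close> is applied.\<close>

lemma type_realize:
  assumes S1: "S1 n N" and small: "small B" and MB: "M \<subseteq> B" and Q: "Def B n Q" and b: "length b = n"
    and pos: "\<And>\<theta>. Def M n \<theta> \<Longrightarrow> \<theta> b \<Longrightarrow> \<not> N (\<lambda>y. \<theta> y \<and> Q y)"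
  obtains y where "ty M b y" "wide N n B y" "Q y"
proof -
  let ?F = "{\<lambda>y. \<theta> y \<and> Q y |\<theta>. Def M n \<theta> \<and> \<theta> b}"
  have "\<exists>y. wide N n B y \<and> (\<forall>P\<in>?F. P y)"
  proof (rule wide_realize[OF S1 small])
    show "?F \<noteq> {}" using Def_True by blast
    show "Def B n P" if P: "P \<in> ?F" for P
    proof -
      obtain \<theta> where "P = (\<lambda>y. \<theta> y \<and> Q y)" "Def M n \<theta>" using P by blast
      then show ?thesis using Def_conj[OF Def_mono[OF _ MB] Q] by blast
    qed
    show "\<not> N P" if P: "P \<in> ?F" for P
    proof -
      obtain \<theta> where "P = (\<lambda>y. \<theta> y \<and> Q y)" "Def M n \<theta>" "\<theta> b" using P by blast
      then show ?thesis using pos by blast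
    qed
    fix P P' assume "P \<in> ?F" "P' \<in> ?F"
    then obtain \<theta> \<theta>' where *: "P = (\<lambda>y. \<theta> y \<and> Q y)" "Def M n \<theta>" "\<theta> b"
      "P' = (\<lambda>y. \<theta>' y \<and> Q y)" "Def M n \<theta>'" "\<theta>' b" by blast
    then show "(\<lambda>x. P x \<and> P' x) \<in> ?F"
      by (intro CollectI exI[of _ "\<lambda>x. \<theta> x \<and> \<theta>' x"]) (auto intro: Def_conj)
  qed
  then obtain y where y: "wide N n B y" and yF: "\<forall>P\<in>?F. P y" by blast
  have *: "\<theta> y \<and> Q y" if "Def M n \<theta>" "\<theta> b" for \<theta>
    using that by (intro yF[rule_format, of "\<lambda>y. \<theta> y \<and> Q y"] CollectI exI[of _ \<theta>]) simp
  have "ty M b y" unfolding ty_def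
  proof (intro conjI allI impI)
    show "length b = length y" using b wide_length[OF y] by simp
    fix P assume "Def M (length b) P"
    then show "P b = P y" using *[of P] *[of "\<lambda>x. \<not> P x"] Def_neg[of M n P] b by auto
  qed
  then show thesis using y *[OF Def_True] that by blast
qed

definition indep :: "(('m list \<Rightarrow> bool) \<Rightarrow> bool) \<Rightarrow> nat \<Rightarrow> 'm list list \<Rightarrow> bool" where
  "indep N n bs \<longleftrightarrow> (\<forall>i<length bs. wide N n (M \<union> set (concat (take i bs))) (bs ! i))"

lemma indep_snoc: "indep N n (bs @ [b]) \<longleftrightarrow> indep N n bs \<and> wide N n (M \<union> set (concat bs)) b"
  unfolding indep_def by (auto simp: nth_append less_Suc_eq)

end

text \<open>The assumption \<open>no_ladder\<close> is \<open>I\<close>-stability for infinite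
  sequences in the order \<open>s 0, t 0, s 1, t 1, ...\<close> and for both signs
  \<open>\<epsilon>\<close>. The sign \<open>False\<close> accounts, after a shift by one, for
  finite ladders that are independent in the reversed order, and it keeps the locale symmetric in
  the two sorts.\<close>

locale two_sorts = over_model def0 small M
  for def0 :: "nat \<Rightarrow> ('m list \<Rightarrow> bool) \<Rightarrow> bool" and small and M +
  fixes m n :: nat and N N' :: "('m list \<Rightarrow> bool) \<Rightarrow> bool" and \<rho> :: "'m list \<Rightarrow> 'm list \<Rightarrow> bool"
    and a b :: "'m list"
  assumes S1: "S1 m N" and S1': "S1 n N'"
    and rel_def: "Def M (m + n) (\<lambda>w. \<rho> (take m w) (drop m w))"
    and wide_a: "wide N m M a" and wide_b: "wide N' n M b"
    and no_ladder: "\<And>(s :: nat \<Rightarrow> 'm list) t \<epsilon>. (\<And>i. wide N m (M \<union> (\<Union>j<i. set (s j) \<union> set (t j))) (s i)) \<Longrightarrow>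
       (\<And>i. wide N' n (M \<union> (\<Union>j\<le>i. set (s j)) \<union> (\<Union>j<i. set (t j))) (t i)) \<Longrightarrow>
       \<exists>i j. (\<rho> (s i) (t j) = \<epsilon>) \<noteq> (i \<le> j)"
begin

text \<open>Omitting the first term of a sequence that begins in the sort of \<open>b\<close> leaves
  one that begins in the sort of \<open>a\<close>. The shift turns \<open>i \<le> j\<close> into the
  negation of the order with exchanged indices, which is absorbed by negating
  \<open>\<epsilon>\<close>.\<close>

lemma swap: "two_sorts def0 small M n m N' N (\<lambda>y x. \<rho> x y) b a"
proof unfold_locales
  have "picks (n + m) (m + n) (\<lambda>w. drop n w @ take n w)"
    by (rule picks_append[OF picks_drop picks_take]) simp
  from Def_picks[OF rel_def this] show "Def M (n + m) (\<lambda>w. \<rho> (drop n w) (take n w))"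
    by (rule Def_cong) simp
  fix s t :: "nat \<Rightarrow> 'm list" and \<epsilon>
  assume s: "\<And>i. wide N' n (M \<union> (\<Union>j<i. set (s j) \<union> set (t j))) (s i)"
    and t: "\<And>i. wide N m (M \<union> (\<Union>j\<le>i. set (s j)) \<union> (\<Union>j<i. set (t j))) (t i)"
  have "\<exists>i j. (\<rho> (t i) (s (Suc j)) = (\<not> \<epsilon>)) \<noteq> (i \<le> j)"
  proof (rule no_ladder)
    show "wide N m (M \<union> (\<Union>j<i. set (t j) \<union> set (s (Suc j)))) (t i)" for i
    proof (rule wide_mono[OF t])
      have "s (Suc j) \<in> s ` {..i}" if "j < i" for j using that by auto
      then show "M \<union> (\<Union>j<i. set (t j) \<union> set (s (Suc j))) \<subseteq> M \<union> (\<Union>j\<le>i. set (s j)) \<union> (\<Union>j<i. set (t j))"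
        by fastforce
    qed
    show "wide N' n (M \<union> (\<Union>j\<le>i. set (t j)) \<union> (\<Union>j<i. set (s (Suc j)))) (s (Suc i))" for i
      by (rule wide_mono[OF s]) force
  qed
  then show "\<exists>i j. (\<rho> (t j) (s i) = \<epsilon>) \<noteq> (i \<le> j)"
    by (metis not_less_eq_eq)
qed (fact S1 S1' wide_a wide_b)+

lemma length_a: "length a = m" and length_b: "length b = n"
  using wide_a wide_b by (auto dest: wide_length)

lemma length_ty_b: "ty M b d \<Longrightarrow> length d = n"
  using length_b by (simp add: ty_def)

text \<open>
  By saturation, \<open>pos \<epsilon>\<close> means that \<open>\<rho> x b = \<epsilon>\<close> for some \<open>x\<close> of the type of \<open>a\<close>
  over \<open>M\<close> that is wide over \<open>M\<close> and \<open>b\<close>.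
\<close>

definition pos :: "bool \<Rightarrow> bool" where
  "pos \<epsilon> \<longleftrightarrow> (\<forall>\<theta>. Def M m \<theta> \<longrightarrow> \<theta> a \<longrightarrow> \<not> N (\<lambda>x. \<theta> x \<and> \<rho> x b = \<epsilon>))"

text \<open>The parameters are read as \<open>k\<close> blocks of length \<open>n\<close> from one
  concatenated list, so that a whole sequence of them counts as a single tuple in the results on
  types and coheirs.\<close>

definition pattern :: "('m list \<Rightarrow> bool) \<Rightarrow> (nat \<Rightarrow> bool) \<Rightarrow> nat \<Rightarrow> 'm list \<Rightarrow> bool" where
  "pattern \<theta> \<eta> k w \<longleftrightarrow>
     \<theta> (take m w) \<and> (\<forall>i<k. \<rho> (take m w) (take n (drop (m + n * i) w)) = \<eta> i)"

lemma Def_pattern: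
  assumes "Def M m \<theta>" shows "Def M (m + n * k) (pattern \<theta> \<eta> k)"
  unfolding pattern_def
proof (intro Def_conj Def_all_less Def_eq_bool)
  show "Def M (m + n * k) (\<lambda>w. \<theta> (take m w))" by (rule Def_picks[OF assms picks_take]) simp
  fix i assume i: "i < k"
  have le: "n * i + n \<le> n * k" using mult_le_mono2[of "Suc i" k n] i by simp
  then have eq: "m + n * k = (m + n * i) + (n * k - n * i)" by simp
  have tk: "picks (n * k - n * i) n (take n)" by (rule picks_take) (use le in simp)
  have "picks (m + n * k) n (\<lambda>w. take n (drop (m + n * i) w))"
    unfolding eq by (rule picks_comp[OF picks_drop tk])
  then have "picks (m + n * k) (m + n) (\<lambda>w. take m w @ take n (drop (m + n * i) w))"
    by (intro picks_append picks_take) simp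
  from Def_picks[OF rel_def this]
  show "Def M (m + n * k) (\<lambda>w. \<rho> (take m w) (take n (drop (m + n * i) w)))"
    by (rule Def_cong) simp
qed

lemma pattern_concat:
  assumes "length x = m" "\<forall>b\<in>set bs. length b = n"
  shows "pattern \<theta> \<eta> (length bs) (x @ concat bs) \<longleftrightarrow> \<theta> x \<and> (\<forall>i<length bs. \<rho> x (bs ! i) = \<eta> i)"
  using concat_nth_take[OF assms(2)] assms(1) by (simp add: pattern_def)

lemma Def_rel: "length d = n \<Longrightarrow> set d \<subseteq> A \<Longrightarrow> M \<subseteq> A \<Longrightarrow> Def A m (\<lambda>x. \<rho> x d = \<epsilon>)"
proof -
  assume d: "length d = n" "set d \<subseteq> A" "M \<subseteq> A"
  have "Def A m (\<lambda>x. \<rho> (take m (x @ d)) (drop m (x @ d)) = \<epsilon>)"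
    by (rule Def_inst) (use d Def_eq_bool[OF Def_mono[OF rel_def]] in auto)
  then show ?thesis by (rule Def_cong) simp
qed

lemma null_rel_ty:
  assumes \<theta>: "Def M m \<theta>" and ty: "ty M d d'" and d: "length d = n"
  shows "N (\<lambda>x. \<theta> x \<and> \<rho> x d = \<epsilon>) = N (\<lambda>x. \<theta> x \<and> \<rho> x d' = \<epsilon>)"
proof -
  define P where "P w \<longleftrightarrow> \<theta> (take m w) \<and> \<rho> (take m w) (drop m w) = \<epsilon>" for w
  have "Def M (m + length d) P"
    unfolding P_def d by (intro Def_conj Def_eq_bool[OF rel_def] Def_picks[OF \<theta> picks_take]) simp
  from null_ty[OF S1 this ty] show ?thesis
    using null_cong[OF S1, of "\<lambda>x. P (x @ d)" "\<lambda>x. \<theta> x \<and> \<rho> x d = \<epsilon>"]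
      null_cong[OF S1, of "\<lambda>x. P (x @ d')" "\<lambda>x. \<theta> x \<and> \<rho> x d' = \<epsilon>"] by (simp add: P_def)
qed

text \<open>By stationarity the pair of the earlier parameters \<open>u\<close> and the last one
  \<open>d\<close> may be replaced by \<open>(c 1, d')\<close>, where \<open>c\<close> is a Morley
  sequence of a coheir of \<open>u\<close> and \<open>d'\<close> is the first block of
  \<open>c 0\<close>. S1 keeps the pattern wide at \<open>c 0\<close> and \<open>c 1\<close>
  together, and since all signs agree, the pattern at \<open>c 0\<close> contains the condition at
  \<open>d'\<close>.\<close>

lemma pos_indep:
  assumes "pos \<epsilon>" and "indep N' n bs" and "\<forall>b'\<in>set bs. ty M b b'" and "Def M m \<theta>" and "\<theta> a"
  shows "\<not> N (\<lambda>x. \<theta> x \<and> (\<forall>i<length bs. \<rho> x (bs ! i) = \<epsilon>))"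
  using assms(2,3)
proof (induction bs rule: rev_induct)
  case Nil
  then show ?case using wideD[OF wide_a assms(4,5)] by simp
next
  case (snoc d bs)
  have ind: "indep N' n bs" and d: "wide N' n (M \<union> set (concat bs)) d" and tyd: "ty M b d"
    using snoc.prems by (auto simp: indep_snoc)
  have lbs: "\<forall>b\<in>set bs. length b = n" using snoc.prems(2) length_ty_b by simp
  have ld: "length d = n" using d by (rule wide_length)
  have IH: "\<not> N (\<lambda>x. \<theta> x \<and> (\<forall>i<length bs. \<rho> x (bs ! i) = \<epsilon>))" using snoc ind by simp
  show ?case
  proof (cases "bs = []")
    \<comment> \<open>There is no earlier block from which to take \<open>d'\<close>; the single
      condition is \<open>pos \<epsilon>\<close>, moved from \<open>b\<close> to \<open>d\<close> by
      invariance.\<close>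
    case True
    have "\<not> N (\<lambda>x. \<theta> x \<and> \<rho> x b = \<epsilon>)" using assms(1,4,5) unfolding pos_def by blast
    then show ?thesis using True null_rel_ty[OF assms(4) tyd length_b, of \<epsilon>] by simp
  next
    case False
    define k where "k = length bs"
    define u where "u = concat bs"
    define Y where "Y = pattern \<theta> (\<lambda>_. \<epsilon>) k"
    define Z where "Z w \<longleftrightarrow> \<rho> (take m w) (drop m w) = \<epsilon>" for w
    have lu: "length u = n * k" using lbs by (simp add: u_def k_def length_concat_const)
    have Y: "Def M (m + length u) Y" unfolding Y_def lu by (rule Def_pattern[OF assms(4)])
    have Z: "Def M (m + n) Z" unfolding Z_def by (rule Def_eq_bool[OF rel_def])
    have Yu: "Y (x @ u) \<longleftrightarrow> \<theta> x \<and> (\<forall>i<k. \<rho> x (bs ! i) = \<epsilon>)" if "length x = m" for x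
      unfolding Y_def u_def k_def by (rule pattern_concat[OF that lbs])
    obtain U where U: "ultra_on (length u) M U" and u: "realizes U M (length u) u"
      by (rule coheir_exists)
    obtain c where c: "morley U M (length u) c" using morley_extend[OF small_M U, of 0] by auto
    then have lc: "length (c i) = length u" for i by (simp add: morley_def realizes_def)
    have "realizes U M (length u) (c 0)" using c unfolding morley_def by (blast intro: realizes_mono)
    then have uc: "ty M u (c 0)" using u by (auto simp: realizes_def ty_def)
    have "\<not> N (\<lambda>x. Y (x @ u))"
      using IH null_cong[OF S1, of "\<lambda>x. Y (x @ u)"] Yu by (simp add: k_def)
    then have "\<not> N (\<lambda>x. Y (x @ c 0))" using null_ty[OF S1 Y uc] by simp
    then have "\<not> N (\<lambda>x. Y (x @ c 0) \<and> Y (x @ c 1))"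
      using null_S1[OF S1 _ morley_indisc[OF U c], of Y] Y lc by auto
    define d' where "d' = take n (c 0)"
    obtain b1 bs' where bs: "bs = b1 # bs'" using False by (cases bs) auto
    have k: "0 < k" by (simp add: k_def bs)
    have lb1: "length b1 = n" using lbs bs by simp
    have ld': "length d' = n"
    proof -
      have "n \<le> n * k" using k by simp
      then show ?thesis by (simp add: d'_def lc lu)
    qed
    have "ty M (b1 @ concat bs') (d' @ drop n (c 0))"
      using uc by (simp add: u_def bs d'_def)
    then have "ty M b1 d'" by (rule ty_appendD) (simp add: lb1 ld')
    then have tyd': "ty M d d'"
      using snoc.prems(2) bs ty_trans[OF ty_sym[OF tyd]] ty_trans by simp blast
    have "realizes U (M \<union> set d') (length u) (c 1)"
    proof (rule realizes_mono)
      show "realizes U (M \<union> (\<Union>j<1. set (c j))) (length u) (c 1)" using c by (simp only: morley_def)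
      show "M \<union> set d' \<subseteq> M \<union> (\<Union>j<1. set (c j))" by (auto simp: d'_def dest: in_set_takeD)
    qed
    then have eq: "N (\<lambda>x. Y (x @ u) \<and> Z (x @ d)) = N (\<lambda>x. Y (x @ c 1) \<and> Z (x @ d'))"
      using null_conj_coheir[OF S1 S1' Y Z refl U u _ tyd'] d by (simp add: u_def)
    have Y0: "Z (x @ d')" if "Y (x @ c 0)" "length x = m" for x
      using that k by (auto simp: Y_def Z_def pattern_def d'_def)
    have "\<not> N (\<lambda>x. Y (x @ c 1) \<and> Z (x @ d'))"
    proof
      assume N: "N (\<lambda>x. Y (x @ c 1) \<and> Z (x @ d'))"
      have "Def UNIV m (\<lambda>x. Y (x @ c i))" for i
        by (rule Def_inst) (use Def_UNIV[OF Y] lc in auto)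
      then have "Def UNIV m (\<lambda>x. Y (x @ c 0) \<and> Y (x @ c 1))" by (simp add: Def_conj)
      from null_mono[OF S1 this N] show False
        using Y0 \<open>\<not> N (\<lambda>x. Y (x @ c 0) \<and> Y (x @ c 1))\<close> by blast
    qed
    then have "\<not> N (\<lambda>x. Y (x @ u) \<and> Z (x @ d))" by (simp only: eq not_False_eq_True)
    moreover have *: "Y (x @ u) \<and> Z (x @ d) \<longleftrightarrow>
        \<theta> x \<and> (\<forall>i<length (bs @ [d]). \<rho> x ((bs @ [d]) ! i) = \<epsilon>)" if "length x = m" for x
      using Yu[OF that] that by (auto simp: Z_def k_def nth_append less_Suc_eq)
    ultimately show ?thesis by (simp only: null_cong[OF S1 *, symmetric] not_False_eq_True)
  qed
qed

text \<open>Pairs \<open>(y_i, x_i)\<close> are built, each entry wide over all before it, with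
  value \<open>\<epsilon>\<close> between \<open>x_i\<close> and every \<open>y_j\<close>,
  \<open>j \<le> i\<close>. If all \<open>x_i\<close>, \<open>y_j\<close> with \<open>i < j\<close>
  had the other value, there would be a ladder; so some such pair has the value
  \<open>\<epsilon>\<close> in the opposite order of independence. Keeping the type of
  \<open>d\<close> over \<open>w\<close> preserves conditions already imposed on
  \<open>d\<close>.\<close>

lemma step:
  assumes \<epsilon>: "pos \<epsilon>" and wide: "wide N' n (M \<union> set w) d" and ty: "ty M b d"
  obtains a' d' where "ty M a a'" "wide N m (M \<union> set w) a'" "wide N' n (M \<union> set w \<union> set a') d'"
    "ty (M \<union> set w) d d'" "\<rho> a' d' = \<epsilon>"
proof -
  \<comment> \<open>In each pair \<open>fst\<close> is the new \<open>y\<close> and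
    \<open>snd\<close> the new \<open>x\<close>; the former is chosen before the latter.\<close>
  let ?P = "\<lambda>s (i :: nat) p. ty (M \<union> set w) d (fst p) \<and> ty M a (snd p) \<and>
     wide N' n (M \<union> set w \<union> (\<Union>j<i. set (fst (s j)) \<union> set (snd (s j)))) (fst p) \<and>
     wide N m (M \<union> set w \<union> (\<Union>j<i. set (fst (s j)) \<union> set (snd (s j))) \<union> set (fst p)) (snd p) \<and>
     (\<forall>j<i. \<rho> (snd p) (fst (s j)) = \<epsilon>) \<and> \<rho> (snd p) (fst p) = \<epsilon>"
  have "\<exists>s. \<forall>i. ?P s i (s i)"
  proof (rule dependent_wf_choice[OF wf_less, where P = ?P])
    fix s s' :: "nat \<Rightarrow> 'm list \<times> 'm list" and i p
    assume "\<And>j. (j, i) \<in> {(x, y). x < y} \<Longrightarrow> s j = s' j"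
    then have eq: "s j = s' j" if "j < i" for j using that by simp
    then have "(\<Union>j<i. set (fst (s j)) \<union> set (snd (s j))) = (\<Union>j<i. set (fst (s' j)) \<union> set (snd (s' j)))"
      by auto
    then show "?P s i p = ?P s' i p" using eq by auto
  next
    fix s i assume "\<And>j. (j, i) \<in> {(x, y). x < y} \<Longrightarrow> ?P s j (s j)"
    then have s: "?P s j (s j)" if "j < i" for j using that by simp
    define B where "B = M \<union> set w \<union> (\<Union>j<i. set (fst (s j)) \<union> set (snd (s j)))"
    have small: "small (B \<union> set y)" for y
    proof -
      have "B \<union> set y = M \<union> (set w \<union> (\<Union>j<i. set (fst (s j)) \<union> set (snd (s j))) \<union> set y)"
        by (auto simp: B_def)
      then show ?thesis
        using small_Un[OF small_M, of "set w \<union> (\<Union>j<i. set (fst (s j)) \<union> set (snd (s j))) \<union> set y"]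
        by (simp add: countable_finite)
    qed
    have "small B" using small[of "[]"] by simp
    then obtain y where y: "wide N' n B y" "ty (M \<union> set w) d y"
      using wide_extend[OF S1' _ _ wide] unfolding B_def by blast
    have tyb: "ty M b y" using ty ty_mono[OF y(2)] ty_trans by blast
    define bs where "bs = map (fst \<circ> s) [0..<i] @ [y]"
    have tybs: "ty M b b'" if b': "b' \<in> set bs" for b'
    proof -
      consider "b' = y" | j where "j < i" "b' = fst (s j)" using b' by (auto simp: bs_def)
      then show ?thesis
      proof cases
        case (2 j)
        then have "ty (M \<union> set w) d b'" using s by blast
        then have "ty M d b'" by (rule ty_mono) simp
        then show ?thesis using ty ty_trans by blast
      qed (use tyb in simp)
    qed
    have lbs: "\<forall>b'\<in>set bs. length b' = n" using tybs length_ty_b by blast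
    have "indep N' n bs"
      unfolding indep_def
    proof (intro allI impI)
      fix j assume "j < length bs"
      then consider "j = i" | "j < i" by (auto simp: bs_def less_Suc_eq)
      then show "wide N' n (M \<union> set (concat (take j bs))) (bs ! j)"
      proof cases
        case 1
        have "wide N' n (M \<union> set (concat (map (fst \<circ> s) [0..<i]))) y"
          by (rule wide_mono[OF y(1)]) (auto simp: B_def)
        then show ?thesis using 1 by (simp add: bs_def nth_append)
      next
        case 2
        have "wide N' n (M \<union> set (concat (map (fst \<circ> s) [0..<j]))) (fst (s j))"
          by (rule wide_mono[of N' n "M \<union> set w \<union> (\<Union>j'<j. set (fst (s j')) \<union> set (snd (s j')))"])
            (use s[OF 2] in auto)
        then show ?thesis using 2 by (simp add: bs_def nth_append take_map)
      qed
    qed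
    from pos_indep[OF \<epsilon> this] tybs
    have pos: "\<not> N (\<lambda>x. \<theta> x \<and> (\<forall>j<length bs. \<rho> x (bs ! j) = \<epsilon>))" if "Def M m \<theta>" "\<theta> a" for \<theta>
      using that by blast
    have "Def (B \<union> set y) m (\<lambda>x. \<forall>j<length bs. \<rho> x (bs ! j) = \<epsilon>)"
    proof (intro Def_all_less Def_rel)
      fix j assume j: "j < length bs"
      show "length (bs ! j) = n" using lbs j by simp
      have "set bs \<subseteq> insert y (fst ` s ` {..<i})" by (auto simp: bs_def)
      then show "set (bs ! j) \<subseteq> B \<union> set y" using nth_mem[OF j] by (fastforce simp: B_def)
      show "M \<subseteq> B \<union> set y" by (auto simp: B_def)
    qed
    then obtain x where x: "ty M a x" "wide N m (B \<union> set y) x" "\<forall>j<length bs. \<rho> x (bs ! j) = \<epsilon>"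
      using type_realize[OF S1 small _ _ length_a pos] unfolding B_def by blast
    have "\<rho> x (fst (s j)) = \<epsilon>" if "j < i" for j
      using x(3)[rule_format, of j] that by (simp add: bs_def nth_append)
    moreover have "\<rho> x y = \<epsilon>"
      using x(3)[rule_format, of i] by (simp add: bs_def nth_append)
    ultimately have "?P s i (y, x)" using y x(1,2) by (simp add: B_def)
    then show "\<exists>p. ?P s i p" by blast
  qed
  then obtain s where s: "\<And>i. ?P s i (s i)" by blast
  have "\<exists>i j. i < j \<and> \<rho> (snd (s i)) (fst (s j)) = \<epsilon>"
  proof (rule ccontr)
    assume neg: "\<not> ?thesis"
    \<comment> \<open>The ladder begins with \<open>snd (s 0)\<close>. Shifting the other entries by
      one turns the strict order into \<open>i \<le> j\<close>, and the sign is the opposite one,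
      \<open>\<not> \<epsilon>\<close>.\<close>
    have "\<exists>i j. (\<rho> (snd (s i)) (fst (s (Suc j))) = (\<not> \<epsilon>)) \<noteq> (i \<le> j)"
    proof (rule no_ladder)
      fix i
      have "wide N m (M \<union> set w \<union> (\<Union>j<i. set (fst (s j)) \<union> set (snd (s j))) \<union> set (fst (s i))) (snd (s i))"
        using s by blast
      then show "wide N m (M \<union> (\<Union>j<i. set (snd (s j)) \<union> set (fst (s (Suc j))))) (snd (s i))"
      proof (rule wide_mono)
        have "Suc j < i \<or> Suc j = i" if "j < i" for j using that by auto
        then show "M \<union> (\<Union>j<i. set (snd (s j)) \<union> set (fst (s (Suc j))))
          \<subseteq> M \<union> set w \<union> (\<Union>j<i. set (fst (s j)) \<union> set (snd (s j))) \<union> set (fst (s i))" by blast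
      qed
      have "wide N' n (M \<union> set w \<union> (\<Union>j<Suc i. set (fst (s j)) \<union> set (snd (s j)))) (fst (s (Suc i)))"
        using s by blast
      then show "wide N' n (M \<union> (\<Union>j\<le>i. set (snd (s j))) \<union> (\<Union>j<i. set (fst (s (Suc j))))) (fst (s (Suc i)))"
        by (rule wide_mono) force
    qed
    then obtain i j where ij: "(\<rho> (snd (s i)) (fst (s (Suc j))) = (\<not> \<epsilon>)) \<noteq> (i \<le> j)" by blast
    show False
    proof (cases "i \<le> j")
      case True
      then show False using neg ij by auto
    next
      case False
      then have "Suc j < i \<or> Suc j = i" by auto
      then have "\<rho> (snd (s i)) (fst (s (Suc j))) = \<epsilon>" using s[of i] by auto
      then show False using ij False by auto
    qed
  qed
  then obtain i j where ij: "i < j" "\<rho> (snd (s i)) (fst (s j)) = \<epsilon>" by blast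
  show thesis
  proof (rule that)
    show "ty M a (snd (s i))" "ty (M \<union> set w) d (fst (s j))" using s by blast+
    show "wide N m (M \<union> set w) (snd (s i))"
      by (rule wide_mono[of N m "M \<union> set w \<union> (\<Union>j<i. set (fst (s j)) \<union> set (snd (s j))) \<union> set (fst (s i))"])
        (use s in blast)+
    show "wide N' n (M \<union> set w \<union> set (snd (s i))) (fst (s j))"
      by (rule wide_mono[of N' n "M \<union> set w \<union> (\<Union>i<j. set (fst (s i)) \<union> set (snd (s i)))"])
        (use s ij in blast)+
  qed (fact ij)
qed

text \<open>For empty \<open>w\<close>, \<open>step\<close> yields a pair in which the entry in the
  sort of \<open>b\<close> is the later one. Its wideness over the other entry \<open>a'\<close> is
  the positivity claim at \<open>a'\<close>, which invariance carries to \<open>a\<close>.\<close>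

lemma pos_swap:
  assumes "pos \<epsilon>" shows "two_sorts.pos def0 M n N' (\<lambda>y x. \<rho> x y) b a \<epsilon>"
proof -
  interpret sw: two_sorts def0 small M n m N' N "\<lambda>y x. \<rho> x y" b a by (rule swap)
  have "wide N' n (M \<union> set []) b" using wide_b by simp
  then obtain a' d' where "ty M a a'" "wide N' n (M \<union> set [] \<union> set a') d'" "ty (M \<union> set []) b d'"
    "\<rho> a' d' = \<epsilon>"
    by (rule step[OF assms _ ty_refl])
  then have *: "ty M a a'" "wide N' n (M \<union> set a') d'" "ty M b d'" "\<rho> a' d' = \<epsilon>" by simp_all
  have la': "length a' = m" using ty_length[OF *(1)] length_a by simp
  show ?thesis unfolding sw.pos_def
  proof (intro allI impI)
    fix \<theta> assume \<theta>: "Def M n \<theta>" "\<theta> b"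
    then have "\<theta> d'" using ty_D[OF *(3)] length_b by auto
    moreover have "Def (M \<union> set a') n (\<lambda>y. \<theta> y \<and> \<rho> a' y = \<epsilon>)"
      by (intro Def_conj sw.Def_rel[OF la'] Def_mono[OF \<theta>(1)]) auto
    ultimately have "\<not> N' (\<lambda>y. \<theta> y \<and> \<rho> a' y = \<epsilon>)" using wideD[OF *(2)] *(4) by blast
    then show "\<not> N' (\<lambda>y. \<theta> y \<and> \<rho> a y = \<epsilon>)"
      using sw.null_rel_ty[OF \<theta>(1) *(1) length_a] by simp
  qed
qed

text \<open>By stationarity one good \<open>d'\<close> can stand in for \<open>d\<close>. The
  shorter pattern is realised by some \<open>x\<close> wide over \<open>u\<close>, and
  \<open>step\<close> with the sorts exchanged is applied to \<open>x\<close>: it replaces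
  \<open>x\<close> within its type over \<open>M\<close> and \<open>u\<close>, so the shorter
  pattern survives, and makes it wide over a new \<open>d'\<close> with the prescribed
  value.\<close>

lemma all_patterns:
  assumes pos: "\<And>\<epsilon>. pos \<epsilon>" and "indep N' n bs" and "\<forall>b'\<in>set bs. ty M b b'" and "Def M m \<theta>" and "\<theta> a"
  shows "\<not> N (\<lambda>x. \<theta> x \<and> (\<forall>i<length bs. \<rho> x (bs ! i) = \<eta> i))"
  using assms(2-5)
proof (induction bs arbitrary: \<theta> rule: rev_induct)
  case Nil
  then show ?case using wideD[OF wide_a] by simp
next
  case (snoc d bs)
  interpret sw: two_sorts def0 small M n m N' N "\<lambda>y x. \<rho> x y" b a by (rule swap)
  have ind: "indep N' n bs" and d: "wide N' n (M \<union> set (concat bs)) d" and tyd: "ty M b d"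
    using snoc.prems by (auto simp: indep_snoc)
  have lbs: "\<forall>b\<in>set bs. length b = n" using snoc.prems(2) length_ty_b by simp
  define k where "k = length bs"
  define u where "u = concat bs"
  define Y where "Y = pattern \<theta> \<eta> k"
  define Z where "Z w \<longleftrightarrow> \<rho> (take m w) (drop m w) = \<eta> k" for w
  have lu: "length u = n * k" using lbs by (simp add: u_def k_def length_concat_const)
  have Y: "Def M (m + length u) Y" unfolding Y_def lu by (rule Def_pattern[OF snoc.prems(3)])
  have Z: "Def M (m + n) Z" unfolding Z_def by (rule Def_eq_bool[OF rel_def])
  have Yu: "Y (x @ u) \<longleftrightarrow> \<theta> x \<and> (\<forall>i<k. \<rho> x (bs ! i) = \<eta> i)" if "length x = m" for x
    unfolding Y_def u_def k_def by (rule pattern_concat[OF that lbs])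
  have "\<forall>b'\<in>set bs. ty M b b'" using snoc.prems(2) by simp
  from snoc.IH[OF ind this]
  have IH: "\<not> N (\<lambda>x. \<theta>' x \<and> (\<forall>i<k. \<rho> x (bs ! i) = \<eta> i))" if "Def M m \<theta>'" "\<theta>' a" for \<theta>'
    using that by (simp add: k_def)
  have smallu: "small (M \<union> set u)" by (rule small_Un[OF small_M]) (auto intro: countable_finite)
  have "Def (M \<union> set u) m (\<lambda>x. \<forall>i<k. \<rho> x (bs ! i) = \<eta> i)"
  proof (intro Def_all_less Def_rel)
    fix i assume "i < k"
    then have i: "bs ! i \<in> set bs" by (simp add: k_def)
    show "length (bs ! i) = n" using lbs i by simp
    show "set (bs ! i) \<subseteq> M \<union> set u" using i by (auto simp: u_def)
  qed simp
  then obtain x where x: "ty M a x" "wide N m (M \<union> set u) x" "\<forall>i<k. \<rho> x (bs ! i) = \<eta> i"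
    using type_realize[OF S1 smallu _ _ length_a IH] by blast
  obtain d' x' where *: "ty M b d'" "wide N' n (M \<union> set u) d'" "wide N m (M \<union> set u \<union> set d') x'"
    "ty (M \<union> set u) x x'" "\<rho> x' d' = \<eta> k"
    using sw.step[OF pos_swap[OF pos] x(2,1)] by metis
  have lx: "length x = m" "length x' = m" and ld': "length d' = n"
    using x(2) *(2,3) by (auto dest: wide_length)
  have Def_Yu: "Def (M \<union> set u) m (\<lambda>x. Y (x @ u))"
    by (rule Def_inst) (use Def_mono[OF Y] in auto)
  have "\<theta> x" using ty_D[OF x(1)] snoc.prems(3,4) length_a by auto
  then have "Y (x @ u)" using x(3) Yu[OF lx(1)] by simp
  then have "Y (x' @ u)" using ty_D[OF *(4)] Def_Yu lx by auto
  moreover have "Z (x' @ d')" using *(5) lx by (simp add: Z_def)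
  moreover have "Def (M \<union> set u \<union> set d') m (\<lambda>x. Y (x @ u) \<and> Z (x @ d'))"
  proof (rule Def_conj)
    show "Def (M \<union> set u \<union> set d') m (\<lambda>x. Y (x @ u))" by (rule Def_mono[OF Def_Yu]) simp
    show "Def (M \<union> set u \<union> set d') m (\<lambda>x. Z (x @ d'))"
      by (rule Def_inst) (use Def_mono[OF Z, of "M \<union> set u \<union> set d'"] ld' in auto)
  qed
  ultimately have R: "\<not> N (\<lambda>x. Y (x @ u) \<and> Z (x @ d'))" using wideD[OF *(3)] by blast
  obtain U where U: "ultra_on (length u) M U" and u: "realizes U M (length u) u"
    by (rule coheir_exists)
  have "small (M \<union> set d)" by (rule small_Un[OF small_M]) (auto intro: countable_finite)
  then obtain u' where u': "realizes U (M \<union> set d) (length u) u'" using realizes_exists[OF _ U] by blast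
  have tyd': "ty M d' d" using ty_trans[OF ty_sym[OF *(1)] tyd] .
  have wd: "wide N' n (M \<union> set u) d" using d by (simp add: u_def)
  \<comment> \<open>Both \<open>(u, d')\<close> and \<open>(u, d)\<close> are compared with the same
    coheir pair \<open>(u', d)\<close>.\<close>
  have "\<not> N (\<lambda>x. Y (x @ u) \<and> Z (x @ d))"
    using R null_conj_coheir[OF S1 S1' Y Z refl U u *(2) tyd' u']
      null_conj_coheir[OF S1 S1' Y Z refl U u wd ty_refl u'] by simp
  moreover have eq: "Y (x @ u) \<and> Z (x @ d) \<longleftrightarrow>
      \<theta> x \<and> (\<forall>i<length (bs @ [d]). \<rho> x ((bs @ [d]) ! i) = \<eta> i)" if "length x = m" for x
    using Yu[OF that] that by (auto simp: Z_def k_def nth_append less_Suc_eq)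
  ultimately show ?case by (simp only: null_cong[OF S1 eq, symmetric] not_False_eq_True)
qed

text \<open>The set \<open>B\<close> may exceed the entries of \<open>bs\<close>: in a ladder the
  new element has to be wide over the earlier entries of both sorts, while the pattern mentions only
  one.\<close>

lemma realize_pattern:
  assumes pos: "\<And>\<epsilon>. pos \<epsilon>" and "indep N' n bs" and bs: "\<forall>b'\<in>set bs. ty M b b'"
    and B: "countable B" "set (concat bs) \<subseteq> B"
  obtains x where "ty M a x" "wide N m (M \<union> B) x" "\<forall>i<length bs. \<rho> x (bs ! i) = \<eta> i"
proof -
  have "Def (M \<union> B) m (\<lambda>x. \<forall>i<length bs. \<rho> x (bs ! i) = \<eta> i)"
  proof (intro Def_all_less Def_rel)
    fix i assume "i < length bs"
    then have i: "bs ! i \<in> set bs" by simp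
    show "length (bs ! i) = n" using i bs length_ty_b by blast
    show "set (bs ! i) \<subseteq> M \<union> B" using i B(2) by auto
  qed simp
  then show thesis
    using type_realize[OF S1 small_Un[OF small_M B(1)] _ _ length_a all_patterns[OF assms(1-3)]] that
    by blast
qed

text \<open>With all patterns available on both sides, each new \<open>x\<close> gets the value
  \<open>False\<close> against all earlier \<open>y\<close>, and then each new \<open>y\<close> the
  value \<open>True\<close> against all \<open>x\<close> so far. This is a ladder of the forbidden
  kind.\<close>

theorem not_pos_both: "\<not> (\<forall>\<epsilon>. pos \<epsilon>)"
proof
  assume "\<forall>\<epsilon>. pos \<epsilon>"
  then have pos: "pos \<epsilon>" for \<epsilon> by blast
  interpret sw: two_sorts def0 small M n m N' N "\<lambda>y x. \<rho> x y" b a by (rule swap)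
  let ?A = "\<lambda>s (i :: nat). \<Union>j<i. set (fst (s j)) \<union> set (snd (s j))"
  let ?P = "\<lambda>s (i :: nat) p. ty M a (fst p) \<and> ty M b (snd p) \<and>
     wide N m (M \<union> ?A s i) (fst p) \<and> wide N' n (M \<union> (?A s i \<union> set (fst p))) (snd p) \<and>
     (\<forall>j<i. \<not> \<rho> (fst p) (snd (s j))) \<and> (\<forall>j<i. \<rho> (fst (s j)) (snd p)) \<and> \<rho> (fst p) (snd p)"
  have "\<exists>s. \<forall>i. ?P s i (s i)"
  proof (rule dependent_wf_choice[OF wf_less, where P = ?P])
    fix s s' :: "nat \<Rightarrow> 'm list \<times> 'm list" and i p
    assume "\<And>j. (j, i) \<in> {(x, y). x < y} \<Longrightarrow> s j = s' j"
    then have eq: "s j = s' j" if "j < i" for j using that by simp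
    then have "?A s i = ?A s' i" by auto
    then show "?P s i p = ?P s' i p" using eq by auto
  next
    fix s i assume "\<And>j. (j, i) \<in> {(x, y). x < y} \<Longrightarrow> ?P s j (s j)"
    then have s: "?P s j (s j)" if "j < i" for j using that by simp
    define bs where "bs = map (snd \<circ> s) [0..<i]"
    have "indep N' n bs" unfolding indep_def
    proof (intro allI impI)
      fix j assume "j < length bs"
      then have j: "j < i" by (simp add: bs_def)
      have "wide N' n (M \<union> set (concat (map (snd \<circ> s) [0..<j]))) (snd (s j))"
        by (rule wide_mono[of N' n "M \<union> (?A s j \<union> set (fst (s j)))"]) (use s[OF j] in auto)
      then show "wide N' n (M \<union> set (concat (take j bs))) (bs ! j)"
        using j by (simp add: bs_def take_map)
    qed
    moreover have "\<forall>b'\<in>set bs. ty M b b'" using s by (auto simp: bs_def)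
    moreover have "countable (?A s i)" by (auto intro: countable_finite)
    moreover have "set (concat bs) \<subseteq> ?A s i" by (auto simp: bs_def)
    ultimately obtain x where x: "ty M a x" "wide N m (M \<union> ?A s i) x"
      "\<forall>j<length bs. \<rho> x (bs ! j) = False"
      using realize_pattern[OF pos, of bs "?A s i" "\<lambda>_. False"] by blast
    define as where "as = map (fst \<circ> s) [0..<i] @ [x]"
    have "indep N m as" unfolding indep_def
    proof (intro allI impI)
      fix j assume "j < length as"
      then consider "j = i" | "j < i" by (auto simp: as_def less_Suc_eq)
      then show "wide N m (M \<union> set (concat (take j as))) (as ! j)"
      proof cases
        case 1
        have "wide N m (M \<union> set (concat (map (fst \<circ> s) [0..<i]))) x"
          by (rule wide_mono[OF x(2)]) auto
        then show ?thesis using 1 by (simp add: as_def nth_append)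
      next
        case 2
        have "wide N m (M \<union> set (concat (map (fst \<circ> s) [0..<j]))) (fst (s j))"
          by (rule wide_mono[of N m "M \<union> ?A s j"]) (use s[OF 2] in auto)
        then show ?thesis using 2 by (simp add: as_def nth_append take_map)
      qed
    qed
    moreover have "\<forall>a'\<in>set as. ty M a a'" using s x(1) by (auto simp: as_def)
    moreover have "countable (?A s i \<union> set x)" by (auto intro: countable_finite)
    moreover have "set (concat as) \<subseteq> ?A s i \<union> set x" by (auto simp: as_def)
    ultimately obtain y where y: "ty M b y" "wide N' n (M \<union> (?A s i \<union> set x)) y"
      "\<forall>j<length as. \<rho> (as ! j) y = True"
      using sw.realize_pattern[OF pos_swap[OF pos], of as "?A s i \<union> set x" "\<lambda>_. True"] by blast
    have "\<not> \<rho> x (snd (s j))" if "j < i" for j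
      using x(3)[rule_format, of j] that by (simp add: bs_def)
    moreover have "\<rho> (fst (s j)) y" if "j < i" for j
      using y(3)[rule_format, of j] that by (simp add: as_def nth_append)
    moreover have "\<rho> x y"
      using y(3)[rule_format, of i] by (simp add: as_def nth_append)
    ultimately have "?P s i (x, y)" using x(1,2) y(1,2) by simp
    then show "\<exists>p. ?P s i p" by blast
  qed
  then obtain s where s: "\<And>i. ?P s i (s i)" by blast
  have "\<exists>i j. (\<rho> (fst (s i)) (snd (s j)) = True) \<noteq> (i \<le> j)"
  proof (rule no_ladder)
    show "wide N m (M \<union> ?A s i) (fst (s i))" for i using s by blast
    fix i
    have "wide N' n (M \<union> (?A s i \<union> set (fst (s i)))) (snd (s i))" using s by blast
    then show "wide N' n (M \<union> (\<Union>j\<le>i. set (fst (s j))) \<union> (\<Union>j<i. set (snd (s j)))) (snd (s i))"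
      by (rule wide_mono) (auto simp: le_less)
  qed
  then obtain i j where ij: "\<rho> (fst (s i)) (snd (s j)) \<noteq> (i \<le> j)" by blast
  consider "i < j" | "i = j" | "j < i" by linarith
  then show False using ij s by cases auto
qed

text \<open>The value at an independent pair is a positive sign: directly if the entry in the sort
  of \<open>a\<close> comes last, and by \<open>pos_swap\<close> with the sorts exchanged otherwise.
  Two different values would make both signs positive.\<close>

theorem rel_unique:
  assumes "ty M a a'" "ty M b b'"
    and ab: "wide N' n (M \<union> set a) b \<or> wide N m (M \<union> set b) a"
    and ab': "wide N' n (M \<union> set a') b' \<or> wide N m (M \<union> set b') a'"
  shows "\<rho> a b = \<rho> a' b'"
proof -
  interpret sw: two_sorts def0 small M n m N' N "\<lambda>y x. \<rho> x y" b a by (rule swap)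
  \<comment> \<open>Kept general in the data, so that it serves for the given sorts and for the
    exchanged ones.\<close>
  have *: "two_sorts.pos def0 M m N \<rho> a b (\<rho> a' b')"
    if "two_sorts def0 small M m n N N' \<rho> a b" "ty M a a'" "ty M b b'" "wide N m (M \<union> set b') a'"
    for m n N N' \<rho> a b a' b'
  proof -
    interpret t: two_sorts def0 small M m n N N' \<rho> a b by fact
    have l: "length a = m" "length b' = n" using t.length_a t.length_ty_b that by auto
    show ?thesis unfolding t.pos_def
    proof (intro allI impI)
      fix \<theta> assume \<theta>: "Def M m \<theta>" "\<theta> a"
      then have "\<theta> a'" using ty_D[OF that(2)] l by auto
      moreover have "Def (M \<union> set b') m (\<lambda>x. \<theta> x \<and> \<rho> x b' = \<rho> a' b')"
        by (intro Def_conj t.Def_rel[OF l(2)] Def_mono[OF \<theta>(1)]) auto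
      ultimately show "\<not> N (\<lambda>x. \<theta> x \<and> \<rho> x b = \<rho> a' b')"
        using wideD[OF that(4)] t.null_rel_ty[OF \<theta>(1) that(3) t.length_b] by simp
    qed
  qed
  have pos: "pos (\<rho> a' b')"
    if "ty M a a'" "ty M b b'" "wide N' n (M \<union> set a') b' \<or> wide N m (M \<union> set b') a'" for a' b'
    using that(3)
  proof
    assume "wide N' n (M \<union> set a') b'"
    from sw.pos_swap[OF *[OF swap that(2,1) this]] show ?thesis .
  next
    assume "wide N m (M \<union> set b') a'"
    from *[OF two_sorts_axioms that(1,2) this] show ?thesis .
  qed
  show ?thesis
  proof (rule ccontr)
    assume "\<rho> a b \<noteq> \<rho> a' b'"
    then have "pos \<epsilon>" for \<epsilon>
      using pos[OF ty_refl ty_refl ab] pos[OF assms(1,2) ab'] by (cases "\<epsilon> = \<rho> a b") auto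
    then show False using not_pos_both by blast
  qed
qed

end


section \<open>Formulas and definable predicates\<close>

lemma finite_pars_tm: "finite (pars_tm t)"
  by (induction t) auto

lemma finite_pars: "finite (pars \<phi>)"
  by (induction \<phi>) (auto simp: finite_pars_tm)

lemma finite_fv_tm: "finite (fv_tm t)"
  by (induction t) auto

lemma finite_fv: "finite (fv \<phi>)"
  by (induction \<phi>) (auto simp: finite_fv_tm)

lemma tm_val_cong: "(\<And>v. v \<in> fv_tm t \<Longrightarrow> e v = e' v) \<Longrightarrow> tm_val S e t = tm_val S e' t"
proof (induction t)
  case (App f ts)
  then have "map (tm_val S e) ts = map (tm_val S e') ts" by (intro map_cong refl) auto
  then show ?case by (simp only: tm_val.simps)
qed auto

lemma sat_cong: "(\<And>v. v \<in> fv \<phi> \<Longrightarrow> e v = e' v) \<Longrightarrow> sat D S \<phi> e = sat D S \<phi> e'"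
proof (induction \<phi> arbitrary: e e')
  case (Equ s t)
  then have "tm_val S e s = tm_val S e' s" "tm_val S e t = tm_val S e' t"
    by (auto intro!: tm_val_cong)
  then show ?case by simp
next
  case (Rel r ts)
  then have "map (tm_val S e) ts = map (tm_val S e') ts" by (intro map_cong tm_val_cong refl) auto
  then show ?case by (simp only: sat.simps)
next
  case (Con \<phi> \<psi>)
  have "sat D S \<phi> e = sat D S \<phi> e'" "sat D S \<psi> e = sat D S \<psi> e'"
    using Con.prems by (auto intro!: Con.IH)
  then show ?case by simp
next
  case (Dis \<phi> \<psi>)
  have "sat D S \<phi> e = sat D S \<phi> e'" "sat D S \<psi> e = sat D S \<psi> e'"
    using Dis.prems by (auto intro!: Dis.IH)
  then show ?case by simp
next
  case (Neg \<phi>)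
  have "sat D S \<phi> e = sat D S \<phi> e'" by (rule Neg.IH) (use Neg.prems in auto)
  then show ?case by simp
next
  case (Exi n \<phi>)
  have "sat D S \<phi> (e(n := x)) = sat D S \<phi> (e'(n := x))" for x
    by (rule Exi.IH) (use Exi.prems in auto)
  then show ?case by simp
qed simp

section \<open>Renaming variables and abstracting or instantiating parameters\<close>

primrec trans_tm :: "(nat \<Rightarrow> nat) \<Rightarrow> ('m \<Rightarrow> nat) \<Rightarrow> ('f, 'm) tm \<Rightarrow> ('f, 'm) tm" where
  "trans_tm f g (Var n) = Var (f n)"
| "trans_tm f g (Par m) = Var (g m)"
| "trans_tm f g (App h ts) = App h (map (trans_tm f g) ts)"

lemma wf_trans_tm: "wf_tm L t \<Longrightarrow> wf_tm L (trans_tm f g t)"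
  by (induction t) auto

lemma pars_trans_tm: "pars_tm (trans_tm f g t) = {}"
  by (induction t) auto

lemma fv_trans_tm: "fv_tm (trans_tm f g t) = f ` fv_tm t \<union> g ` pars_tm t"
  by (induction t) auto

lemma val_trans_tm:
  "(\<And>v. v \<in> fv_tm t \<Longrightarrow> e' v = e (f v)) \<Longrightarrow> (\<And>m. m \<in> pars_tm t \<Longrightarrow> e (g m) = m) \<Longrightarrow>
   tm_val S e (trans_tm f g t) = tm_val S e' t"
proof (induction t)
  case (App h ts)
  have "tm_val S e (trans_tm f g t) = tm_val S e' t" if "t \<in> set ts" for t
    by (rule App.IH) (use App.prems that in auto)
  then have "map (tm_val S e) (map (trans_tm f g) ts) = map (tm_val S e') ts" by simp
  then show ?case by (simp only: tm_val.simps trans_tm.simps)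
qed auto

text \<open>Bound variables are renamed afresh, so \<open>f\<close> and \<open>g\<close> need not be injective.\<close>

lemma trans_fm:
  fixes S :: "('f, 'r, 'm) struct"
  assumes "wf_fm L \<phi>"
  shows "\<exists>\<phi>'. wf_fm L \<phi>' \<and> pars \<phi>' = {} \<and> fv \<phi>' \<subseteq> f ` fv \<phi> \<union> g ` pars \<phi> \<and>
    (\<forall>e e'. (\<forall>v\<in>fv \<phi>. e' v = e (f v)) \<longrightarrow> (\<forall>m\<in>pars \<phi>. e (g m) = m) \<longrightarrow>
      sat UNIV S \<phi>' e = sat UNIV S \<phi> e')"
  using assms
proof (induction \<phi> arbitrary: f)
  case Fls
  show ?case by (intro exI[of _ Fls]) auto
next
  case (Equ s t)
  have "tm_val S e (trans_tm f g s) = tm_val S e' s" "tm_val S e (trans_tm f g t) = tm_val S e' t"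
    if "\<forall>v\<in>fv (Equ s t). e' v = e (f v)" "\<forall>m\<in>pars (Equ s t). e (g m) = m" for e e'
    using that by (auto intro!: val_trans_tm)
  then show ?case
    using Equ by (intro exI[of _ "Equ (trans_tm f g s) (trans_tm f g t)"])
      (auto simp: wf_trans_tm pars_trans_tm fv_trans_tm)
next
  case (Rel r ts)
  have "map (tm_val S e) (map (trans_tm f g) ts) = map (tm_val S e') ts"
    if "\<forall>v\<in>fv (Rel r ts). e' v = e (f v)" "\<forall>m\<in>pars (Rel r ts). e (g m) = m" for e e'
    using that by (auto intro!: val_trans_tm)
  then show ?case
    using Rel by (intro exI[of _ "Rel r (map (trans_tm f g) ts)"])
      (auto simp: wf_trans_tm pars_trans_tm fv_trans_tm simp del: map_map)
next
  case (Neg \<phi>)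
  then have wf: "wf_fm L \<phi>" by simp
  obtain \<phi>' where "wf_fm L \<phi>'" "pars \<phi>' = {}" "fv \<phi>' \<subseteq> f ` fv \<phi> \<union> g ` pars \<phi>"
    "\<And>e e'. \<forall>v\<in>fv \<phi>. e' v = e (f v) \<Longrightarrow> \<forall>m\<in>pars \<phi>. e (g m) = m \<Longrightarrow> sat UNIV S \<phi>' e = sat UNIV S \<phi> e'"
    using Neg.IH[OF wf] by blast
  then show ?case by (intro exI[of _ "Neg \<phi>'"]) auto
next
  case (Con \<phi> \<psi>)
  then have wf: "wf_fm L \<phi>" "wf_fm L \<psi>" by simp_all
  obtain \<phi>' where \<phi>': "wf_fm L \<phi>'" "pars \<phi>' = {}" "fv \<phi>' \<subseteq> f ` fv \<phi> \<union> g ` pars \<phi>"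
    "\<And>e e'. \<forall>v\<in>fv \<phi>. e' v = e (f v) \<Longrightarrow> \<forall>m\<in>pars \<phi>. e (g m) = m \<Longrightarrow> sat UNIV S \<phi>' e = sat UNIV S \<phi> e'"
    using Con.IH(1)[OF wf(1)] by blast
  obtain \<psi>' where \<psi>': "wf_fm L \<psi>'" "pars \<psi>' = {}" "fv \<psi>' \<subseteq> f ` fv \<psi> \<union> g ` pars \<psi>"
    "\<And>e e'. \<forall>v\<in>fv \<psi>. e' v = e (f v) \<Longrightarrow> \<forall>m\<in>pars \<psi>. e (g m) = m \<Longrightarrow> sat UNIV S \<psi>' e = sat UNIV S \<psi> e'"
    using Con.IH(2)[OF wf(2)] by blast
  have "sat UNIV S (Con \<phi>' \<psi>') e = sat UNIV S (Con \<phi> \<psi>) e'"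
    if "\<forall>v\<in>fv (Con \<phi> \<psi>). e' v = e (f v)" "\<forall>m\<in>pars (Con \<phi> \<psi>). e (g m) = m" for e e'
    using \<phi>'(4)[of e' e] \<psi>'(4)[of e' e] that by simp
  then show ?case using \<phi>'(1-3) \<psi>'(1-3) by (intro exI[of _ "Con \<phi>' \<psi>'"]) auto
next
  case (Dis \<phi> \<psi>)
  then have wf: "wf_fm L \<phi>" "wf_fm L \<psi>" by simp_all
  obtain \<phi>' where \<phi>': "wf_fm L \<phi>'" "pars \<phi>' = {}" "fv \<phi>' \<subseteq> f ` fv \<phi> \<union> g ` pars \<phi>"
    "\<And>e e'. \<forall>v\<in>fv \<phi>. e' v = e (f v) \<Longrightarrow> \<forall>m\<in>pars \<phi>. e (g m) = m \<Longrightarrow> sat UNIV S \<phi>' e = sat UNIV S \<phi> e'"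
    using Dis.IH(1)[OF wf(1)] by blast
  obtain \<psi>' where \<psi>': "wf_fm L \<psi>'" "pars \<psi>' = {}" "fv \<psi>' \<subseteq> f ` fv \<psi> \<union> g ` pars \<psi>"
    "\<And>e e'. \<forall>v\<in>fv \<psi>. e' v = e (f v) \<Longrightarrow> \<forall>m\<in>pars \<psi>. e (g m) = m \<Longrightarrow> sat UNIV S \<psi>' e = sat UNIV S \<psi> e'"
    using Dis.IH(2)[OF wf(2)] by blast
  have "sat UNIV S (Dis \<phi>' \<psi>') e = sat UNIV S (Dis \<phi> \<psi>) e'"
    if "\<forall>v\<in>fv (Dis \<phi> \<psi>). e' v = e (f v)" "\<forall>m\<in>pars (Dis \<phi> \<psi>). e (g m) = m" for e e'
    using \<phi>'(4)[of e' e] \<psi>'(4)[of e' e] that by simp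
  then show ?case using \<phi>'(1-3) \<psi>'(1-3) by (intro exI[of _ "Dis \<phi>' \<psi>'"]) auto
next
  case (Exi n \<phi>)
  have "finite (f ` fv \<phi> \<union> g ` pars \<phi>)" by (simp add: finite_fv finite_pars)
  then obtain w where w: "w \<notin> f ` fv \<phi> \<union> g ` pars \<phi>" using ex_new_if_finite infinite_UNIV_nat by blast
  have "wf_fm L \<phi>" using Exi.prems by simp
  from Exi.IH[OF this, of "f(n := w)"]
  obtain \<phi>' where \<phi>': "wf_fm L \<phi>'" "pars \<phi>' = {}" "fv \<phi>' \<subseteq> (f(n := w)) ` fv \<phi> \<union> g ` pars \<phi>"
    "\<And>e e'. (\<forall>v\<in>fv \<phi>. e' v = e ((f(n := w)) v)) \<Longrightarrow> (\<forall>m\<in>pars \<phi>. e (g m) = m) \<Longrightarrow>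
      sat UNIV S \<phi>' e = sat UNIV S \<phi> e'"
    by blast
  have "sat UNIV S \<phi>' (e(w := x)) = sat UNIV S \<phi> (e'(n := x))"
    if e: "\<forall>v\<in>fv (Exi n \<phi>). e' v = e (f v)" "\<forall>m\<in>pars (Exi n \<phi>). e (g m) = m" for e e' x
  proof (rule \<phi>'(4))
    show "\<forall>v\<in>fv \<phi>. (e'(n := x)) v = (e(w := x)) ((f(n := w)) v)" using e(1) w by auto
    show "\<forall>m\<in>pars \<phi>. (e(w := x)) (g m) = m" using e(2) w by auto
  qed
  moreover have "fv (Exi w \<phi>') \<subseteq> f ` fv (Exi n \<phi>) \<union> g ` pars (Exi n \<phi>)"
    using \<phi>'(3) by (auto split: if_splits)
  ultimately show ?case using \<phi>'(1,2) by (intro exI[of _ "Exi w \<phi>'"]) auto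
qed

lemma tm_val_inst: "tm_val S e (inst_tm s t) = tm_val S (\<lambda>n. case s n of None \<Rightarrow> e n | Some m \<Rightarrow> m) t"
proof (induction t)
  case (App f ts)
  then have "map (tm_val S e) (map (inst_tm s) ts) = map (tm_val S (\<lambda>n. case s n of None \<Rightarrow> e n | Some m \<Rightarrow> m)) ts"
    by auto
  then show ?case by (simp only: tm_val.simps inst_tm.simps)
qed (auto split: option.split)

lemma sat_inst_fm: "sat D S (inst_fm \<phi> s) e = sat D S \<phi> (\<lambda>n. case s n of None \<Rightarrow> e n | Some m \<Rightarrow> m)"
proof (induction \<phi> arbitrary: s e)
  case (Rel r ts)
  have "map (tm_val S e) (map (inst_tm s) ts) = map (tm_val S (\<lambda>n. case s n of None \<Rightarrow> e n | Some m \<Rightarrow> m)) ts"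
    by (simp add: tm_val_inst)
  then show ?case by (simp only: sat.simps inst_fm.simps)
next
  case (Exi k \<phi>)
  have "(\<lambda>n. case (s(k := None)) n of None \<Rightarrow> (e(k := x)) n | Some m \<Rightarrow> m) =
      (\<lambda>n. case s n of None \<Rightarrow> e n | Some m \<Rightarrow> m)(k := x)" for x
    by (auto split: option.split)
  then show ?case by (simp add: Exi.IH)
qed (auto simp: tm_val_inst)

lemma fv_inst_tm: "fv_tm (inst_tm s t) = fv_tm t - dom s"
  by (induction t) (auto split: option.splits)

lemma fv_inst_fm: "fv (inst_fm \<phi> s) = fv \<phi> - dom s"
  by (induction \<phi> arbitrary: s) (auto simp: fv_inst_tm)

lemma pars_inst_tm: "pars_tm (inst_tm s t) \<subseteq> pars_tm t \<union> ran s"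
  by (induction t) (auto split: option.splits intro: ranI)

lemma ran_upd_None: "ran (s(n := None)) \<subseteq> ran s"
  by (auto simp: ran_def)

lemma pars_inst_fm: "pars (inst_fm \<phi> s) \<subseteq> pars \<phi> \<union> ran s"
proof (induction \<phi> arbitrary: s)
  case (Equ t u)
  then show ?case using pars_inst_tm[of s t] pars_inst_tm[of s u] by auto
next
  case (Rel r ts)
  then show ?case using pars_inst_tm[of s] by fastforce
next
  case (Con \<phi> \<psi>)
  then show ?case using Con.IH[of s] by auto
next
  case (Dis \<phi> \<psi>)
  then show ?case using Dis.IH[of s] by auto
next
  case (Exi n \<phi>)
  then show ?case using Exi.IH[of "s(n := None)"] ran_upd_None[of s n] by auto
qed auto

lemma wf_inst_tm: "wf_tm L t \<Longrightarrow> wf_tm L (inst_tm s t)"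
  by (induction t) (auto split: option.splits)

lemma wf_inst_fm: "wf_fm L \<phi> \<Longrightarrow> wf_fm L (inst_fm \<phi> s)"
  by (induction \<phi> arbitrary: s) (auto simp: wf_inst_tm)

lemma inst_formulas:
  assumes "\<phi> \<in> formulas L A (X \<union> set zs)" "length c = length zs" "set c \<subseteq> A"
  shows "inst zs c \<phi> \<in> formulas L A X"
proof -
  have "dom (map_of (zip zs c)) = set zs" using assms(2) by simp
  moreover have "ran (map_of (zip zs c)) \<subseteq> set c"
    by (auto simp: ran_def dest!: map_of_SomeD set_zip_rightD)
  ultimately show ?thesis
    using assms pars_inst_fm[of \<phi> "map_of (zip zs c)"]
    by (auto simp: formulas_def inst_def wf_inst_fm fv_inst_fm)
qed

lemma formulas_mono: "A \<subseteq> B \<Longrightarrow> X \<subseteq> Y \<Longrightarrow> formulas L A X \<subseteq> formulas L B Y"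
  by (auto simp: formulas_def)

lemma asg_nth:
  assumes "distinct xs" "length a = length xs" "i < length xs"
  shows "asg xs a (xs ! i) = a ! i"
  using assms by (simp add: asg_def map_of_zip_nth)

lemma asg_upt: "length a = n \<Longrightarrow> i < n \<Longrightarrow> asg [0..<n] a i = a ! i"
  using asg_nth[of "[0..<n]" a i] by simp

lemma asg_map: "distinct xs \<Longrightarrow> v \<in> set xs \<Longrightarrow> asg xs (map e xs) v = e v"
  by (auto simp: in_set_conv_nth asg_nth)

lemma holds_map: "distinct xs \<Longrightarrow> fv \<phi> \<subseteq> set xs \<Longrightarrow> holds S xs \<phi> (map e xs) = sat UNIV S \<phi> e"
  unfolding holds_def by (rule sat_cong) (auto simp: asg_map)

lemma entails_single:
  assumes "distinct xs" "fv \<phi> \<subseteq> set xs" "fv \<psi> \<subseteq> set xs"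
    and "\<And>x. length x = length xs \<Longrightarrow> holds S xs \<phi> x \<Longrightarrow> holds S xs \<psi> x"
  shows "entails S {\<phi>} \<psi>"
  unfolding entails_def
proof (intro allI impI)
  fix e assume "\<forall>\<phi>\<in>{\<phi>}. sat UNIV S \<phi> e"
  then show "sat UNIV S \<psi> e"
    using assms(4)[of "map e xs"] holds_map[OF assms(1,2), of S e] holds_map[OF assms(1,3), of S e] by simp
qed

lemma holds_simps:
  "holds S xs Fls x = False"
  "holds S xs (Neg \<phi>) x = (\<not> holds S xs \<phi> x)"
  "holds S xs (Con \<phi> \<psi>) x = (holds S xs \<phi> x \<and> holds S xs \<psi> x)"
  "holds S xs (Dis \<phi> \<psi>) x = (holds S xs \<phi> x \<or> holds S xs \<psi> x)"
  by (simp_all add: holds_def)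

section \<open>Definable and null predicates given by formulas\<close>

definition fdef :: "('f, 'r) lang \<Rightarrow> ('f, 'r, 'm) struct \<Rightarrow> nat \<Rightarrow> ('m list \<Rightarrow> bool) \<Rightarrow> bool" where
  "fdef L S n P \<longleftrightarrow> (\<exists>\<phi>\<in>formulas L {} {..<n}. \<forall>x. length x = n \<longrightarrow> P x = holds S [0..<n] \<phi> x)"

definition null :: "('f, 'r, 'm) struct \<Rightarrow> nat list \<Rightarrow> ('f, 'r, 'm) fm set \<Rightarrow> ('m list \<Rightarrow> bool) \<Rightarrow> bool" where
  "null S xs I P \<longleftrightarrow> (\<exists>\<phi>\<in>I. \<forall>x. length x = length xs \<longrightarrow> P x = holds S xs \<phi> x)"

locale language_structure =
  fixes L :: "('f, 'r) lang" and S :: "('f, 'r, 'm) struct"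

sublocale language_structure \<subseteq> definability "fdef L S"
proof
  fix n m and P Q :: "'m list \<Rightarrow> bool" and h
  show "fdef L S n Q" if "fdef L S n P" "\<And>x. length x = n \<Longrightarrow> P x = Q x"
    using that unfolding fdef_def by metis
  show "fdef L S n (\<lambda>_. True)"
    unfolding fdef_def by (rule bexI[of _ "Neg Fls"]) (auto simp: formulas_def holds_simps)
  show "fdef L S n (\<lambda>x. \<not> P x)" if P: "fdef L S n P"
  proof -
    obtain \<phi> where "\<phi> \<in> formulas L {} {..<n}" "\<forall>x. length x = n \<longrightarrow> P x = holds S [0..<n] \<phi> x"
      using P by (auto simp: fdef_def)
    then show ?thesis
      unfolding fdef_def by (intro bexI[of _ "Neg \<phi>"]) (auto simp: formulas_def holds_simps)
  qed
  show "fdef L S n (\<lambda>x. P x \<and> Q x)" if P: "fdef L S n P" and Q: "fdef L S n Q"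
  proof -
    obtain \<phi> where "\<phi> \<in> formulas L {} {..<n}" "\<forall>x. length x = n \<longrightarrow> P x = holds S [0..<n] \<phi> x"
      using P by (auto simp: fdef_def)
    moreover obtain \<psi> where "\<psi> \<in> formulas L {} {..<n}" "\<forall>x. length x = n \<longrightarrow> Q x = holds S [0..<n] \<psi> x"
      using Q by (auto simp: fdef_def)
    ultimately show ?thesis
      unfolding fdef_def by (intro bexI[of _ "Con \<phi> \<psi>"]) (auto simp: formulas_def holds_simps)
  qed
  show "fdef L S n (\<lambda>x. P (h x))" if P: "fdef L S m P" and h: "picks n m h"
  proof -
    obtain \<phi> where \<phi>: "\<phi> \<in> formulas L {} {..<m}" "\<forall>x. length x = m \<longrightarrow> P x = holds S [0..<m] \<phi> x"
      using P by (auto simp: fdef_def)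
    obtain f where f: "\<forall>i<m. f i < n" "\<forall>x. length x = n \<longrightarrow> h x = map (\<lambda>i. x ! f i) [0..<m]"
      using h by (auto simp: picks_def)
    have pf: "wf_fm L \<phi>" "pars \<phi> = {}" "fv \<phi> \<subseteq> {..<m}" using \<phi>(1) by (auto simp: formulas_def)
    obtain \<phi>' where \<phi>': "wf_fm L \<phi>'" "pars \<phi>' = {}" "fv \<phi>' \<subseteq> f ` fv \<phi>"
      "\<And>e e'. \<forall>v\<in>fv \<phi>. e' v = e (f v) \<Longrightarrow> sat UNIV S \<phi>' e = sat UNIV S \<phi> e'"
      \<comment> \<open>No parameter occurs in \<open>\<phi>\<close>, so the map on parameters is
        arbitrary and \<open>undefined\<close> is put for it.\<close>
      using trans_fm[OF pf(1), of f undefined S] pf(2) by auto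
    have "\<phi>' \<in> formulas L {} {..<n}" using \<phi>'(1-3) pf(3) f(1) by (auto simp: formulas_def)
    moreover have "P (h x) = holds S [0..<n] \<phi>' x" if x: "length x = n" for x
    proof -
      have "asg [0..<m] (h x) v = asg [0..<n] x (f v)" if "v < m" for v
        using that f x by (simp add: asg_upt)
      then have "sat UNIV S \<phi>' (asg [0..<n] x) = sat UNIV S \<phi> (asg [0..<m] (h x))"
        using pf(3) by (intro \<phi>'(4)) auto
      then show ?thesis using \<phi>(2) picks_length[OF h x] by (simp add: holds_def)
    qed
    ultimately show ?thesis unfolding fdef_def by blast
  qed
qed

context language_structure
begin

text \<open>The parameters of \<open>\<phi>\<close> are listed in \<open>c\<close> and turned into
  variables behind those of \<open>xs\<close>: a variable goes to its position in \<open>xs\<close>,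
  a parameter to \<open>length xs\<close> plus its position in \<open>c\<close>.\<close>

lemma Def_holds:
  assumes xs: "distinct xs" and \<phi>: "\<phi> \<in> formulas L A (set xs)"
  shows "Def A (length xs) (holds S xs \<phi>)"
proof -
  let ?n = "length xs"
  obtain c where c: "set c = pars \<phi>" using finite_list[OF finite_pars[of \<phi>]] by blast
  have "\<forall>v\<in>set xs. \<exists>i. i < ?n \<and> xs ! i = v" by (auto simp: in_set_conv_nth)
  from bchoice[OF this] obtain f where f: "\<And>v. v \<in> set xs \<Longrightarrow> f v < ?n \<and> xs ! f v = v" by blast
  have "\<forall>m\<in>set c. \<exists>i. i < length c \<and> c ! i = m" by (auto simp: in_set_conv_nth)
  from bchoice[OF this] obtain g where g: "\<And>m. m \<in> set c \<Longrightarrow> g m < length c \<and> c ! g m = m" by blast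
  have pf: "wf_fm L \<phi>" "pars \<phi> \<subseteq> A" "fv \<phi> \<subseteq> set xs" using \<phi> by (auto simp: formulas_def)
  obtain \<phi>' where \<phi>': "wf_fm L \<phi>'" "pars \<phi>' = {}" "fv \<phi>' \<subseteq> f ` fv \<phi> \<union> (\<lambda>m. ?n + g m) ` pars \<phi>"
    "\<And>e e'. \<forall>v\<in>fv \<phi>. e' v = e (f v) \<Longrightarrow> \<forall>m\<in>pars \<phi>. e (?n + g m) = m \<Longrightarrow> sat UNIV S \<phi>' e = sat UNIV S \<phi> e'"
    using trans_fm[OF pf(1), of f "\<lambda>m. ?n + g m" S] by auto
  show ?thesis
  proof (rule DefI)
    show "set c \<subseteq> A" using c pf(2) by simp
    have "f ` fv \<phi> \<union> (\<lambda>m. ?n + g m) ` pars \<phi> \<subseteq> {..<?n + length c}"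
      using pf(3) f g c by (auto intro: trans_less_add1)
    from order_trans[OF \<phi>'(3) this] have "\<phi>' \<in> formulas L {} {..<?n + length c}"
      using \<phi>'(1,2) by (simp add: formulas_def)
    then show "fdef L S (?n + length c) (holds S [0..<?n + length c] \<phi>')" unfolding fdef_def by blast
    fix x :: "'m list" assume x: "length x = ?n"
    let ?e = "asg [0..<?n + length c] (x @ c)"
    have e: "?e i = (x @ c) ! i" if "i < ?n + length c" for i
      by (rule asg_upt) (use x that in auto)
    have "sat UNIV S \<phi>' ?e = sat UNIV S \<phi> (asg xs x)"
    proof (rule \<phi>'(4); intro ballI)
      fix v assume "v \<in> fv \<phi>"
      then have v: "f v < ?n" "xs ! f v = v" using pf(3) f by auto
      then show "asg xs x v = ?e (f v)"
        using asg_nth[OF xs x v(1)] e[of "f v"] x by (simp add: nth_append)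
    next
      fix m assume "m \<in> pars \<phi>"
      then have m: "g m < length c" "c ! g m = m" using c g by auto
      then show "?e (?n + g m) = m" using e[of "?n + g m"] nth_append_length_plus[of x c "g m"] x by simp
    qed
    then show "holds S xs \<phi> x = holds S [0..<?n + length c] \<phi>' (x @ c)" by (simp add: holds_def)
  qed
qed

text \<open>Positions are renamed back to actual variables \<open>xs @ zs\<close>, because
  invariance and S1 of an ideal are phrased for formulas in \<open>xs\<close> with parameters put
  for the variables \<open>zs\<close>.\<close>

lemma fdef_inst:
  assumes Q: "fdef L S (length xs + length zs) Q" and d: "distinct (xs @ zs)"
  obtains \<phi> where "\<phi> \<in> formulas L {} (set xs \<union> set zs)"
    "\<And>x c. length x = length xs \<Longrightarrow> length c = length zs \<Longrightarrow> holds S xs (inst zs c \<phi>) x = Q (x @ c)"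
proof -
  let ?n = "length xs + length zs"
  obtain \<phi> where \<phi>: "\<phi> \<in> formulas L {} {..<?n}" "\<And>x. length x = ?n \<Longrightarrow> Q x = holds S [0..<?n] \<phi> x"
    using Q by (auto simp: fdef_def)
  have pf: "wf_fm L \<phi>" "pars \<phi> = {}" "fv \<phi> \<subseteq> {..<?n}" using \<phi>(1) by (auto simp: formulas_def)
  define f where "f i = (xs @ zs) ! i" for i
  obtain \<phi>' where \<phi>': "wf_fm L \<phi>'" "pars \<phi>' = {}" "fv \<phi>' \<subseteq> f ` fv \<phi>"
    "\<And>e e'. \<forall>v\<in>fv \<phi>. e' v = e (f v) \<Longrightarrow> sat UNIV S \<phi>' e = sat UNIV S \<phi> e'"
    using trans_fm[OF pf(1), of f undefined S] pf(2) by auto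
  have "f i \<in> set (xs @ zs)" if "i < ?n" for i unfolding f_def by (rule nth_mem) (use that in simp)
  then have "f ` fv \<phi> \<subseteq> set xs \<union> set zs" using pf(3) by auto
  from order_trans[OF \<phi>'(3) this] have "\<phi>' \<in> formulas L {} (set xs \<union> set zs)"
    using \<phi>'(1,2) by (simp add: formulas_def)
  moreover have "holds S xs (inst zs c \<phi>') x = Q (x @ c)" if x: "length x = length xs" and c: "length c = length zs" for x c
  proof -
    let ?e = "\<lambda>n. case map_of (zip zs c) n of None \<Rightarrow> asg xs x n | Some m \<Rightarrow> m"
    have "asg [0..<?n] (x @ c) i = ?e (f i)" if i: "i < ?n" for i
    proof (cases "i < length xs")
      case True
      then have "xs ! i \<notin> set zs" using d nth_mem[OF True] by (auto simp: disjoint_iff simp del: nth_mem)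
      then have none: "map_of (zip zs c) (xs ! i) = None" using c by simp
      have "f i = xs ! i" using True by (simp add: f_def nth_append)
      then have "?e (f i) = asg xs x (xs ! i)" by (simp only: none option.case)
      then show ?thesis
        using True asg_upt[of "x @ c" ?n i] i asg_nth[of xs x i] d x c by (simp add: nth_append)
    next
      case False
      then obtain j where j: "i = length xs + j" "j < length zs" using i by (metis add_diff_inverse_nat nat_add_left_cancel_less)
      have "map_of (zip zs c) (zs ! j) = Some (c ! j)" using d c j by (simp add: map_of_zip_nth)
      moreover have "f i = zs ! j" by (simp add: f_def j)
      moreover have "(x @ c) ! i = c ! j" using x j nth_append_length_plus[of x c j] by simp
      ultimately show ?thesis using asg_upt[of "x @ c" ?n i] i x c by simp
    qed
    then have "sat UNIV S \<phi>' ?e = sat UNIV S \<phi> (asg [0..<?n] (x @ c))"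
      using pf(3) by (intro \<phi>'(4)) auto
    then show ?thesis using \<phi>(2)[of "x @ c"] x c by (simp add: holds_def inst_def sat_inst_fm)
  qed
  ultimately show thesis by (rule that)
qed

lemma fresh_variables:
  fixes xs :: "nat list"
  obtains zs where "length zs = k" "distinct zs" "set xs \<inter> set zs = {}"
proof -
  obtain b where "\<forall>v\<in>set xs. v < b" using finite_nat_set_iff_bounded[of "set xs"] by auto
  then show thesis by (intro that[of "[b..<b + k]"]) auto
qed

lemma Def_formula:
  assumes P: "Def A (length xs) P" and xs: "distinct xs"
  obtains \<phi> where "\<phi> \<in> formulas L A (set xs)" "\<And>x. length x = length xs \<Longrightarrow> P x = holds S xs \<phi> x"
proof -
  obtain c Q where c: "set c \<subseteq> A" "fdef L S (length xs + length c) Q" "\<And>x. length x = length xs \<Longrightarrow> P x = Q (x @ c)"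
    using P by (rule DefE) blast
  obtain zs where zs: "length zs = length c" "distinct zs" "set xs \<inter> set zs = {}"
    using fresh_variables by blast
  have "distinct (xs @ zs)" using xs zs by simp
  from fdef_inst[OF _ this, of Q] obtain \<phi> where \<phi>: "\<phi> \<in> formulas L {} (set xs \<union> set zs)"
    "\<And>x c. length x = length xs \<Longrightarrow> length c = length zs \<Longrightarrow> holds S xs (inst zs c \<phi>) x = Q (x @ c)"
    using c(2) zs(1) by metis
  have "inst zs c \<phi> \<in> formulas L A (set xs)"
    by (rule inst_formulas) (use \<phi>(1) formulas_mono[of "{}" A] zs c in auto)
  then show thesis using that[of "inst zs c \<phi>"] \<phi>(2) c(3) zs(1) by simp
qed

lemma same_type_iff: "same_type L S A a b \<longleftrightarrow> ty A a b"
proof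
  assume st: "same_type L S A a b"
  then have len: "length a = length b" by (simp add: same_type_def)
  show "ty A a b" unfolding ty_def
  proof (intro conjI allI impI)
    fix P assume "Def A (length a) P"
    then have "Def A (length [0..<length a]) P" by simp
    then obtain \<phi> where \<phi>: "\<phi> \<in> formulas L A (set [0..<length a])"
      "\<And>x. length x = length [0..<length a] \<Longrightarrow> P x = holds S [0..<length a] \<phi> x"
      using Def_formula by (metis distinct_upt)
    then show "P a = P b" using st len by (auto simp: same_type_def tp_def)
  qed (fact len)
next
  assume ty: "ty A a b"
  then have len: "length a = length b" by (rule ty_length)
  have "holds S [0..<length a] \<phi> a = holds S [0..<length a] \<phi> b"
    if "\<phi> \<in> formulas L A (set [0..<length a])" for \<phi>
    using ty_D[OF ty] Def_holds[OF _ that] by simp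
  then show "same_type L S A a b" using len by (auto simp: same_type_def tp_def)
qed

lemma indiscernible_iff: "indiscernible L S A c \<longleftrightarrow> indisc A c"
  by (simp add: indiscernible_def indisc_def same_type_iff)

text \<open>Closure under implication makes membership in the ideal depend only on the set defined,
  so any formula defining \<open>P\<close> can be used to test whether \<open>P\<close> is
  null.\<close>

lemma null_iff:
  assumes I: "ideal L S xs I" and xs: "distinct xs" and \<phi>: "\<phi> \<in> formulas L UNIV (set xs)"
    and P: "\<And>x. length x = length xs \<Longrightarrow> P x = holds S xs \<phi> x"
  shows "null S xs I P \<longleftrightarrow> \<phi> \<in> I"
proof
  assume "null S xs I P"
  then obtain \<psi> where \<psi>: "\<psi> \<in> I" "\<forall>x. length x = length xs \<longrightarrow> P x = holds S xs \<psi> x" by (auto simp: null_def)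
  then have "\<psi> \<in> formulas L UNIV (set xs)" using I by (auto simp: ideal_def)
  then have "entails S {\<phi>} \<psi>"
    using \<phi> P \<psi> by (intro entails_single[OF xs]) (auto simp: formulas_def)
  then show "\<phi> \<in> I" using I \<phi> \<psi>(1) by (auto simp: ideal_def)
qed (use P in \<open>auto simp: null_def\<close>)

lemma S1_null:
  assumes I: "S1_ideal L S {} xs I" and xs: "distinct xs"
  shows "S1 (length xs) (null S xs I)"
proof -
  have ideal: "ideal L S xs I" using I by (simp add: S1_ideal_def)
  have sub: "I \<subseteq> formulas L UNIV (set xs)" using ideal by (simp add: ideal_def)
  show ?thesis unfolding S1_def
  proof (intro conjI allI impI)
    show "null S xs I (\<lambda>_. False)"
      using ideal by (auto simp: null_def ideal_def holds_simps intro!: bexI[of _ Fls])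
    fix P Q
    show "null S xs I Q" if "null S xs I P" "\<forall>x. length x = length xs \<longrightarrow> P x = Q x"
      using that unfolding null_def by metis
    show "null S xs I P" if P: "Def UNIV (length xs) P" and Q: "null S xs I Q"
      and PQ: "\<forall>x. length x = length xs \<longrightarrow> P x \<longrightarrow> Q x"
    proof -
      obtain \<phi> where \<phi>: "\<phi> \<in> formulas L UNIV (set xs)" "\<And>x. length x = length xs \<Longrightarrow> P x = holds S xs \<phi> x"
        using Def_formula[OF P xs] by blast
      obtain \<psi> where \<psi>: "\<psi> \<in> I" "\<forall>x. length x = length xs \<longrightarrow> Q x = holds S xs \<psi> x"
        using Q by (auto simp: null_def)
      have "entails S {\<phi>} \<psi>"
        using \<phi> \<psi> PQ sub by (intro entails_single[OF xs]) (auto simp: formulas_def)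
      then have "\<phi> \<in> I" using ideal \<phi>(1) \<psi>(1) by (auto simp: ideal_def)
      then show ?thesis using \<phi>(2) by (auto simp: null_def)
    qed
    show "null S xs I (\<lambda>x. P x \<or> Q x)" if P: "null S xs I P" and Q: "null S xs I Q"
    proof -
      obtain \<phi> \<psi> where "\<phi> \<in> I" "\<forall>x. length x = length xs \<longrightarrow> P x = holds S xs \<phi> x"
        "\<psi> \<in> I" "\<forall>x. length x = length xs \<longrightarrow> Q x = holds S xs \<psi> x"
        using P Q by (auto simp: null_def)
      moreover have "Dis \<phi> \<psi> \<in> I" using calculation ideal by (simp add: ideal_def)
      ultimately show ?thesis by (auto simp: null_def holds_simps intro!: bexI[of _ "Dis \<phi> \<psi>"])
    qed
  next
    fix P and c c' :: "'m list"
    assume P: "fdef L S (length xs + length c) P" and ty: "ty {} c c'"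
      and N: "null S xs I (\<lambda>x. P (x @ c))"
    obtain zs where zs: "length zs = length c" "distinct zs" "set xs \<inter> set zs = {}"
      using fresh_variables by blast
    have "distinct (xs @ zs)" using xs zs by simp
    from fdef_inst[OF _ this, of P] obtain \<phi> where \<phi>: "\<phi> \<in> formulas L {} (set xs \<union> set zs)"
      "\<And>x c. length x = length xs \<Longrightarrow> length c = length zs \<Longrightarrow> holds S xs (inst zs c \<phi>) x = P (x @ c)"
      using P zs(1) by metis
    have form: "inst zs d \<phi> \<in> formulas L UNIV (set xs)" if "length d = length zs" for d
      by (rule inst_formulas) (use \<phi>(1) formulas_mono[of "{}" UNIV] that in auto)
    have "inst zs c \<phi> \<in> I"
      using null_iff[OF ideal xs form, of c "\<lambda>x. P (x @ c)"] N \<phi>(2) zs(1) by simp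
    moreover have "same_type L S {} c c'" using ty by (simp add: same_type_iff)
    moreover have "invariant L S {} xs I" using I by (simp add: S1_ideal_def)
    ultimately have "inst zs c' \<phi> \<in> I" using \<phi>(1) zs unfolding invariant_def by metis
    then show "null S xs I (\<lambda>x. P (x @ c'))"
      using null_iff[OF ideal xs form, of c' "\<lambda>x. P (x @ c')"] \<phi>(2) zs(1) ty_length[OF ty] by simp
  next
    fix P and c :: "nat \<Rightarrow> 'm list"
    assume P: "fdef L S (length xs + length (c 0)) P" and ind: "indisc {} c"
      and N: "null S xs I (\<lambda>x. P (x @ c 0) \<and> P (x @ c 1))"
    obtain zs where zs: "length zs = length (c 0)" "distinct zs" "set xs \<inter> set zs = {}"
      using fresh_variables by blast
    have "distinct (xs @ zs)" using xs zs by simp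
    from fdef_inst[OF _ this, of P] obtain \<phi> where \<phi>: "\<phi> \<in> formulas L {} (set xs \<union> set zs)"
      "\<And>x c. length x = length xs \<Longrightarrow> length c = length zs \<Longrightarrow> holds S xs (inst zs c \<phi>) x = P (x @ c)"
      using P zs(1) by metis
    have form: "inst zs d \<phi> \<in> formulas L UNIV (set xs)" if "length d = length zs" for d
      by (rule inst_formulas) (use \<phi>(1) formulas_mono[of "{}" UNIV] that in auto)
    have l: "length (c 0) = length zs" "length (c 1) = length zs"
      using ind zs(1) unfolding indisc_def by metis+
    have "Con (inst zs (c 0) \<phi>) (inst zs (c 1) \<phi>) \<in> formulas L UNIV (set xs)"
      using form[OF l(1)] form[OF l(2)] by (auto simp: formulas_def)
    then have "Con (inst zs (c 0) \<phi>) (inst zs (c 1) \<phi>) \<in> I"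
      using null_iff[OF ideal xs, of _ "\<lambda>x. P (x @ c 0) \<and> P (x @ c 1)"] N \<phi>(2) l by (simp add: holds_simps)
    moreover have "indiscernible L S {} c" using ind by (simp add: indiscernible_iff)
    ultimately have "inst zs (c 0) \<phi> \<in> I"
      using I \<phi>(1) zs l unfolding S1_ideal_def by metis
    then show "null S xs I (\<lambda>x. P (x @ c 0))"
      using null_iff[OF ideal xs form[OF l(1)], of "\<lambda>x. P (x @ c 0)"] \<phi>(2) l by simp
  qed
qed

end


section \<open>Monster models\<close>

lemma sat_foldr_Exi:
  "sat D S (foldr Exi vs \<phi>) e \<longleftrightarrow>
     (\<exists>e'. (\<forall>v\<in>set vs. e' v \<in> D) \<and> (\<forall>v. v \<notin> set vs \<longrightarrow> e' v = e v) \<and> sat D S \<phi> e')"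
proof (induction vs arbitrary: e)
  case Nil
  have "e' = e" if "\<forall>v. e' v = e v" for e' using that by auto
  then show ?case by auto
next
  case (Cons v vs)
  show ?case
  proof
    assume "sat D S (foldr Exi (v # vs) \<phi>) e"
    then obtain m e' where m: "m \<in> D" "\<forall>v\<in>set vs. e' v \<in> D"
      "\<forall>v'. v' \<notin> set vs \<longrightarrow> e' v' = (e(v := m)) v'" "sat D S \<phi> e'"
      by (auto simp: Cons.IH)
    have "e' v \<in> D" using m by (cases "v \<in> set vs") auto
    then show "\<exists>e'. (\<forall>v\<in>set (v # vs). e' v \<in> D) \<and> (\<forall>v'. v' \<notin> set (v # vs) \<longrightarrow> e' v' = e v') \<and> sat D S \<phi> e'"
      using m by (intro exI[of _ e']) auto
  next
    assume "\<exists>e'. (\<forall>v\<in>set (v # vs). e' v \<in> D) \<and> (\<forall>v'. v' \<notin> set (v # vs) \<longrightarrow> e' v' = e v') \<and> sat D S \<phi> e'"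
    then obtain e' where "\<forall>v\<in>set (v # vs). e' v \<in> D" "\<forall>v'. v' \<notin> set (v # vs) \<longrightarrow> e' v' = e v'" "sat D S \<phi> e'"
      by blast
    then show "sat D S (foldr Exi (v # vs) \<phi>) e"
      by (auto simp: Cons.IH intro!: bexI[of _ "e' v"] exI[of _ e'])
  qed
qed

lemma foldr_Exi_formulas: "\<phi> \<in> formulas L A (set vs) \<Longrightarrow> foldr Exi vs \<phi> \<in> formulas L A {}"
proof -
  have "fv (foldr Exi vs \<phi>) = fv \<phi> - set vs" "pars (foldr Exi vs \<phi>) = pars \<phi>"
    "wf_fm L (foldr Exi vs \<phi>) = wf_fm L \<phi>"
    by (induction vs) auto
  then show "\<phi> \<in> formulas L A (set vs) \<Longrightarrow> foldr Exi vs \<phi> \<in> formulas L A {}"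
    by (auto simp: formulas_def)
qed

context language_structure
begin

text \<open>Elementarity is given for sentences over \<open>M\<close> and is used twice: for the
  existential closure of the formula, to find a witness in \<open>M\<close>, and for the instance at
  that witness, to carry its truth back to the ambient structure.\<close>

lemma elementary_substructure_model:
  assumes M: "elementary_substructure L S M" and P: "Def M l P" and v: "length v = l" "P v"
  shows "\<exists>w. length w = l \<and> set w \<subseteq> M \<and> P w"
proof -
  let ?xs = "[0..<l]"
  have el: "sat M S \<sigma> e \<longleftrightarrow> sat UNIV S \<sigma> e" if "\<sigma> \<in> formulas L M {}" for \<sigma> e
    using M that by (simp add: elementary_substructure_def)
  have "Def M (length ?xs) P" using P by simp
  then obtain \<phi> where \<phi>: "\<phi> \<in> formulas L M (set ?xs)" "\<And>x. length x = length ?xs \<Longrightarrow> P x = holds S ?xs \<phi> x"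
    by (rule Def_formula) auto
  have "sat UNIV S \<phi> (asg ?xs v)" using \<phi>(2)[of v] v by (simp add: holds_def)
  then have "sat UNIV S (foldr Exi ?xs \<phi>) (asg ?xs v)" by (auto simp: sat_foldr_Exi)
  then have "sat M S (foldr Exi ?xs \<phi>) (asg ?xs v)" using el[OF foldr_Exi_formulas[OF \<phi>(1)]] by simp
  then obtain e where e: "\<forall>v\<in>set ?xs. e v \<in> M" "sat M S \<phi> e" unfolding sat_foldr_Exi by blast
  define w where "w = map e ?xs"
  have w: "length w = l" "set w \<subseteq> M" using e(1) by (auto simp: w_def)
  have inst: "inst ?xs w \<phi> \<in> formulas L M {}"
    by (rule inst_formulas) (use \<phi>(1) w in auto)
  have "(case map_of (zip ?xs w) v of None \<Rightarrow> e v | Some m \<Rightarrow> m) = e v" for v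
    by (auto simp: w_def map_of_zip_map split: option.split)
  then have "sat D S (inst ?xs w \<phi>) e = sat D S \<phi> e" for D
    by (simp add: inst_def sat_inst_fm)
  then have "sat UNIV S \<phi> e" using el[OF inst, of e] e(2) by simp
  then have "holds S ?xs \<phi> w" using holds_map[of ?xs \<phi> S e] \<phi>(1) by (auto simp: w_def formulas_def)
  then have "P w" using \<phi>(2)[of w] w by simp
  then show ?thesis using w by blast
qed

lemma saturated_Def:
  assumes sat: "saturated L S \<kappa>" and A: "|A| <o \<kappa>" and F: "\<And>P. P \<in> F \<Longrightarrow> Def A n P"
    and fin: "\<And>G. finite G \<Longrightarrow> G \<subseteq> F \<Longrightarrow> \<exists>x. length x = n \<and> (\<forall>P\<in>G. P x)"
  shows "\<exists>x. length x = n \<and> (\<forall>P\<in>F. P x)"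
proof -
  let ?xs = "[0..<n]"
  have "\<forall>P\<in>F. \<exists>\<phi>. \<phi> \<in> formulas L A (set ?xs) \<and> (\<forall>x. length x = n \<longrightarrow> P x = holds S ?xs \<phi> x)"
  proof
    fix P assume "P \<in> F"
    then have "Def A (length ?xs) P" using F by simp
    then obtain \<phi> where "\<phi> \<in> formulas L A (set ?xs)" "\<And>x. length x = length ?xs \<Longrightarrow> P x = holds S ?xs \<phi> x"
      by (rule Def_formula) auto
    then show "\<exists>\<phi>. \<phi> \<in> formulas L A (set ?xs) \<and> (\<forall>x. length x = n \<longrightarrow> P x = holds S ?xs \<phi> x)" by auto
  qed
  from bchoice[OF this] obtain f where f: "\<And>P. P \<in> F \<Longrightarrow> f P \<in> formulas L A (set ?xs)"
    "\<And>P x. P \<in> F \<Longrightarrow> length x = n \<Longrightarrow> P x = holds S ?xs (f P) x" by blast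
  have "\<exists>e. \<forall>\<phi>\<in>\<Delta>. sat UNIV S \<phi> e" if D: "\<Delta> \<subseteq> f ` F" "finite \<Delta>" for \<Delta>
  proof -
    obtain G where G: "G \<subseteq> F" "finite G" "\<Delta> = f ` G" using finite_subset_image[OF D(2,1)] by blast
    obtain x where x: "length x = n" "\<forall>P\<in>G. P x" using fin[OF G(2,1)] by blast
    have "sat UNIV S (f P) (asg ?xs x)" if "P \<in> G" for P
      using f(2)[of P x] x that G(1) by (auto simp: holds_def)
    then show ?thesis using G(3) by blast
  qed
  moreover have "f ` F \<subseteq> formulas L A (set ?xs)" using f(1) by auto
  ultimately obtain e where e: "\<forall>\<phi>\<in>f ` F. sat UNIV S \<phi> e"
    using sat A unfolding saturated_def by (meson finite_set)
  have "P (map e ?xs)" if "P \<in> F" for P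
    using f[OF that] e that holds_map[of ?xs "f P" S e] by (auto simp: formulas_def)
  then show ?thesis by (intro exI[of _ "map e ?xs"]) auto
qed

end

text \<open>In any language the formulas \<open>v_n = v_n\<close> form an infinite set, so
  \<open>\<kappa>\<close> is uncountable.\<close>

lemma monster_infinite:
  assumes "|formulas L {} UNIV :: ('f, 'r, 'm) fm set| <o \<kappa>" and "Card_order \<kappa>"
  shows "\<not> finite (Field \<kappa>)" and "countable B \<Longrightarrow> |B| <o \<kappa>"
proof -
  let ?F = "formulas L {} UNIV :: ('f, 'r, 'm) fm set"
  have "range (\<lambda>n. Equ (Var n) (Var n)) \<subseteq> ?F" by (auto simp: formulas_def)
  moreover have "inj (\<lambda>n. Equ (Var n) (Var n) :: ('f, 'r, 'm) fm)" by (auto simp: inj_def)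
  ultimately have le: "|UNIV :: nat set| \<le>o |?F|" using card_of_ordLeq by blast
  then have lt: "|UNIV :: nat set| <o \<kappa>" using assms(1) ordLeq_ordLess_trans by blast
  have "|UNIV :: nat set| \<le>o |Field \<kappa>|"
    using lt card_of_Field_ordIso[OF assms(2)] by (meson ordIso_symmetric ordLess_imp_ordLeq ordLeq_ordIso_trans)
  then show "\<not> finite (Field \<kappa>)" using card_of_ordLeq_infinite infinite_UNIV_nat by blast
  assume "countable B"
  then have "|B| \<le>o |UNIV :: nat set|" by (auto simp: countable_def card_of_ordLeq[symmetric])
  then show "|B| <o \<kappa>" using lt ordLeq_ordLess_trans by blast
qed

locale monster = language_structure L S for L :: "('f, 'r) lang" and S :: "('f, 'r, 'm) struct" +
  fixes T :: "('f, 'r, 'm) fm set" and \<kappa> :: "'k rel"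
  assumes monster: "monster_model L T \<kappa> S"

sublocale monster \<subseteq> saturated_definability "fdef L S" "\<lambda>A. |A| <o \<kappa>"
proof
  have \<kappa>: "|formulas L {} UNIV :: ('f, 'r, 'm) fm set| <o \<kappa>" "Card_order \<kappa>"
    using monster by (auto simp: monster_model_def strong_limit_def)
  show "|A \<union> B| <o \<kappa>" if "|A| <o \<kappa>" "countable B" for A B :: "'m set"
    using card_of_Un_ordLess_infinite_Field[OF monster_infinite(1)[OF \<kappa>] \<kappa>(2) that(1)]
      monster_infinite(2)[OF \<kappa> that(2)] by blast
  show "\<exists>x. length x = n \<and> (\<forall>P\<in>F. P x)"
    if "|A| <o \<kappa>" "\<And>P. P \<in> F \<Longrightarrow> Def A n P"
      "\<And>G. finite G \<Longrightarrow> G \<subseteq> F \<Longrightarrow> \<exists>x. length x = n \<and> (\<forall>P\<in>G. P x)" for A F n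
    using saturated_Def[of \<kappa> A F n] that monster by (auto simp: monster_model_def)
qed

context monster
begin

text \<open>A single null formula in the type shows at once that the type is not wide. Conversely, a
  formula \<open>\<psi>\<close> of the ideal implied by the type may have parameters outside
  \<open>A\<close>: an extension of \<open>a\<close> that is wide over these as well realises the
  type but not \<open>\<psi>\<close>.\<close>

lemma wide_tp_iff:
  assumes I: "S1_ideal L S {} xs I" and xs: "distinct xs" and A: "|A| <o \<kappa>" and a: "length a = length xs"
  shows "Defs.wide S I (tp L S xs a A) \<longleftrightarrow> wide (null S xs I) (length xs) A a"
proof
  note S1 = S1_null[OF I xs]
  have sub: "I \<subseteq> formulas L UNIV (set xs)" using I by (simp add: S1_ideal_def ideal_def)
  show "wide (null S xs I) (length xs) A a" if w: "Defs.wide S I (tp L S xs a A)"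
    unfolding wide_def
  proof (intro conjI allI impI notI)
    fix P assume P: "Def A (length xs) P" "P a" and N: "null S xs I P"
    obtain \<phi> where \<phi>: "\<phi> \<in> formulas L A (set xs)" "\<And>x. length x = length xs \<Longrightarrow> P x = holds S xs \<phi> x"
      using Def_formula[OF P(1) xs] by blast
    obtain \<psi> where \<psi>: "\<psi> \<in> I" "\<forall>x. length x = length xs \<longrightarrow> P x = holds S xs \<psi> x"
      using N by (auto simp: null_def)
    have "entails S {\<phi>} \<psi>"
      using \<phi> \<psi> sub by (intro entails_single[OF xs]) (auto simp: formulas_def)
    moreover have "\<phi> \<in> tp L S xs a A" using \<phi> P(2) a by (simp add: tp_def)
    ultimately have "entails S (tp L S xs a A) \<psi>" by (auto simp: entails_def)
    then show False using w \<psi>(1) by (auto simp: Defs.wide_def)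
  qed (fact a)
  show "Defs.wide S I (tp L S xs a A)" if w: "wide (null S xs I) (length xs) A a"
    unfolding Defs.wide_def
  proof
    assume "\<exists>\<psi>\<in>I. entails S (tp L S xs a A) \<psi>"
    then obtain \<psi> where \<psi>: "\<psi> \<in> I" "entails S (tp L S xs a A) \<psi>" by blast
    have small: "|A \<union> pars \<psi>| <o \<kappa>"
      by (rule small_Un[OF A]) (simp add: countable_finite finite_pars)
    obtain a' where a': "wide (null S xs I) (length xs) (A \<union> pars \<psi>) a'" "ty A a a'"
      by (rule wide_extend[OF S1 small _ w]) auto
    have la': "length a' = length xs" using a'(1) by (rule wide_length)
    have "sat UNIV S \<phi> (asg xs a')" if "\<phi> \<in> tp L S xs a A" for \<phi>
    proof -
      have "\<phi> \<in> formulas L A (set xs)" "holds S xs \<phi> a" using that by (auto simp: tp_def)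
      then have "holds S xs \<phi> a'" using ty_D[OF a'(2)] Def_holds[OF xs] a by metis
      then show ?thesis by (simp add: holds_def)
    qed
    then have "holds S xs \<psi> a'" using \<psi>(2) by (auto simp: entails_def holds_def)
    moreover have "\<psi> \<in> formulas L (A \<union> pars \<psi>) (set xs)" using sub \<psi>(1) by (auto simp: formulas_def)
    ultimately have "\<not> null S xs I (holds S xs \<psi>)" using wideD[OF a'(1) Def_holds[OF xs]] by blast
    then show False using \<psi>(1) by (auto simp: null_def)
  qed
qed

end

section \<open>Ladders as independent sequences\<close>

lemma independent_snoc:
  "independent L S xs ys Ix Iy M (cs @ [c]) \<longleftrightarrow> independent L S xs ys Ix Iy M cs \<and>
     wide_entry L S xs ys Ix Iy (M \<union> (\<Union>c\<in>set cs. set (coords c))) c"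
proof -
  have "(\<Union>j<i. set (coords ((cs @ [c]) ! j))) = (\<Union>j<i. set (coords (cs ! j)))" if "i \<le> length cs" for i
    using that by (auto simp: nth_append)
  moreover have "(\<Union>j<length cs. set (coords (cs ! j))) = (\<Union>c\<in>set cs. set (coords c))"
  proof -
    have "set cs = (!) cs ` {..<length cs}" by (auto simp: set_conv_nth)
    then show ?thesis by (metis image_image)
  qed
  ultimately show ?thesis
    unfolding independent_def by (auto simp: less_Suc_eq nth_append)
qed

lemma independent_Nil: "independent L S xs ys Ix Iy M []"
  by (simp add: independent_def)

lemma independent_pair:
  "independent L S xs ys Ix Iy M [c, d] \<longleftrightarrow>
     wide_entry L S xs ys Ix Iy M c \<and> wide_entry L S xs ys Ix Iy (M \<union> set (coords c)) d"
  using independent_snoc[of L S xs ys Ix Iy M "[]" c] independent_snoc[of L S xs ys Ix Iy M "[c]" d]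
  by (simp add: independent_Nil)

lemma rev_upt_Suc: "rev [1..<Suc k] = map (\<lambda>i. k - i) [0..<k]"
  by (rule nth_equalityI) (auto simp: rev_nth simp del: upt_Suc)

lemma ladder_independent:
  assumes "\<And>i. wide_entry L S xs ys Ix Iy (M \<union> (\<Union>j<i. set (s j) \<union> set (t j))) (InX (s i))"
    and "\<And>i. wide_entry L S xs ys Ix Iy (M \<union> (\<Union>j<i. set (s j) \<union> set (t j)) \<union> set (s i)) (InY (t i))"
  shows "independent L S xs ys Ix Iy M (ladder k (\<lambda>i. s (i - 1)) (\<lambda>i. t (i - 1)))"
proof (induction k)
  case (Suc k)
  let ?l = "ladder k (\<lambda>i. s (i - 1)) (\<lambda>i. t (i - 1))"
  have set: "(\<Union>c\<in>set ?l. set (coords c)) = (\<Union>j<k. set (s j) \<union> set (t j))"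
  proof -
    have "{1..<Suc k} = Suc ` {..<k}" by (simp add: image_Suc_lessThan atLeastLessThanSuc_atLeastAtMost)
    then show ?thesis by (simp add: ladder_def del: upt_Suc)
  qed
  have "ladder (Suc k) (\<lambda>i. s (i - 1)) (\<lambda>i. t (i - 1)) = (?l @ [InX (s k)]) @ [InY (t k)]"
    by (simp add: ladder_def)
  moreover have "independent L S xs ys Ix Iy M (?l @ [InX (s k)])"
    unfolding independent_snoc set using Suc assms(1)[of k] by blast
  moreover have "wide_entry L S xs ys Ix Iy (M \<union> (\<Union>c\<in>set (?l @ [InX (s k)]). set (coords c))) (InY (t k))"
  proof -
    have "M \<union> (\<Union>c\<in>set (?l @ [InX (s k)]). set (coords c)) = M \<union> (\<Union>j<k. set (s j) \<union> set (t j)) \<union> set (s k)"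
      using set by auto
    then show ?thesis using assms(2)[of k] by (simp only:)
  qed
  ultimately show ?case by (simp only: independent_snoc)
qed (simp add: ladder_def independent_Nil)

text \<open>Reversal puts the entries of index \<open>k\<close> in front, so index \<open>i\<close>
  of the ladder is the term \<open>k - i\<close> of the sequences and \<open>t 0\<close> is the
  first entry.\<close>

lemma rev_ladder_independent:
  assumes "\<And>i. wide_entry L S xs ys Ix Iy (M \<union> (\<Union>j<i. set (t j) \<union> set (s j))) (InY (t i))"
    and "\<And>i. wide_entry L S xs ys Ix Iy (M \<union> (\<Union>j<i. set (t j) \<union> set (s j)) \<union> set (t i)) (InX (s i))"
  shows "independent L S xs ys Ix Iy M (rev (ladder k (\<lambda>i. s (k - i)) (\<lambda>i. t (k - i))))"
proof -
  let ?l = "\<lambda>n. concat (map (\<lambda>i. [InY (t i), InX (s i)]) [0..<n])"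
  have "rev (ladder k (\<lambda>i. s (k - i)) (\<lambda>i. t (k - i))) =
      concat (map (\<lambda>i. [InY (t (k - i)), InX (s (k - i))]) (rev [1..<Suc k]))"
    by (simp add: ladder_def rev_concat rev_map comp_def del: upt_Suc)
  also have "\<dots> = ?l k"
    unfolding rev_upt_Suc map_map by (intro arg_cong[of _ _ concat] map_cong refl) auto
  finally have eq: "rev (ladder k (\<lambda>i. s (k - i)) (\<lambda>i. t (k - i))) = ?l k" .
  have "independent L S xs ys Ix Iy M (?l n)" for n
  proof (induction n)
    case (Suc n)
    have set: "(\<Union>c\<in>set (?l n). set (coords c)) = (\<Union>j<n. set (t j) \<union> set (s j))"
      by (auto simp: lessThan_atLeast0)
    have "?l (Suc n) = (?l n @ [InY (t n)]) @ [InX (s n)]" by simp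
    moreover have "independent L S xs ys Ix Iy M (?l n @ [InY (t n)])"
      unfolding independent_snoc set using Suc assms(1)[of n] by blast
    moreover have "wide_entry L S xs ys Ix Iy (M \<union> (\<Union>c\<in>set (?l n @ [InY (t n)]). set (coords c))) (InX (s n))"
    proof -
      have "M \<union> (\<Union>c\<in>set (?l n @ [InY (t n)]). set (coords c)) = M \<union> (\<Union>j<n. set (t j) \<union> set (s j)) \<union> set (t n)"
        using set by auto
      then show ?thesis using assms(2)[of n] by (simp only:)
    qed
    ultimately show ?case by (simp only: independent_snoc)
  qed (simp add: independent_Nil)
  then show ?thesis using eq by simp
qed

theorem theorem3p3:
  fixes L :: "('f, 'r) lang"
    and T :: "('f, 'r, 'm) fm set"
    and \<kappa> :: "'k rel"
    and S :: "('f, 'r, 'm) struct"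
    and xs ys :: "nat list"
    and Ix Iy :: "('f, 'r, 'm) fm set"
    and \<phi> :: "('f, 'r, 'm) fm"
    and M :: "'m set"
    and a a' b b' :: "'m list"
  assumes "complete_theory L T"
    and "monster_model L T \<kappa> S"
    and "distinct (xs @ ys)"
    and "S1_ideal L S {} xs Ix"
    and "S1_ideal L S {} ys Iy"
    and "\<phi> \<in> formulas L {} (set xs \<union> set ys)"
    and "I_stable L \<kappa> S xs ys Ix Iy \<phi>"
    and "small_model L \<kappa> S M"
    and "length a = length xs" and "length b = length ys"
    and "independent L S xs ys Ix Iy M [InX a, InY b] \<or>
         independent L S xs ys Ix Iy M [InY b, InX a]"
    and "same_type L S M a a'" and "same_type L S M b b'"
    and "independent L S xs ys Ix Iy M [InX a', InY b'] \<or>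
         independent L S xs ys Ix Iy M [InY b', InX a']"
  shows "holds S (xs @ ys) \<phi> (a @ b) \<longleftrightarrow> holds S (xs @ ys) \<phi> (a' @ b')"
proof -
  interpret monster L S T \<kappa> by unfold_locales fact
  have M: "elementary_substructure L S M" "|M| <o \<kappa>" using assms(8) by (auto simp: small_model_def)
  interpret over_model "fdef L S" "\<lambda>A. |A| <o \<kappa>" M
    by unfold_locales (use M elementary_substructure_model[OF M(1)] in auto)
  have dist: "distinct xs" "distinct ys" using assms(3) by auto
  define m n N N' where mn: "m = length xs" "n = length ys" "N = null S xs Ix" "N' = null S ys Iy"
  have S1: "S1 m N" "S1 n N'" unfolding mn by (rule S1_null; fact)+
  \<comment> \<open>Only countable sets are ever added to \<open>M\<close>, so the parameter sets
    stay small and wideness of tuples agrees with wideness of their types.\<close>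
  have wx: "wide_entry L S xs ys Ix Iy (M \<union> B) (InX c) \<longleftrightarrow> wide N m (M \<union> B) c"
    and wy: "wide_entry L S xs ys Ix Iy (M \<union> B) (InY c) \<longleftrightarrow> wide N' n (M \<union> B) c"
    if "countable B" for B c
    using wide_tp_iff[OF assms(4) dist(1) small_Un[OF M(2) that]]
      wide_tp_iff[OF assms(5) dist(2) small_Un[OF M(2) that]]
    by (auto simp: mn dest: wide_length)
  have pair1: "independent L S xs ys Ix Iy M [InX c, InY d] \<longleftrightarrow> wide N m M c \<and> wide N' n (M \<union> set c) d"
    and pair2: "independent L S xs ys Ix Iy M [InY d, InX c] \<longleftrightarrow> wide N' n M d \<and> wide N m (M \<union> set d) c" for c d
    using wx[of "{}" c] wx[of "set d" c] wy[of "{}" d] wy[of "set c" d]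
    by (simp_all add: independent_pair countable_finite)
  have wide: "wide N m M a" "wide N' n M b"
    using assms(11) unfolding pair1 pair2 by (auto intro: wide_mono)
  define \<rho> where "\<rho> x y = holds S (xs @ ys) \<phi> (x @ y)" for x y
  interpret two_sorts "fdef L S" "\<lambda>A. |A| <o \<kappa>" M m n N N' \<rho> a b
  proof unfold_locales
    have "Def {} (length (xs @ ys)) (holds S (xs @ ys) \<phi>)"
      by (rule Def_holds) (use assms(3,6) in auto)
    then have "Def M (m + n) (holds S (xs @ ys) \<phi>)" using Def_mono[of "{}" _ _ M] by (simp add: mn)
    then show "Def M (m + n) (\<lambda>w. \<rho> (take m w) (drop m w))"
      by (simp add: \<rho>_def)
    fix s t :: "nat \<Rightarrow> 'm list" and \<epsilon>
    assume s: "\<And>i. wide N m (M \<union> (\<Union>j<i. set (s j) \<union> set (t j))) (s i)"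
      and t: "\<And>i. wide N' n (M \<union> (\<Union>j\<le>i. set (s j)) \<union> (\<Union>j<i. set (t j))) (t i)"
    show "\<exists>i j. (\<rho> (s i) (t j) = \<epsilon>) \<noteq> (i \<le> j)"
    proof (rule ccontr)
      assume "\<nexists>i j. (\<rho> (s i) (t j) = \<epsilon>) \<noteq> (i \<le> j)"
      then have st: "(\<rho> (s i) (t j) = \<epsilon>) = (i \<le> j)" for i j by blast
      obtain k where "I_stable_of_ladder L \<kappa> S xs ys Ix Iy k \<phi>"
        using assms(7) by (auto simp: I_stable_def)
      then have no: "\<not> (\<forall>i\<in>{1..k}. \<forall>j\<in>{1..k}. \<rho> (c i) (d j) \<longleftrightarrow> i \<le> j)"
        if "independent L S xs ys Ix Iy M (ladder k c d) \<or> independent L S xs ys Ix Iy M (rev (ladder k c d))"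
        for c d using that assms(8) unfolding I_stable_of_ladder_def \<rho>_def by blast
      \<comment> \<open>The sign decides the orientation: \<open>True\<close> gives a ladder
        independent in its own order, \<open>False\<close> one whose reversal is
        independent.\<close>
      show False
      proof (cases \<epsilon>)
        case True
        have "independent L S xs ys Ix Iy M (ladder k (\<lambda>i. s (i - 1)) (\<lambda>i. t (i - 1)))"
        proof (rule ladder_independent)
          show "wide_entry L S xs ys Ix Iy (M \<union> (\<Union>j<i. set (s j) \<union> set (t j))) (InX (s i))" for i
            using s wx by (simp add: countable_finite)
          fix i
          have "wide N' n (M \<union> ((\<Union>j<i. set (s j) \<union> set (t j)) \<union> set (s i))) (t i)"
            by (rule wide_mono[OF t]) auto
          then show "wide_entry L S xs ys Ix Iy (M \<union> (\<Union>j<i. set (s j) \<union> set (t j)) \<union> set (s i)) (InY (t i))"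
            unfolding Un_assoc by (subst wy) (auto simp: countable_finite)
        qed
        moreover have "\<rho> (s (i - 1)) (t (j - 1)) \<longleftrightarrow> i \<le> j" if "i \<in> {1..k}" "j \<in> {1..k}" for i j
          using st[of "i - 1" "j - 1"] True that by auto
        ultimately show False using no by blast
      next
        case False
        \<comment> \<open>The term \<open>s 0\<close> is dropped, and
          \<open>t 0, s 1, t 1, s 2, ...\<close> is used. Here
          \<open>\<rho> (s (Suc i)) (t j)\<close> holds iff \<open>j \<le> i\<close>, so counting
          both indices down from \<open>k\<close> restores \<open>i \<le> j\<close>.\<close>
        have "independent L S xs ys Ix Iy M (rev (ladder k (\<lambda>i. s (Suc (k - i))) (\<lambda>i. t (k - i))))"
        proof (rule rev_ladder_independent)
          fix i
          have "wide N' n (M \<union> (\<Union>j<i. set (t j) \<union> set (s (Suc j)))) (t i)"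
            by (rule wide_mono[OF t]) (auto simp: less_eq_Suc_le)
          then show "wide_entry L S xs ys Ix Iy (M \<union> (\<Union>j<i. set (t j) \<union> set (s (Suc j)))) (InY (t i))"
            by (subst wy) (auto simp: countable_finite)
          have "wide N m (M \<union> ((\<Union>j<i. set (t j) \<union> set (s (Suc j))) \<union> set (t i))) (s (Suc i))"
            by (rule wide_mono[OF s]) (auto simp: less_Suc_eq)
          then show "wide_entry L S xs ys Ix Iy (M \<union> (\<Union>j<i. set (t j) \<union> set (s (Suc j))) \<union> set (t i)) (InX (s (Suc i)))"
            unfolding Un_assoc by (subst wx) (auto simp: countable_finite)
        qed
        moreover have "\<rho> (s (Suc (k - i))) (t (k - j)) \<longleftrightarrow> i \<le> j" if "i \<in> {1..k}" "j \<in> {1..k}" for i j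
          using st[of "Suc (k - i)" "k - j"] False that by auto
        ultimately show False using no by blast
      qed
    qed
  qed (use S1 wide in auto)
  have "\<rho> a b = \<rho> a' b'"
  proof (rule rel_unique)
    show "ty M a a'" "ty M b b'" using assms(12,13) by (simp_all add: same_type_iff)
  qed (use assms(11,14) in \<open>auto simp: pair1 pair2\<close>)
  then show ?thesis by (simp add: \<rho>_def)
qed

end
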